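(* Let $\mathcal H$ be an infinite-dimensional complex Hilbert space, let $(E,\|\cdot\|_E)$ with $E\subset c_0$ be a fully symmetric sequence space, and let $(\mathcal C_E,\|\cdot\|_{\mathcal C_E})$ be the Banach ideal of compact operators on $\mathcal H$ associated with $E$. The following conditions are equivalent: (i) for every Dunford-Schwartz operator $T$ (acting on $\mathcal C_E$) the averages $A_n(T)=\frac1{n+1}\sum_{k=0}^nT^k$ converge strongly in $\mathcal C_E$, that is, for every $x\in\mathcal C_E$ there exists $\widehat x\in\mathcal C_E$ such that $\|A_n(T)(x)-\widehat x\|_{\mathcal C_E}\to0$ as $n\to\infty$; (ii) $(E,\|\cdot\|_E)$ is separable and $E\ne l^1$ as sets.
   Context: $\mathcal B(\mathcal H)$ and $\mathcal K(\mathcal H)$ are the algebras of bounded, respectively compact, linear operators on $\mathcal H$, and $\|\cdot\|_\infty$ is the operator norm. $\mathcal H$ is not assumed separable. $\mathcal C^1$ is the trace class with norm $\|x\|_1=\tau(|x|)$, $\tau$ the canonical trace. A linear operator $T:\mathcal B(\mathcal H)\to\mathcal B(\mathcal H)$ is a Dunford-Schwartz operator if $\|T(x)\|_1\le\|x\|_1$ for all $x\in\mathcal C^1$ and $\|T(x)\|_\infty\le\|x\|_\infty$ for all $x\in\mathcal B(\mathcal H)$. Such a $T$ maps $\mathcal C_E$ into $\mathcal C_E$ whenever $E\subset c_0$ is fully symmetric. $l^\infty$, $c_0$, $l^1$ are the spaces of complex sequences (indexed by $n\ge 1$) that are bounded, converge to $0$, are absolutely summable, respectively. For $\xi=\{\xi_n\}\in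 l^\infty$ the non-increasing rearrangement is $\xi^*=\{\xi^*_n\}$, $\xi_n^*=\inf\{\sup_{m\notin F}|\xi_m| : F\subset\mathbb N,\ |F|<n\}$. Write $\xi\prec\prec\eta$ if $\sum_{n=1}^m\xi_n^*\le\sum_{n=1}^m\eta_n^*$ for all $m\in\mathbb N$. A fully symmetric sequence space is a non-zero linear subspace $E\subset l^\infty$ with a complete norm $\|\cdot\|_E$ such that $\eta\in E$, $\xi\in l^\infty$, $\xi\prec\prec\eta$ imply $\xi\in E$ and $\|\xi\|_E\le\|\eta\|_E$. For $x\in\mathcal K(\mathcal H)$, $\{s_n(x)\}_{n=1}^\infty$ are the singular values of $x$ (eigenvalues of $|x|$ in decreasing order, counted with multiplicity, completed by zeros if there are finitely many). $\mathcal C_E=\{x\in\mathcal K(\mathcal H):\{s_n(x)\}\in E\}$ with norm $\|x\|_{\mathcal C_E}=\|\{s_n(x)\}\|_E$. *)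

theory Defs
  imports "HOL-Analysis.Analysis"
begin

section \<open>Complex Hilbert spaces\<close>

class scaleC =
  fixes scaleC :: "complex \<Rightarrow> 'a \<Rightarrow> 'a" (infixr "*\<^sub>C" 75)

class complex_vector = real_vector + scaleC +
  assumes scaleC_add_right: "c *\<^sub>C (x + y) = c *\<^sub>C x + c *\<^sub>C y"
    and scaleC_add_left: "(c + d) *\<^sub>C x = c *\<^sub>C x + d *\<^sub>C x"
    and scaleC_scaleC: "c *\<^sub>C d *\<^sub>C x = (c * d) *\<^sub>C x"
    and scaleC_one: "1 *\<^sub>C x = x"
    and scaleR_scaleC: "r *\<^sub>R x = complex_of_real r *\<^sub>C x"

text \<open>The inner product is linear in its first argument. The equation
  \<open>cinner_norm\<close> contains positive definiteness, and \<^class>\<open>banach\<close>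
  supplies completeness. There is no separability assumption.\<close>

class complex_hilbert = complex_vector + banach +
  fixes cinner :: "'a \<Rightarrow> 'a \<Rightarrow> complex"
  assumes cinner_commute: "cinner x y = cnj (cinner y x)"
    and cinner_add_left: "cinner (x + y) z = cinner x z + cinner y z"
    and cinner_scaleC_left: "cinner (c *\<^sub>C x) y = c * cinner x y"
    and cinner_norm: "cinner x x = complex_of_real ((norm x)\<^sup>2)"

global_interpretation complex_vector: vector_space "scaleC :: complex \<Rightarrow> 'a \<Rightarrow> 'a::complex_vector"
  defines cspan = complex_vector.span
    and cdim = complex_vector.dim
  by standard (auto simp: scaleC_add_right scaleC_add_left scaleC_scaleC scaleC_one)

abbreviation clinear :: "('a::complex_vector \<Rightarrow> 'b::complex_vector) \<Rightarrow> bool"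
  where "clinear f \<equiv> Vector_Spaces.linear scaleC scaleC f"

lemma clinear_iff:
  "clinear f \<longleftrightarrow> (\<forall>x y. f (x + y) = f x + f y) \<and> (\<forall>c x. f (c *\<^sub>C x) = c *\<^sub>C f x)"
  by (simp add: Vector_Spaces.linear_iff complex_vector.vector_space_axioms)

definition infinite_dimensional :: "'a::complex_vector itself \<Rightarrow> bool"
  where "infinite_dimensional _ \<longleftrightarrow> (\<nexists>S::'a set. finite S \<and> cspan S = UNIV)"


section \<open>Bounded operators\<close>

typedef (overloaded) 'a bop =
  "{f :: 'a::complex_hilbert \<Rightarrow> 'a. clinear f \<and> bounded_linear f}"
  morphisms bop_apply Abs_bop
proof (rule exI[of _ "\<lambda>_. 0"])
  show "(\<lambda>_. 0) \<in> {f :: 'a \<Rightarrow> 'a. clinear f \<and> bounded_linear f}"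
    by (auto simp: clinear_iff complex_vector.scale_zero_right)
qed

setup_lifting type_definition_bop

lemma scaleC_uminus: "c *\<^sub>C (- x) = - (c *\<^sub>C (x::'a::complex_vector))"
  by (rule complex_vector.scale_minus_right)

lemma scaleC_diff: "c *\<^sub>C (x - y) = c *\<^sub>C x - c *\<^sub>C (y::'a::complex_vector)"
  by (rule complex_vector.scale_right_diff_distrib)

lemma norm_scaleC: "norm (c *\<^sub>C x) = cmod c * norm (x::'a::complex_hilbert)"
proof -
  have "complex_of_real ((norm (c *\<^sub>C x))\<^sup>2) = c * cnj c * cinner x x"
    by (metis cinner_commute cinner_norm cinner_scaleC_left complex_cnj_mult mult.assoc)
  also have "\<dots> = complex_of_real ((cmod c * norm x)\<^sup>2)"
    by (simp only: cinner_norm complex_norm_square[symmetric] power_mult_distrib of_real_mult)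
  finally have "(norm (c *\<^sub>C x))\<^sup>2 = (cmod c * norm x)\<^sup>2"
    using of_real_eq_iff by blast
  then show ?thesis
    by (simp add: power2_eq_iff_nonneg)
qed

lemma bounded_linear_scaleC: "bounded_linear (\<lambda>x::'a::complex_hilbert. c *\<^sub>C x)"
  by (rule bounded_linear_intro[of _ "cmod c"])
     (auto simp: scaleC_add_right scaleR_scaleC scaleC_scaleC norm_scaleC mult.commute)

instantiation bop :: (complex_hilbert) real_normed_vector
begin

lift_definition zero_bop :: "'a bop" is "\<lambda>_. 0"
  by (auto simp: clinear_iff)

lift_definition plus_bop :: "'a bop \<Rightarrow> 'a bop \<Rightarrow> 'a bop" is "\<lambda>f g x. f x + g x"
  by (auto simp: clinear_iff scaleC_add_right bounded_linear_add)

lift_definition minus_bop :: "'a bop \<Rightarrow> 'a bop \<Rightarrow> 'a bop" is "\<lambda>f g x. f x - g x"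
  by (auto simp: clinear_iff scaleC_diff bounded_linear_sub)

lift_definition uminus_bop :: "'a bop \<Rightarrow> 'a bop" is "\<lambda>f x. - f x"
  by (auto simp: clinear_iff scaleC_uminus bounded_linear_minus)

lift_definition scaleR_bop :: "real \<Rightarrow> 'a bop \<Rightarrow> 'a bop" is "\<lambda>r f x. r *\<^sub>R f x"
  by (auto simp: clinear_iff scaleR_scaleC scaleC_add_right scaleC_scaleC mult.commute
      intro: bounded_linear_compose[OF bounded_linear_scaleC])

lift_definition norm_bop :: "'a bop \<Rightarrow> real" is onorm .

definition "dist_bop (f::'a bop) g = norm (f - g)"

definition "sgn_bop (f::'a bop) = inverse (norm f) *\<^sub>R f"

definition [code del]:
  "(uniformity :: ('a bop \<times> 'a bop) filter) = (INF e\<in>{0 <..}. principal {(x, y). dist x y < e})"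

definition [code del]:
  "open (S :: 'a bop set) \<longleftrightarrow> (\<forall>x\<in>S. \<forall>\<^sub>F (x', y) in uniformity. x' = x \<longrightarrow> y \<in> S)"

instance
proof
  fix f g h :: "'a bop" and r s :: real
  show "f + g + h = f + (g + h)" by transfer (simp add: add.assoc)
  show "f + g = g + f" by transfer (simp add: add.commute)
  show "0 + f = f" by transfer simp
  show "- f + f = 0" by transfer simp
  show "f - g = f + - g" by transfer simp
  show "r *\<^sub>R (f + g) = r *\<^sub>R f + r *\<^sub>R g" by transfer (simp add: scaleR_add_right)
  show "(r + s) *\<^sub>R f = r *\<^sub>R f + s *\<^sub>R f" by transfer (simp add: scaleR_add_left)
  show "r *\<^sub>R s *\<^sub>R f = (r * s) *\<^sub>R f" by transfer simp
  show "1 *\<^sub>R f = f" by transfer simp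
  show "dist f g = norm (f - g)" by (rule dist_bop_def)
  show "sgn f = inverse (norm f) *\<^sub>R f" by (rule sgn_bop_def)
  show "(uniformity :: ('a bop \<times> 'a bop) filter) = (INF e\<in>{0 <..}. principal {(x, y). dist x y < e})"
    by (rule uniformity_bop_def)
  show "open S \<longleftrightarrow> (\<forall>x\<in>S. \<forall>\<^sub>F (x', y) in uniformity. x' = x \<longrightarrow> y \<in> S)" for S :: "'a bop set"
    by (rule open_bop_def)
  show "norm f = 0 \<longleftrightarrow> f = 0" by transfer (auto simp: onorm_eq_0)
  show "norm (f + g) \<le> norm f + norm g" by transfer (auto simp: onorm_triangle)
  show "norm (r *\<^sub>R f) = \<bar>r\<bar> * norm f" by transfer (auto simp: onorm_scaleR)
qed

end

instantiation bop :: (complex_hilbert) complex_vector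
begin

lift_definition scaleC_bop :: "complex \<Rightarrow> 'a bop \<Rightarrow> 'a bop" is "\<lambda>c f x. c *\<^sub>C f x"
  by (auto simp: clinear_iff scaleC_add_right scaleC_scaleC mult.commute
      intro: bounded_linear_compose[OF bounded_linear_scaleC])

instance
  by standard (transfer, auto simp: scaleC_add_right scaleC_add_left scaleC_scaleC scaleC_one
      scaleR_scaleC)+

end

lift_definition bop_comp :: "'a::complex_hilbert bop \<Rightarrow> 'a bop \<Rightarrow> 'a bop" is "\<lambda>f g x. f (g x)"
  by (auto simp: clinear_iff bounded_linear_compose)

definition adjoint_bop :: "'a::complex_hilbert bop \<Rightarrow> 'a bop"
  where "adjoint_bop x = (THE y. \<forall>u v. cinner (bop_apply x u) v = cinner u (bop_apply y v))"

definition positive_bop :: "'a::complex_hilbert bop \<Rightarrow> bool"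
  where "positive_bop a \<longleftrightarrow>
    (\<forall>u. Im (cinner (bop_apply a u) u) = 0 \<and> 0 \<le> Re (cinner (bop_apply a u) u))"

text \<open>\<open>|x|\<close> is the unique positive square root of \<open>x* x\<close>.\<close>

definition abs_bop :: "'a::complex_hilbert bop \<Rightarrow> 'a bop"
  where "abs_bop x = (THE a. positive_bop a \<and> bop_comp a a = bop_comp (adjoint_bop x) x)"

definition compact_bop :: "'a::complex_hilbert bop \<Rightarrow> bool"
  where "compact_bop x \<longleftrightarrow> compact (closure (bop_apply x ` cball 0 1))"


section \<open>The canonical trace and the trace norm\<close>

definition orthonormal_basis :: "'a::complex_hilbert set \<Rightarrow> bool"
  where "orthonormal_basis B \<longleftrightarrow>
    (\<forall>e\<in>B. \<forall>f\<in>B. cinner e f = (if e = f then 1 else 0)) \<and> closure (cspan B) = UNIV"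

text \<open>The trace is used on positive operators only, where it takes values in
  \<open>[0, \<infinity>]\<close> and does not depend on the orthonormal basis, which may be uncountable.\<close>

definition trace_bop :: "'a::complex_hilbert bop \<Rightarrow> ennreal"
  where "trace_bop a =
    (\<Sum>\<^sub>\<infinity>e\<in>(SOME B. orthonormal_basis B). ennreal (Re (cinner (bop_apply a e) e)))"

definition trace_norm :: "'a::complex_hilbert bop \<Rightarrow> ennreal"
  where "trace_norm x = trace_bop (abs_bop x)"

definition trace_class :: "'a::complex_hilbert bop set"
  where "trace_class = {x. trace_norm x < \<infinity>}"


section \<open>Sequence spaces\<close>

text \<open>Sequences are indexed from 0: position \<open>n\<close> holds the term with index \<open>n + 1\<close> in the
  usual numbering. This is why \<open>card F \<le> n\<close> replaces \<open>|F| < n\<close> in the rearrangement.\<close>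

definition linf :: "(nat \<Rightarrow> complex) set"
  where "linf = {\<xi>. bounded (range \<xi>)}"

definition c0 :: "(nat \<Rightarrow> complex) set"
  where "c0 = {\<xi>. \<xi> \<longlonglongrightarrow> 0}"

definition l1 :: "(nat \<Rightarrow> complex) set"
  where "l1 = {\<xi>. summable (\<lambda>n. norm (\<xi> n))}"

definition rearrangement :: "(nat \<Rightarrow> complex) \<Rightarrow> nat \<Rightarrow> real"
  where "rearrangement \<xi> n = (INF F\<in>{F. finite F \<and> card F \<le> n}. SUP m\<in>- F. norm (\<xi> m))"

definition submajorized :: "(nat \<Rightarrow> complex) \<Rightarrow> (nat \<Rightarrow> complex) \<Rightarrow> bool" (infix "\<prec>\<prec>" 50)
  where "\<xi> \<prec>\<prec> \<eta> \<longleftrightarrow> (\<forall>m. (\<Sum>n<m. rearrangement \<xi> n) \<le> (\<Sum>n<m. rearrangement \<eta> n))"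

locale fully_symmetric_space =
  fixes E :: "(nat \<Rightarrow> complex) set" and norm_E :: "(nat \<Rightarrow> complex) \<Rightarrow> real"
  assumes subset_linf: "E \<subseteq> linf"
    and zero_mem: "(\<lambda>_. 0) \<in> E"
    and add_mem: "\<xi> \<in> E \<Longrightarrow> \<eta> \<in> E \<Longrightarrow> (\<lambda>n. \<xi> n + \<eta> n) \<in> E"
    and scale_mem: "\<xi> \<in> E \<Longrightarrow> (\<lambda>n. c * \<xi> n) \<in> E"
    and nonzero: "E \<noteq> {\<lambda>_. 0}"
    and norm_nonneg: "\<xi> \<in> E \<Longrightarrow> 0 \<le> norm_E \<xi>"
    and norm_eq_0: "\<xi> \<in> E \<Longrightarrow> norm_E \<xi> = 0 \<longleftrightarrow> \<xi> = (\<lambda>_. 0)"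
    and norm_triangle: "\<xi> \<in> E \<Longrightarrow> \<eta> \<in> E \<Longrightarrow> norm_E (\<lambda>n. \<xi> n + \<eta> n) \<le> norm_E \<xi> + norm_E \<eta>"
    and norm_scale: "\<xi> \<in> E \<Longrightarrow> norm_E (\<lambda>n. c * \<xi> n) = cmod c * norm_E \<xi>"
    and norm_complete: "(\<And>k. X k \<in> E) \<Longrightarrow>
      (\<forall>e>0. \<exists>K. \<forall>k\<ge>K. \<forall>l\<ge>K. norm_E (\<lambda>n. X k n - X l n) < e) \<Longrightarrow>
      \<exists>\<xi>\<in>E. (\<lambda>k. norm_E (\<lambda>n. X k n - \<xi> n)) \<longlonglongrightarrow> 0"
    and fully_symmetric_mem: "\<eta> \<in> E \<Longrightarrow> \<xi> \<in> linf \<Longrightarrow> \<xi> \<prec>\<prec> \<eta> \<Longrightarrow> \<xi> \<in> E"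
    and fully_symmetric_norm: "\<eta> \<in> E \<Longrightarrow> \<xi> \<in> linf \<Longrightarrow> \<xi> \<prec>\<prec> \<eta> \<Longrightarrow> norm_E \<xi> \<le> norm_E \<eta>"

definition separable_seq_space :: "(nat \<Rightarrow> complex) set \<Rightarrow> ((nat \<Rightarrow> complex) \<Rightarrow> real) \<Rightarrow> bool"
  where "separable_seq_space E norm_E \<longleftrightarrow>
    (\<exists>D. countable D \<and> D \<subseteq> E \<and> (\<forall>\<xi>\<in>E. \<forall>e>0. \<exists>\<delta>\<in>D. norm_E (\<lambda>n. \<xi> n - \<delta> n) < e))"


section \<open>Singular values and the ideals associated with sequence spaces\<close>

text \<open>For compact \<open>x\<close>, the singular value sequence is the unique non-increasing sequence of
  nonnegative reals in which every \<open>t > 0\<close> occurs as often as its multiplicity as an eigenvalue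
  of \<open>|x|\<close> (never, if it is not an eigenvalue). The eigenvalue 0 is not counted: zeros occur
  only to complete the sequence when there are finitely many positive eigenvalues.\<close>

definition eigenspace_bop :: "'a::complex_hilbert bop \<Rightarrow> real \<Rightarrow> 'a set"
  where "eigenspace_bop a t = {v. bop_apply a v = t *\<^sub>R v}"

definition singular_values :: "'a::complex_hilbert bop \<Rightarrow> nat \<Rightarrow> real"
  where "singular_values x = (THE s. decseq s \<and> (\<forall>n. 0 \<le> s n) \<and>
    (\<forall>t>0. finite {n. s n = t} \<and> card {n. s n = t} = cdim (eigenspace_bop (abs_bop x) t)))"

definition op_ideal :: "(nat \<Rightarrow> complex) set \<Rightarrow> 'a::complex_hilbert bop set"
  where "op_ideal E = {x. compact_bop x \<and> (\<lambda>n. complex_of_real (singular_values x n)) \<in> E}"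

definition op_ideal_norm :: "((nat \<Rightarrow> complex) \<Rightarrow> real) \<Rightarrow> 'a::complex_hilbert bop \<Rightarrow> real"
  where "op_ideal_norm norm_E x = norm_E (\<lambda>n. complex_of_real (singular_values x n))"


section \<open>Dunford-Schwartz operators\<close>

definition dunford_schwartz :: "('a::complex_hilbert bop \<Rightarrow> 'a bop) \<Rightarrow> bool"
  where "dunford_schwartz T \<longleftrightarrow> clinear T \<and>
    (\<forall>x\<in>trace_class. trace_norm (T x) \<le> trace_norm x) \<and> (\<forall>x. norm (T x) \<le> norm x)"

definition ergodic_average :: "('a::complex_hilbert bop \<Rightarrow> 'a bop) \<Rightarrow> nat \<Rightarrow> 'a bop \<Rightarrow> 'a bop"
  where "ergodic_average T n x = (1 / real (n + 1)) *\<^sub>R (\<Sum>k=0..n. (T ^^ k) x)"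

end

theory Submission
  imports Defs
begin

text \<open>Write \<open>\<phi> n\<close> for the norm in \<open>E\<close> of the indicator of \<open>n\<close> indices. The two conditions in
  (ii) are analytic properties of \<open>E\<close> in disguise. Separability of \<open>E\<close> means that finitely
  supported sequences are dense, equivalently that the left shifts of every non-increasing element
  tend to 0 in norm (\<open>separable_imp_shift_tendsto_0\<close>, \<open>separableI\<close>). And \<open>E \<noteq> l\<^sup>1\<close> means
  \<open>\<phi> n / n \<longlonglongrightarrow> 0\<close> (\<open>\<phi>_ratio_tendsto_0\<close>, \<open>\<phi>_ratio_imp_not_l1\<close>), so that sequences bounded in
  \<open>l\<^sup>1\<close> and small in supremum norm are small in \<open>E\<close>.

  Sufficiency. The sum of the first \<open>k\<close> singular values of a compact operator is the Ky Fan norm,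
  a supremum of \<open>\<Sum> |\<langle>x u\<^sub>i, v\<^sub>i\<rangle>|\<close> over orthonormal systems, and at the same time the K-functional
  between the trace norm and the operator norm: \<open>x\<close> splits into \<open>\<Sum> (s\<^sub>n - s\<^sub>k) \<langle>\<cdot>, e\<^sub>n\<rangle> f\<^sub>n\<close> and a
  remainder of norm at most \<open>s\<^sub>k\<close>. The first description makes Ky Fan sums subadditive; the second shows
  that a Dunford-Schwartz operator \<open>T\<close> decreases singular values in the sense of submajorization
  (\<open>dunford_schwartz_singular_values\<close>). Hence \<open>T\<close> contracts \<open>\<C>\<^sub>E\<close> and also the
  Hilbert-Schmidt norm. The latter satisfies the parallelogram law, which makes the averages of a
  Hilbert-Schmidt operator Cauchy (\<open>parallelogram_averages_Cauchy\<close>). For a rank one operator they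
  are therefore Cauchy in operator norm and bounded in trace norm, hence Cauchy in \<open>\<C>\<^sub>E\<close> when
  \<open>\<phi> n / n \<longlonglongrightarrow> 0\<close>. If \<open>E\<close> is separable, finite rank operators are dense in \<open>\<C>\<^sub>E\<close>, and
  contractivity together with completeness of \<open>\<C>\<^sub>E\<close> finishes the argument
  (\<open>averages_converge\<close>).

  Necessity. One operator serves both conditions: \<open>T x = V x V*\<close>, where \<open>V\<close> shifts an orthonormal
  sequence. It acts on a diagonal operator by shifting the diagonal to the right. For the
  diagonal \<open>(1, 0, 0, ...)\<close> the averages have norm \<open>\<phi> (n+1) / (n+1)\<close>; for a non-increasing diagonal
  \<open>s\<close> they dominate \<open>s\<close> from place \<open>n\<close> on. In both cases the limit vanishes on the orthonormal
  sequence, because each single diagonal entry tends to 0, so convergence forces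
  \<open>\<phi> n / n \<longlonglongrightarrow> 0\<close> and the shifts of \<open>s\<close> to tend to 0 (\<open>shift_average_small\<close>).

  Much of the text supplies operator theory for possibly non-separable Hilbert spaces:
  square roots, the spectral theorem for compact operators in the form of a singular value
  decomposition indexed by the natural numbers, and the comparison of the trace over an uncountable
  basis with singular values.\<close>

section \<open>Geometry of complex Hilbert spaces\<close>

lemma cinner_add_right: "cinner x (y + z) = cinner x y + cinner x (z::'a::complex_hilbert)"
  by (metis cinner_add_left cinner_commute complex_cnj_add)

lemma cinner_scaleC_right: "cinner x (c *\<^sub>C y) = cnj c * cinner x (y::'a::complex_hilbert)"
  by (metis cinner_commute cinner_scaleC_left complex_cnj_mult)

lemma cinner_zero_left [simp]: "cinner 0 (y::'a::complex_hilbert) = 0"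
  using cinner_scaleC_left[of 0 0 y] by (simp add: complex_vector.scale_zero_left)

lemma cinner_zero_right [simp]: "cinner (y::'a::complex_hilbert) 0 = 0"
  by (metis cinner_commute cinner_zero_left complex_cnj_zero)

lemma cinner_minus_left: "cinner (- x) y = - cinner x (y::'a::complex_hilbert)"
proof -
  have "cinner x y + cinner (- x) y = 0"
    unfolding cinner_add_left[symmetric] by simp
  then show ?thesis
    by (metis minus_unique)
qed

lemma cinner_minus_right: "cinner x (- y) = - cinner x (y::'a::complex_hilbert)"
  by (metis cinner_commute cinner_minus_left complex_cnj_minus)

lemma cinner_diff_left: "cinner (x - y) z = cinner x z - cinner y (z::'a::complex_hilbert)"
  using cinner_add_left[of x "- y" z] by (simp add: cinner_minus_left)

lemma cinner_diff_right: "cinner x (y - z) = cinner x y - cinner x (z::'a::complex_hilbert)"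
  using cinner_add_right[of x y "- z"] by (simp add: cinner_minus_right)

lemma cinner_scaleR_left: "cinner (r *\<^sub>R x) y = of_real r * cinner x (y::'a::complex_hilbert)"
  by (simp add: scaleR_scaleC cinner_scaleC_left)

lemma cinner_scaleR_right: "cinner x (r *\<^sub>R y) = of_real r * cinner x (y::'a::complex_hilbert)"
  by (simp add: scaleR_scaleC cinner_scaleC_right)

lemma cinner_sum_left: "cinner (sum f A) y = (\<Sum>i\<in>A. cinner (f i) (y::'a::complex_hilbert))"
  by (induction A rule: infinite_finite_induct) (auto simp: cinner_add_left)

lemma cinner_sum_right: "cinner y (sum f A) = (\<Sum>i\<in>A. cinner (y::'a::complex_hilbert) (f i))"
  by (induction A rule: infinite_finite_induct) (auto simp: cinner_add_right)

lemmas cinner_linear = cinner_add_left cinner_add_right cinner_minus_left cinner_minus_right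
  cinner_diff_left cinner_diff_right cinner_scaleC_left cinner_scaleC_right
  cinner_scaleR_left cinner_scaleR_right

lemma Re_cinner_self: "Re (cinner x x) = (norm (x::'a::complex_hilbert))\<^sup>2"
  by (simp add: cinner_norm)

lemma cinner_eq_0_commute: "cinner x y = 0 \<longleftrightarrow> cinner y (x::'a::complex_hilbert) = 0"
  by (metis cinner_commute complex_cnj_zero)

lemma cmod_cinner_commute: "cmod (cinner x y) = cmod (cinner y (x::'a::complex_hilbert))"
  by (metis cinner_commute complex_mod_cnj)

lemma Re_cinner_commute: "Re (cinner x y) = Re (cinner y (x::'a::complex_hilbert))"
  by (metis cinner_commute complex_cnj(1) complex_surj complex.sel(1))

lemma norm_add_sq: "(norm (x + y))\<^sup>2 = (norm x)\<^sup>2 + (norm y)\<^sup>2 + 2 * Re (cinner x (y::'a::complex_hilbert))"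
  using Re_cinner_commute[of x y] by (simp flip: Re_cinner_self add: cinner_linear)

lemma norm_add_sq_orth: "cinner x y = 0 \<Longrightarrow> (norm (x + y))\<^sup>2 = (norm x)\<^sup>2 + (norm (y::'a::complex_hilbert))\<^sup>2"
  by (simp add: norm_add_sq)

lemma parallelogram:
  "(norm (x + y))\<^sup>2 + (norm (x - y))\<^sup>2 = 2 * (norm x)\<^sup>2 + 2 * (norm (y::'a::complex_hilbert))\<^sup>2"
  using norm_add_sq[of x y] norm_add_sq[of x "- y"] by (simp add: cinner_minus_right)

lemma norm_sum_sq_orth:
  fixes f :: "'i \<Rightarrow> 'a::complex_hilbert"
  assumes "finite A" "\<And>i j. i \<in> A \<Longrightarrow> j \<in> A \<Longrightarrow> i \<noteq> j \<Longrightarrow> cinner (f i) (f j) = 0"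
  shows "(norm (sum f A))\<^sup>2 = (\<Sum>i\<in>A. (norm (f i))\<^sup>2)"
  using assms
proof (induction A rule: finite_induct)
  case (insert i A)
  have "cinner (f i) (sum f A) = 0"
    unfolding cinner_sum_right using insert by (intro sum.neutral) auto
  then show ?case
    using insert by (simp add: norm_add_sq_orth)
qed auto

subsection \<open>Bounded operators as functions\<close>

lemma clinear_bop: "clinear (bop_apply x)" and bounded_linear_bop: "bounded_linear (bop_apply x)"
  using bop_apply[of x] by auto

lemma bop_apply_add: "bop_apply x (u + v) = bop_apply x u + bop_apply x v"
  and bop_apply_scaleC: "bop_apply x (c *\<^sub>C v) = c *\<^sub>C bop_apply x v"
  using clinear_bop[of x] by (auto simp: clinear_iff)

lemma bop_apply_zero [simp]: "bop_apply x 0 = 0"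
  using bounded_linear_bop[of x] by (rule linear_simps)

lemma bop_apply_diff: "bop_apply x (u - v) = bop_apply x u - bop_apply x v"
  and bop_apply_minus: "bop_apply x (- u) = - bop_apply x u"
  and bop_apply_scaleR: "bop_apply x (r *\<^sub>R v) = r *\<^sub>R bop_apply x v"
  using bounded_linear_bop[of x] by (auto simp: linear_simps)

lemma bop_apply_sum: "bop_apply x (sum f A) = (\<Sum>i\<in>A. bop_apply x (f i))"
  by (induction A rule: infinite_finite_induct) (auto simp: bop_apply_add)

lemmas bop_apply_linear = bop_apply_add bop_apply_scaleC bop_apply_diff bop_apply_minus
  bop_apply_scaleR bop_apply_sum

lemmas bop_ops = plus_bop.rep_eq minus_bop.rep_eq uminus_bop.rep_eq zero_bop.rep_eq
  scaleR_bop.rep_eq scaleC_bop.rep_eq bop_comp.rep_eq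

lemma bop_sum: "bop_apply (sum x A) v = (\<Sum>i\<in>A. bop_apply (x i) v)"
  by (induction A rule: infinite_finite_induct) (auto simp: bop_ops)

lemma bop_eqI: "(\<And>v. bop_apply x v = bop_apply y v) \<Longrightarrow> x = y"
  by (simp add: bop_apply_inject[symmetric] fun_eq_iff)

lemma norm_bop_apply: "norm (bop_apply x v) \<le> norm x * norm v"
  unfolding norm_bop.rep_eq by (rule onorm[OF bounded_linear_bop])

lemma norm_bop_le:
  assumes "0 \<le> C" "\<And>v. norm (bop_apply x v) \<le> C * norm v"
  shows "norm x \<le> C"
  unfolding norm_bop.rep_eq using assms by (rule onorm_bound)

lemma norm_bop_comp: "norm (bop_comp x y) \<le> norm x * norm y"
proof (rule norm_bop_le)
  show "0 \<le> norm x * norm y" by simp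
  fix v
  have "norm (bop_apply x (bop_apply y v)) \<le> norm x * norm (bop_apply y v)"
    by (rule norm_bop_apply)
  also have "\<dots> \<le> norm x * (norm y * norm v)"
    by (intro mult_left_mono norm_bop_apply) auto
  finally show "norm (bop_apply (bop_comp x y) v) \<le> norm x * norm y * norm v"
    by (simp add: bop_ops mult.assoc)
qed

lemma ex_bop:
  assumes "clinear f" "\<And>v. norm (f v) \<le> C * norm v"
  shows "\<exists>x. bop_apply x = (f :: 'a::complex_hilbert \<Rightarrow> 'a)"
proof -
  have "bounded_linear f"
    using assms by (intro bounded_linear_intro[of f C])
      (auto simp: clinear_iff scaleR_scaleC mult.commute)
  then show ?thesis
    using assms Abs_bop_inverse by blast
qed

lift_definition id_bop :: "'a::complex_hilbert bop" is "\<lambda>v. v"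
  by (auto simp: clinear_iff)

lemma bop_comp_linear:
  "bop_comp (x + y) z = bop_comp x z + bop_comp y z"
  "bop_comp z (x + y) = bop_comp z x + bop_comp z y"
  "bop_comp (x - y) z = bop_comp x z - bop_comp y z"
  "bop_comp z (x - y) = bop_comp z x - bop_comp z y"
  "bop_comp (r *\<^sub>R x) z = r *\<^sub>R bop_comp x z"
  "bop_comp z (r *\<^sub>R x) = r *\<^sub>R bop_comp z x"
  "bop_comp id_bop x = x" "bop_comp x id_bop = x"
  by (auto intro!: bop_eqI simp: bop_ops bop_apply_linear id_bop.rep_eq)

lemma bop_comp_assoc: "bop_comp (bop_comp x y) z = bop_comp x (bop_comp y z)"
  by (rule bop_eqI) (simp add: bop_ops)

lemma bounded_bilinear_bop_comp: "bounded_bilinear (bop_comp :: 'a::complex_hilbert bop \<Rightarrow> _)"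
  by standard (auto simp: bop_comp_linear intro!: exI[of _ 1] norm_bop_comp)

lemma bounded_linear_bop_apply: "bounded_linear (\<lambda>x. bop_apply x v)"
  by (rule bounded_linear_intro[of _ "norm v"])
     (auto simp: bop_ops mult.commute[of _ "norm v"] intro: norm_bop_apply[THEN order_trans])

lemma tendsto_bop_apply: "(X \<longlongrightarrow> x) F \<Longrightarrow> ((\<lambda>n. bop_apply (X n) v) \<longlongrightarrow> bop_apply x v) F"
  by (rule bounded_linear.tendsto[OF bounded_linear_bop_apply])

text \<open>Completeness is inherited from the space of real-linear bounded maps, in which the
  complex-linear ones are closed under pointwise limits.\<close>

instance bop :: (complex_hilbert) banach
proof
  fix X :: "nat \<Rightarrow> 'a bop"
  assume X: "Cauchy X"
  define Y where "Y n = Blinfun (bop_apply (X n))" for n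
  have Y: "blinfun_apply (Y n) = bop_apply (X n)" for n
    by (simp add: Y_def bounded_linear_Blinfun_apply bounded_linear_bop)
  have "norm (Y m - Y n) = norm (X m - X n)" for m n
    by (simp add: norm_blinfun.rep_eq minus_blinfun.rep_eq Y norm_bop.rep_eq minus_bop.rep_eq)
  then have "Cauchy Y"
    using X by (simp add: Cauchy_def dist_norm)
  then obtain Z where Z: "Y \<longlonglongrightarrow> Z"
    using convergent_eq_Cauchy by blast
  have lim: "(\<lambda>n. bop_apply (X n) v) \<longlonglongrightarrow> blinfun_apply Z v" for v
    using blinfun.tendsto[OF Z tendsto_const[of v]] by (simp add: Y)
  have "blinfun_apply Z (c *\<^sub>C v) = c *\<^sub>C blinfun_apply Z v" for c v
  proof (rule LIMSEQ_unique[OF lim])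
    show "(\<lambda>n. bop_apply (X n) (c *\<^sub>C v)) \<longlonglongrightarrow> c *\<^sub>C blinfun_apply Z v"
      using bounded_linear.tendsto[OF bounded_linear_scaleC lim[of v], of c]
      by (simp add: bop_apply_scaleC)
  qed
  then have "clinear (blinfun_apply Z)"
    by (simp add: clinear_iff blinfun.add_right)
  then have Zx: "bop_apply (Abs_bop (blinfun_apply Z)) = blinfun_apply Z"
    by (simp add: Abs_bop_inverse blinfun.bounded_linear_right)
  have "norm (X n - Abs_bop (blinfun_apply Z)) = norm (Y n - Z)" for n
    by (simp add: norm_blinfun.rep_eq minus_blinfun.rep_eq Y norm_bop.rep_eq minus_bop.rep_eq Zx)
  then have "X \<longlonglongrightarrow> Abs_bop (blinfun_apply Z)"
    using Z by (simp add: tendsto_iff dist_norm)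
  then show "convergent X"
    by (auto simp: convergent_def)
qed

subsection \<open>Positive operators and the Cauchy-Schwarz inequality\<close>

text \<open>A positive form is real on the diagonal; polarization at \<open>u + v\<close> and \<open>u + iv\<close> turns
  this into symmetry.\<close>

lemma positive_bop_selfadjoint:
  assumes "positive_bop a"
  shows "cinner (bop_apply a u) v = cinner u (bop_apply a v)"
proof -
  have im: "Im (cinner (bop_apply a w) w) = 0" for w
    using assms by (auto simp: positive_bop_def)
  have 1: "Im (cinner (bop_apply a u) v) + Im (cinner (bop_apply a v) u) = 0"
    using im[of "u + v"] im[of u] im[of v] by (simp add: bop_apply_linear cinner_linear)
  have 2: "Re (cinner (bop_apply a v) u) - Re (cinner (bop_apply a u) v) = 0"
    using im[of "u + \<i> *\<^sub>C v"] im[of u] im[of v] by (simp add: bop_apply_linear cinner_linear)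
  have "cinner (bop_apply a u) v = cnj (cinner (bop_apply a v) u)"
    using 1 2 by (simp add: complex_eq_iff)
  then show ?thesis
    by (metis cinner_commute)
qed

text \<open>The quadratic polynomial \<open>\<langle>a w, w\<rangle>\<close> along \<open>w = u - t \<langle>a u, v\<rangle> v\<close> is nonnegative in \<open>t\<close>.\<close>

lemma positive_bop_Cauchy_Schwarz:
  assumes a: "positive_bop a"
  shows "(cmod (cinner (bop_apply a u) v))\<^sup>2
    \<le> Re (cinner (bop_apply a u) u) * Re (cinner (bop_apply a v) v)"
proof -
  define z where "z = cinner (bop_apply a u) v"
  define Q where "Q w = Re (cinner (bop_apply a w) w)" for w
  have Q0: "0 \<le> Q w" for w
    using a by (auto simp: Q_def positive_bop_def)
  have vu: "cinner (bop_apply a v) u = cnj z"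
    unfolding z_def by (metis positive_bop_selfadjoint[OF a] cinner_commute)
  have Qvv: "cinner (bop_apply a v) v = of_real (Q v)"
    using a by (simp add: Q_def positive_bop_def complex_eq_iff)
  have poly: "0 \<le> Q u - 2 * t * (cmod z)\<^sup>2 + t\<^sup>2 * (cmod z)\<^sup>2 * Q v" for t :: real
  proof -
    define c where "c = - of_real t * z"
    have zz: "z * cnj z = of_real ((cmod z)\<^sup>2)"
      by (rule complex_norm_square[symmetric])
    have "Q (u + c *\<^sub>C v) = Q u + Re (cnj c * z) + Re (c * cnj z) + Re (c * cnj c * of_real (Q v))"
      by (simp add: Q_def[of "u + c *\<^sub>C v"] Q_def[of u] bop_apply_linear cinner_linear vu Qvv z_def[symmetric]
          algebra_simps)
    also have "cnj c * z = of_real (- t * (cmod z)\<^sup>2)"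
      using zz by (simp add: c_def mult.commute[of "cnj z"])
    also have "c * cnj z = of_real (- t * (cmod z)\<^sup>2)"
      using zz by (simp add: c_def)
    also have "c * cnj c = of_real (t\<^sup>2 * (cmod z)\<^sup>2)"
    proof -
      have "c * cnj c = of_real (t\<^sup>2) * (z * cnj z)"
        by (simp add: c_def power2_eq_square mult_ac)
      then show ?thesis
        by (simp only: zz of_real_mult)
    qed
    finally show ?thesis
      using Q0[of "u + c *\<^sub>C v"] by simp
  qed
  have "(cmod z)\<^sup>2 \<le> Q u * Q v"
  proof (cases "Q v = 0")
    case True
    show ?thesis
    proof (rule ccontr)
      assume "\<not> ?thesis"
      then have "0 < (cmod z)\<^sup>2"
        using True by simp
      then show False
        using poly[of "(Q u + 1) / (2 * (cmod z)\<^sup>2)"] True by (simp add: field_simps)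
    qed
  next
    case False
    then have "0 < Q v"
      using Q0[of v] by simp
    then show ?thesis
      using poly[of "1 / Q v"] by (simp add: field_simps power2_eq_square)
  qed
  then show ?thesis
    by (simp add: z_def Q_def)
qed

lemma positive_id_bop: "positive_bop id_bop"
  by (simp add: positive_bop_def id_bop.rep_eq cinner_norm)

lemma cmod_cinner_le: "cmod (cinner u v) \<le> norm u * norm (v::'a::complex_hilbert)"
  using positive_bop_Cauchy_Schwarz[OF positive_id_bop, of u v]
  by (simp add: id_bop.rep_eq Re_cinner_self flip: power_mult_distrib)

lemma bounded_linear_cinner_left: "bounded_linear (\<lambda>u. cinner u (v::'a::complex_hilbert))"
  by (rule bounded_linear_intro[of _ "norm v"]) (auto simp: cinner_linear cmod_cinner_le scaleR_conv_of_real)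

lemma bounded_linear_cinner_right: "bounded_linear (\<lambda>v. cinner (u::'a::complex_hilbert) v)"
  by (rule bounded_linear_intro[of _ "norm u"])
     (auto simp: cinner_linear scaleR_conv_of_real mult.commute[of "norm _" "norm u"] cmod_cinner_le)

lemmas tendsto_cinner_left = bounded_linear.tendsto[OF bounded_linear_cinner_left]
lemmas tendsto_cinner_right = bounded_linear.tendsto[OF bounded_linear_cinner_right]

text \<open>The Cauchy-Schwarz inequality for the form of \<open>a\<close>, applied to \<open>v\<close> and \<open>a v\<close>. Since the bound
  \<open>C\<close> is required at \<open>a v\<close> only, it can be the bound of the form on an invariant subspace.\<close>

lemma positive_bop_norm_sq_le:
  assumes a: "positive_bop a"
    and le: "Re (cinner (bop_apply a (bop_apply a v)) (bop_apply a v)) \<le> C * (norm (bop_apply a v))\<^sup>2"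
  shows "(norm (bop_apply a v))\<^sup>2 \<le> C * Re (cinner (bop_apply a v) v)"
proof -
  define n where "n = (norm (bop_apply a v))\<^sup>2"
  have Q0: "0 \<le> Re (cinner (bop_apply a v) v)"
    using a by (auto simp: positive_bop_def)
  have "n\<^sup>2 = (cmod (cinner (bop_apply a v) (bop_apply a v)))\<^sup>2"
    by (simp add: cinner_norm n_def norm_power)
  also have "\<dots> \<le> Re (cinner (bop_apply a v) v)
      * Re (cinner (bop_apply a (bop_apply a v)) (bop_apply a v))"
    by (rule positive_bop_Cauchy_Schwarz[OF a])
  also have "\<dots> \<le> Re (cinner (bop_apply a v) v) * (C * n)"
    unfolding n_def using le by (intro mult_left_mono Q0)
  finally have "n * n \<le> (C * Re (cinner (bop_apply a v) v)) * n"
    by (simp add: power2_eq_square mult_ac)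
  moreover have "0 \<le> n" by (simp add: n_def)
  moreover have "0 \<le> C * Re (cinner (bop_apply a v) v)" if "n = 0"
    using that by (simp add: n_def)
  ultimately show ?thesis
    unfolding n_def[symmetric] by (cases "n = 0") auto
qed

lemma positive_bop_kernel:
  assumes a: "positive_bop a" and 0: "cinner (bop_apply a v) v = 0"
  shows "bop_apply a v = 0"
  using positive_bop_Cauchy_Schwarz[OF a, of v "bop_apply a v"] 0
  by (simp add: cinner_norm)

subsection \<open>Riesz representation and adjoints\<close>

text \<open>The representing vector is the minimizer of \<open>\<parallel>v\<parallel>\<^sup>2 - 2 Re (\<phi> v)\<close> on the subspace; the
  parallelogram law makes minimizing sequences Cauchy. Applied to \<open>\<phi> v = \<langle>v, x\<rangle>\<close> the same statement
  yields orthogonal projections.\<close>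

lemma Riesz_subspace:
  fixes M :: "'a::complex_hilbert set" and \<phi> :: "'a \<Rightarrow> complex"
  assumes M: "complex_vector.subspace M" "closed M"
    and add: "\<And>u v. \<phi> (u + v) = \<phi> u + \<phi> v" and sc: "\<And>c v. \<phi> (c *\<^sub>C v) = c * \<phi> v"
    and bd: "\<And>v. cmod (\<phi> v) \<le> C * norm v"
  shows "\<exists>y\<in>M. \<forall>v\<in>M. \<phi> v = cinner v y"
proof -
  have bl: "bounded_linear \<phi>"
    by (rule bounded_linear_intro[of _ C])
      (auto simp: add sc bd scaleR_scaleC scaleR_conv_of_real mult.commute[of _ C])
  define F where "F v = (norm v)\<^sup>2 - 2 * Re (\<phi> v)" for v
  have Fge: "- C\<^sup>2 \<le> F v" for v
  proof -
    have "Re (\<phi> v) \<le> C * norm v"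
      using bd[of v] complex_Re_le_cmod[of "\<phi> v"] by simp
    moreover have "0 \<le> (norm v - C)\<^sup>2" by simp
    ultimately show ?thesis
      by (simp add: F_def power2_diff mult.commute)
  qed
  define m where "m = Inf (F ` M)"
  have bdd: "bdd_below (F ` M)"
    using Fge by (auto intro!: bdd_belowI[of _ "- C\<^sup>2"])
  have ne: "F ` M \<noteq> {}"
    using complex_vector.subspace_0[OF M(1)] by auto
  have mle: "m \<le> F v" if "v \<in> M" for v
    unfolding m_def using bdd that by (intro cInf_lower) auto
  have "\<exists>v\<in>M. F v < m + 1 / real (Suc n)" for n
    using cInf_lessD[OF ne, of "m + 1 / real (Suc n)"] by (auto simp: m_def)
  then obtain X where X: "\<And>n. X n \<in> M" "\<And>n. F (X n) < m + 1 / real (Suc n)"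
    by metis
  have par: "(norm (X i - X j))\<^sup>2 \<le> 2 / real (Suc i) + 2 / real (Suc j)" for i j
  proof -
    define h where "h = (1/2) *\<^sub>R (X i + X j)"
    have "h \<in> M"
      unfolding h_def scaleR_scaleC using X(1) M(1)
      by (intro complex_vector.subspace_scale complex_vector.subspace_add)
    then have "m \<le> F h" by (rule mle)
    moreover have "4 * F h = (norm (X i + X j))\<^sup>2 - 4 * Re (\<phi> (X i)) - 4 * Re (\<phi> (X j))"
      by (simp add: F_def h_def power_divide linear_simps[OF bl] scaleR_conv_of_real add
          add_divide_distrib diff_divide_distrib)
    ultimately show ?thesis
      using parallelogram[of "X i" "X j"] X(2)[of i] X(2)[of j] by (simp add: F_def)
  qed
  have "Cauchy X"
  proof (rule metric_CauchyI)
    fix e :: real assume e: "0 < e"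
    obtain N where N: "1 / real (Suc N) < e\<^sup>2 / 4"
      using e nat_approx_posE[of "e\<^sup>2 / 4"] by (metis divide_pos_pos zero_less_numeral zero_less_power)
    show "\<exists>M. \<forall>m\<ge>M. \<forall>n\<ge>M. dist (X m) (X n) < e"
    proof (intro exI allI impI)
      fix i j assume ij: "N \<le> i" "N \<le> j"
      have "1 / real (Suc i) \<le> 1 / real (Suc N)" "1 / real (Suc j) \<le> 1 / real (Suc N)"
        using ij by (auto simp: field_simps)
      then have "(norm (X i - X j))\<^sup>2 < e\<^sup>2"
        using par[of i j] N by simp
      then show "dist (X i) (X j) < e"
        using e by (simp add: dist_norm power2_less_imp_less)
    qed
  qed
  then obtain y where y: "X \<longlonglongrightarrow> y"
    using convergent_eq_Cauchy by blast
  then have yM: "y \<in> M"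
    using M(2) X(1) closed_sequentially by blast
  have "(\<lambda>n. F (X n)) \<longlonglongrightarrow> F y"
    unfolding F_def by (intro tendsto_intros y bounded_linear.tendsto[OF bl])
  moreover have "(\<lambda>n. m + 1 / real (Suc n)) \<longlonglongrightarrow> m"
    using tendsto_add[OF tendsto_const[of m] LIMSEQ_inverse_real_of_nat] by (simp add: inverse_eq_divide)
  ultimately have Fy: "F y \<le> m"
    using X(2) by (meson LIMSEQ_le less_imp_le)
  have re: "Re (\<phi> v) = Re (cinner v y)" if v: "v \<in> M" for v
  proof -
    define d where "d = Re (cinner v y) - Re (\<phi> v)"
    have poly: "0 \<le> t\<^sup>2 * (norm v)\<^sup>2 + 2 * t * d" for t
    proof -
      have "y + t *\<^sub>R v \<in> M"
        unfolding scaleR_scaleC using v yM M(1)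
        by (intro complex_vector.subspace_scale complex_vector.subspace_add)
      then have "F y \<le> F (y + t *\<^sub>R v)"
        using Fy mle by force
      then show ?thesis
        using Re_cinner_commute[of y v]
        by (simp add: F_def norm_add_sq linear_simps[OF bl] cinner_linear d_def power_mult_distrib algebra_simps)
    qed
    have "d = 0"
    proof (cases "v = 0")
      case True
      then show ?thesis by (simp add: d_def linear_simps[OF bl])
    next
      case False
      have "0 \<le> - (d\<^sup>2 / (norm v)\<^sup>2)"
        using poly[of "- d / (norm v)\<^sup>2"] False by (simp add: field_simps power2_eq_square)
      then show ?thesis
        using False by (simp add: divide_le_0_iff)
    qed
    then show ?thesis by (simp add: d_def)
  qed
  have "\<phi> v = cinner v y" if v: "v \<in> M" for v
  proof -
    have "\<i> *\<^sub>C v \<in> M"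
      using v M(1) by (intro complex_vector.subspace_scale)
    from re[OF this] re[OF v] show ?thesis
      by (simp add: sc cinner_linear complex_eq_iff)
  qed
  then show ?thesis
    using yM by blast
qed

lemma cinner_eqI:
  assumes "\<And>u. cinner u a = cinner u b"
  shows "a = (b::'a::complex_hilbert)"
proof -
  have "cinner (a - b) (a - b) = 0"
    by (simp add: cinner_diff_right assms)
  then show ?thesis
    by (simp add: cinner_norm)
qed

lemma adjoint_bop_ex:
  "\<exists>y. \<forall>u v. cinner (bop_apply x u) v = cinner u (bop_apply y (v::'a::complex_hilbert))"
proof -
  have "\<exists>y. \<forall>u. cinner (bop_apply x u) v = cinner u y" for v
  proof -
    have "norm (bop_apply x w) * norm v \<le> (norm x * norm v) * norm w" for w
      using mult_right_mono[OF norm_bop_apply[of x w], of "norm v"] by (simp add: mult_ac)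
    then have "\<exists>y\<in>UNIV. \<forall>u\<in>UNIV. cinner (bop_apply x u) v = cinner u y"
      by (intro Riesz_subspace[where C = "norm x * norm v"])
        (auto simp: bop_apply_linear cinner_linear complex_vector.subspace_UNIV
          intro: order_trans[OF cmod_cinner_le])
    then show ?thesis by blast
  qed
  then obtain y where y: "\<And>u v. cinner (bop_apply x u) v = cinner u (y v)"
    by metis
  have "clinear y"
    unfolding clinear_iff
    by (intro allI conjI; rule cinner_eqI) (simp_all add: y[symmetric] cinner_linear)
  moreover have "norm (y v) \<le> norm x * norm v" for v
  proof -
    have "(norm (y v))\<^sup>2 = cmod (cinner (bop_apply x (y v)) v)"
      by (simp add: y cinner_norm norm_power)
    also have "\<dots> \<le> norm (bop_apply x (y v)) * norm v"
      by (rule cmod_cinner_le)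
    also have "\<dots> \<le> norm x * norm (y v) * norm v"
      by (intro mult_right_mono norm_bop_apply) auto
    finally have "norm (y v) * norm (y v) \<le> norm (y v) * (norm x * norm v)"
      by (simp add: power2_eq_square mult_ac)
    then show ?thesis
      by (cases "norm (y v) = 0") (auto simp: mult_le_cancel_left)
  qed
  ultimately show ?thesis
    using ex_bop[of y "norm x"] y by metis
qed

lemma cinner_adjoint: "cinner (bop_apply x u) v = cinner u (bop_apply (adjoint_bop x) v)"
proof -
  have "\<exists>!y. \<forall>u v. cinner (bop_apply x u) v = cinner u (bop_apply y v)"
  proof -
    obtain y where y: "\<forall>u v. cinner (bop_apply x u) v = cinner u (bop_apply y v)"
      using adjoint_bop_ex[of x] by blast
    moreover have "z = y" if "\<forall>u v. cinner (bop_apply x u) v = cinner u (bop_apply z v)" for z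
    proof (intro bop_eqI cinner_eqI)
      show "cinner u (bop_apply z v) = cinner u (bop_apply y v)" for u v
        using y that by metis
    qed
    ultimately show ?thesis by (rule ex1I)
  qed
  from theI'[OF this] show ?thesis
    unfolding adjoint_bop_def by blast
qed

lemma cinner_adjoint': "cinner (bop_apply (adjoint_bop x) u) v = cinner u (bop_apply x v)"
  by (metis cinner_adjoint cinner_commute)

subsection \<open>Square roots and the absolute value\<close>

definition commutes :: "'a::complex_hilbert bop \<Rightarrow> 'a bop \<Rightarrow> bool"
  where "commutes x y \<longleftrightarrow> bop_comp x y = bop_comp y x"

definition selfadjoint :: "'a::complex_hilbert bop \<Rightarrow> bool"
  where "selfadjoint x \<longleftrightarrow> (\<forall>u v. cinner (bop_apply x u) v = cinner u (bop_apply x v))"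

text \<open>For \<open>0 \<le> b \<le> 1\<close> the iteration \<open>X\<^bsub>n+1\<^esub> = (1 - b + X\<^sub>n\<^sup>2) / 2\<close> converges in norm to
  \<open>1 - b\<^bsup>1/2\<^esup>\<close>: it is dominated, increments included, by the scalar iteration
  \<open>r\<^bsub>n+1\<^esub> = (1 + r\<^sub>n\<^sup>2) / 2\<close>, which increases and stays below 1.\<close>

primrec sqrt_iter :: "'a::complex_hilbert bop \<Rightarrow> nat \<Rightarrow> 'a bop" where
  "sqrt_iter a 0 = 0"
| "sqrt_iter a (Suc n) = (1/2) *\<^sub>R (a + bop_comp (sqrt_iter a n) (sqrt_iter a n))"

primrec sqrt_iter_bound :: "nat \<Rightarrow> real" where
  "sqrt_iter_bound 0 = 0"
| "sqrt_iter_bound (Suc n) = (1 + (sqrt_iter_bound n)\<^sup>2) / 2"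

lemma sqrt_iter_bound_range: "0 \<le> sqrt_iter_bound n \<and> sqrt_iter_bound n \<le> 1"
proof (induction n)
  case (Suc n)
  then have "(sqrt_iter_bound n)\<^sup>2 \<le> 1"
    by (simp add: power_le_one)
  then show ?case by (simp add: add_nonneg_nonneg)
qed auto

lemma sqrt_iter_bound_mono: "sqrt_iter_bound n \<le> sqrt_iter_bound (Suc n)"
proof -
  have "0 \<le> (1 - sqrt_iter_bound n)\<^sup>2" by simp
  then show ?thesis by (simp add: power2_diff)
qed

lemma norm_sqrt_iter:
  assumes "norm a \<le> 1"
  shows "norm (sqrt_iter a n) \<le> sqrt_iter_bound n"
proof (induction n)
  case (Suc n)
  have "norm (bop_comp (sqrt_iter a n) (sqrt_iter a n)) \<le> (sqrt_iter_bound n)\<^sup>2"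
    unfolding power2_eq_square using Suc sqrt_iter_bound_range[of n]
    by (intro order_trans[OF norm_bop_comp] mult_mono) auto
  then have "norm (a + bop_comp (sqrt_iter a n) (sqrt_iter a n)) \<le> 1 + (sqrt_iter_bound n)\<^sup>2"
    using assms by (intro order_trans[OF norm_triangle_ineq]) auto
  then show ?case by simp
qed auto

text \<open>Increments are compared through \<open>x\<^sup>2 - y\<^sup>2 = x (x - y) + (x - y) y\<close>.\<close>

lemma norm_sqrt_iter_diff:
  assumes "norm a \<le> 1"
  shows "norm (sqrt_iter a (Suc n) - sqrt_iter a n) \<le> sqrt_iter_bound (Suc n) - sqrt_iter_bound n"
proof (induction n)
  case 0
  then show ?case using assms by (simp add: bop_ops bop_comp_linear zero_bop_def[symmetric])
     (metis (no_types, lifting) add.right_neutral bounded_bilinear.zero_left bounded_bilinear_bop_comp)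
next
  case (Suc n)
  define x where "x = sqrt_iter a (Suc n)"
  define y where "y = sqrt_iter a n"
  define r where "r = sqrt_iter_bound (Suc n)"
  define s where "s = sqrt_iter_bound n"
  have "sqrt_iter a (Suc (Suc n)) - sqrt_iter a (Suc n) =
    (1/2) *\<^sub>R (bop_comp x x - bop_comp y y)"
    unfolding sqrt_iter.simps(2)[of a "Suc n"] sqrt_iter.simps(2)[of a n] x_def[symmetric]
    unfolding x_def sqrt_iter.simps(2)[of a n] y_def by (simp add: scaleR_diff_right[symmetric])
  also have "bop_comp x x - bop_comp y y = bop_comp x (x - y) + bop_comp (x - y) y"
    by (simp add: bop_comp_linear)
  also have "norm ((1/2) *\<^sub>R \<dots>) \<le> (1/2) * (norm x * norm (x - y) + norm (x - y) * norm y)"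
    by (simp, intro order_trans[OF norm_triangle_ineq] add_mono norm_bop_comp)
  also have "\<dots> \<le> (1/2) * (r * (r - s) + (r - s) * s)"
    unfolding r_def s_def x_def y_def
    using Suc sqrt_iter_bound_range[of "Suc n"] sqrt_iter_bound_mono[of n] assms
    by (intro mult_left_mono add_mono mult_mono norm_sqrt_iter) auto
  also have "\<dots> = (r\<^sup>2 - s\<^sup>2) / 2"
    by (simp add: power2_eq_square algebra_simps)
  also have "\<dots> = sqrt_iter_bound (Suc (Suc n)) - sqrt_iter_bound (Suc n)"
    unfolding sqrt_iter_bound.simps(2)[of "Suc n"] r_def[symmetric]
    unfolding r_def sqrt_iter_bound.simps(2)[of n] s_def[symmetric] by (simp add: field_simps)
  finally show ?case by simp
qed

lemma sqrt_iter_convergent: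
  assumes "norm a \<le> 1"
  shows "convergent (sqrt_iter a)"
proof -
  have "convergent sqrt_iter_bound"
    using sqrt_iter_bound_range sqrt_iter_bound_mono
    by (intro Bseq_mono_convergent BseqI'[of _ 1]) (auto intro: incseq_SucI[unfolded incseq_def, rule_format])
  then obtain l where l: "sqrt_iter_bound \<longlonglongrightarrow> l"
    by (auto simp: convergent_def)
  have "summable (\<lambda>n. sqrt_iter_bound (Suc n) - sqrt_iter_bound n)"
    using telescope_summable[OF l] .
  then have "summable (\<lambda>n. sqrt_iter a (Suc n) - sqrt_iter a n)"
    by (rule summable_comparison_test'[where N = 0]) (use norm_sqrt_iter_diff[OF assms] in auto)
  then have "convergent (\<lambda>n. \<Sum>k<n. sqrt_iter a (Suc k) - sqrt_iter a k)"
    by (simp add: summable_iff_convergent)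
  then show ?thesis
    unfolding sum_lessThan_telescope by simp
qed

lemma commutes_limit:
  assumes "X \<longlonglongrightarrow> x" "\<And>n. commutes (X n) y"
  shows "commutes x y"
proof -
  interpret bounded_bilinear "bop_comp :: 'a bop \<Rightarrow> _"
    by (rule bounded_bilinear_bop_comp)
  have "(\<lambda>n. bop_comp (X n) y) \<longlonglongrightarrow> bop_comp x y" "(\<lambda>n. bop_comp y (X n)) \<longlonglongrightarrow> bop_comp y x"
    using assms(1) by (auto intro!: tendsto)
  then show ?thesis
    using assms(2) by (auto simp: commutes_def intro: LIMSEQ_unique)
qed

lemma sqrt_exists_contraction:
  assumes b: "positive_bop b" and bn: "\<And>v. Re (cinner (bop_apply b v) v) \<le> (norm v)\<^sup>2"
  shows "\<exists>c. positive_bop c \<and> bop_comp c c = b \<and> (\<forall>y. commutes b y \<longrightarrow> commutes c y)"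
proof -
  define a where "a = id_bop - b"
  have "norm a \<le> 1"
  proof (rule norm_bop_le)
    show "(0::real) \<le> 1" by simp
    fix v
    have im: "Im (cinner (bop_apply b w) w) = 0" and re: "0 \<le> Re (cinner (bop_apply b w) w)" for w
      using b by (auto simp: positive_bop_def)
    have "positive_bop a"
      unfolding positive_bop_def a_def using bn im
      by (auto simp: bop_ops id_bop.rep_eq cinner_linear cinner_norm)
    note pos_a = this
    have le: "Re (cinner (bop_apply a w) w) \<le> (norm w)\<^sup>2" for w
      using re[of w] by (simp add: a_def bop_ops id_bop.rep_eq cinner_linear cinner_norm)
    have "(norm (bop_apply a v))\<^sup>2 \<le> Re (cinner (bop_apply a v) v)"
      using positive_bop_norm_sq_le[OF pos_a, of v 1] le by simp
    also have "\<dots> \<le> (norm v)\<^sup>2"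
      by (rule le)
    finally have "norm (bop_apply a v) \<le> norm v"
      by (rule power2_le_imp_le) simp
    then show "norm (bop_apply a v) \<le> 1 * norm v"
      by simp
  qed
  from sqrt_iter_convergent[OF this] obtain x where x: "sqrt_iter a \<longlonglongrightarrow> x"
    by (auto simp: convergent_def)
  interpret bilin: bounded_bilinear "bop_comp :: 'a bop \<Rightarrow> _"
    by (rule bounded_bilinear_bop_comp)
  have "(\<lambda>n. sqrt_iter a (Suc n)) \<longlonglongrightarrow> (1/2) *\<^sub>R (a + bop_comp x x)"
    unfolding sqrt_iter.simps by (intro tendsto_intros bilin.tendsto x)
  moreover have "(\<lambda>n. sqrt_iter a (Suc n)) \<longlonglongrightarrow> x"
    using x by (rule LIMSEQ_Suc)
  ultimately have fix_eq: "(1/2) *\<^sub>R (a + bop_comp x x) = x"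
    by (rule LIMSEQ_unique)
  have "2 *\<^sub>R x = 2 *\<^sub>R ((1/2) *\<^sub>R (a + bop_comp x x))"
    by (simp only: fix_eq)
  then have "2 *\<^sub>R x = a + bop_comp x x"
    by simp
  then have xx: "bop_comp x x = x + x - a"
    by (simp add: scaleR_2 algebra_simps)
  define c where "c = id_bop - x"
  have cc: "bop_comp c c = b"
    by (simp add: c_def bop_comp_linear xx a_def)
  have "selfadjoint a"
    using positive_bop_selfadjoint[OF b]
    by (auto simp: selfadjoint_def a_def bop_ops id_bop.rep_eq cinner_linear)
  then have "selfadjoint (sqrt_iter a n)" for n
    by (induction n) (auto simp: selfadjoint_def bop_ops cinner_linear)
  then have sx: "cinner (bop_apply x u) v = cinner u (bop_apply x v)" for u v
    by (intro LIMSEQ_unique[OF tendsto_cinner_left[OF tendsto_bop_apply[OF x]]])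
       (auto simp: selfadjoint_def intro!: tendsto_cinner_right tendsto_bop_apply x)
  have nx: "norm x \<le> 1"
    using norm_sqrt_iter[OF \<open>norm a \<le> 1\<close>] sqrt_iter_bound_range
    by (intro Lim_bounded[OF tendsto_norm[OF x], of 0]) (meson order_trans)
  have "positive_bop c"
    unfolding positive_bop_def
  proof
    fix u
    have "cinner (bop_apply x u) u = cnj (cinner (bop_apply x u) u)"
      by (metis sx cinner_commute)
    then have "Im (cinner (bop_apply x u) u) = 0"
      by (metis Reals_cnj_iff complex_is_Real_iff)
    moreover have "Re (cinner (bop_apply x u) u) \<le> norm (bop_apply x u) * norm u"
      using cmod_cinner_le complex_Re_le_cmod order_trans by blast
    moreover have "norm (bop_apply x u) * norm u \<le> 1 * norm u * norm u"
      using nx by (intro mult_right_mono order_trans[OF norm_bop_apply] mult_mono) auto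
    ultimately show "Im (cinner (bop_apply c u) u) = 0 \<and> 0 \<le> Re (cinner (bop_apply c u) u)"
      by (simp add: c_def bop_ops id_bop.rep_eq cinner_linear cinner_norm power2_eq_square)
  qed
  moreover have "commutes c y" if y: "commutes b y" for y
  proof -
    have a: "commutes a y"
      using y by (simp add: commutes_def a_def bop_comp_linear)
    have "commutes (sqrt_iter a n) y" for n
    proof (induction n)
      case 0
      show ?case by (simp add: commutes_def bilin.zero_left bilin.zero_right)
    next
      case (Suc n)
      then have "bop_comp (bop_comp (sqrt_iter a n) (sqrt_iter a n)) y
          = bop_comp y (bop_comp (sqrt_iter a n) (sqrt_iter a n))"
        by (metis bop_comp_assoc commutes_def)
      then show ?case
        using a by (simp add: commutes_def bop_comp_linear)
    qed
    then have "commutes x y"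
      using x by (rule commutes_limit[rotated])
    then show ?thesis
      by (simp add: commutes_def c_def bop_comp_linear)
  qed
  ultimately show ?thesis
    using cc by blast
qed

text \<open>Scaling reduces to \<open>b \<le> 1\<close>.\<close>

lemma sqrt_exists:
  assumes b: "positive_bop b"
  shows "\<exists>c. positive_bop c \<and> bop_comp c c = b \<and> (\<forall>y. commutes b y \<longrightarrow> commutes c y)"
proof -
  define k where "k = norm b + 1"
  have k: "0 < k"
    by (simp add: k_def add_nonneg_pos)
  define d where "d = (1 / k) *\<^sub>R b"
  have "Re (cinner (bop_apply b v) v) \<le> k * (norm v)\<^sup>2" for v
  proof -
    have "Re (cinner (bop_apply b v) v) \<le> norm (bop_apply b v) * norm v"
      using cmod_cinner_le complex_Re_le_cmod order_trans by blast
    also have "\<dots> \<le> (k * norm v) * norm v"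
      by (intro mult_right_mono order_trans[OF norm_bop_apply]) (auto simp: k_def)
    finally show ?thesis by (simp add: power2_eq_square mult_ac)
  qed
  then have "Re (cinner (bop_apply d v) v) \<le> (norm v)\<^sup>2" for v
    using k by (simp add: d_def bop_ops cinner_linear field_simps)
  moreover have "positive_bop d"
    using b k by (simp add: positive_bop_def d_def bop_ops cinner_linear)
  ultimately obtain c where c: "positive_bop c" "bop_comp c c = d" "\<And>y. commutes d y \<Longrightarrow> commutes c y"
    using sqrt_exists_contraction[of d] by blast
  have "positive_bop (sqrt k *\<^sub>R c)"
    using c(1) k by (simp add: positive_bop_def bop_ops cinner_linear)
  moreover have "bop_comp (sqrt k *\<^sub>R c) (sqrt k *\<^sub>R c) = b"
    using k c(2) by (simp add: bop_comp_linear d_def)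
  moreover have "commutes (sqrt k *\<^sub>R c) y" if "commutes b y" for y
    using c(3)[of y] that by (simp add: commutes_def bop_comp_linear d_def)
  ultimately show ?thesis by blast
qed

text \<open>Let \<open>c\<close> be the root that commutes with everything \<open>a\<^sup>2\<close> commutes with. Then
  \<open>(a + c)(a - c) = 0\<close>, and positivity of \<open>a\<close> and \<open>c\<close> on the range of \<open>a - c\<close> forces
  \<open>a - c\<close> to vanish.\<close>

lemma sqrt_unique:
  assumes a: "positive_bop a" and c: "positive_bop c" "bop_comp c c = bop_comp a a"
    and comm: "\<And>y. commutes (bop_comp a a) y \<Longrightarrow> commutes c y"
  shows "a = c"
proof (rule bop_eqI)
  fix v
  have "commutes (bop_comp a a) a"
    by (simp add: commutes_def bop_comp_assoc)
  then have ca: "bop_comp c a = bop_comp a c"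
    using comm by (simp add: commutes_def)
  define w where "w = bop_apply (a - c) v"
  have "bop_comp (a + c) (a - c) = 0"
    by (simp add: bop_comp_linear c(2) ca)
  then have "bop_apply (a + c) w = 0"
    unfolding w_def by (metis bop_comp.rep_eq zero_bop.rep_eq)
  then have "cinner (bop_apply a w) w + cinner (bop_apply c w) w = 0"
    by (simp add: bop_ops flip: cinner_add_left)
  then have "cinner (bop_apply a w) w = 0" "cinner (bop_apply c w) w = 0"
    using a c(1) by (auto simp: positive_bop_def complex_eq_iff add_nonneg_eq_0_iff)
  then have "bop_apply a w = 0" "bop_apply c w = 0"
    using a c(1) positive_bop_kernel by blast+
  then have "cinner w w = 0"
    unfolding w_def using positive_bop_selfadjoint[OF a] positive_bop_selfadjoint[OF c(1)]
    by (simp add: bop_ops cinner_diff_left)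
  then have "w = 0"
    by (simp add: cinner_norm)
  then show "bop_apply a v = bop_apply c v"
    by (simp add: w_def bop_ops)
qed

lemma positive_sqrt_ex1:
  assumes b: "positive_bop b"
  shows "\<exists>!a. positive_bop a \<and> bop_comp a a = b"
  using sqrt_exists[OF b] sqrt_unique by metis

lemma abs_bop:
  shows positive_abs_bop: "positive_bop (abs_bop x)"
    and abs_bop_square: "bop_comp (abs_bop x) (abs_bop x) = bop_comp (adjoint_bop x) x"
proof -
  have "positive_bop (bop_comp (adjoint_bop x) x)"
    by (simp add: positive_bop_def bop_ops cinner_adjoint' cinner_norm)
  from theI'[OF positive_sqrt_ex1[OF this]]
  show "positive_bop (abs_bop x)" "bop_comp (abs_bop x) (abs_bop x) = bop_comp (adjoint_bop x) x"
    unfolding abs_bop_def by auto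
qed

lemma abs_bop_unique:
  assumes "positive_bop a" "bop_comp a a = bop_comp (adjoint_bop x) x"
  shows "abs_bop x = a"
proof -
  have "positive_bop (bop_comp (adjoint_bop x) x)"
    by (simp add: positive_bop_def bop_ops cinner_adjoint' cinner_norm)
  from positive_sqrt_ex1[OF this] show ?thesis
    using assms abs_bop by metis
qed

lemma cinner_abs_bop:
  "cinner (bop_apply (abs_bop x) u) (bop_apply (abs_bop x) v) = cinner (bop_apply x u) (bop_apply x v)"
proof -
  have "cinner (bop_apply (abs_bop x) u) (bop_apply (abs_bop x) v)
      = cinner u (bop_apply (bop_comp (abs_bop x) (abs_bop x)) v)"
    by (simp add: bop_ops positive_bop_selfadjoint[OF positive_abs_bop])
  then show ?thesis
    unfolding abs_bop_square by (simp add: bop_ops cinner_adjoint)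
qed

lemma norm_abs_bop_apply: "norm (bop_apply (abs_bop x) v) = norm (bop_apply x v)"
  using cinner_abs_bop[of x v v] by (simp add: cinner_norm flip: of_real_power)

lemma abs_bop_positive: "positive_bop a \<Longrightarrow> abs_bop a = a"
proof (rule abs_bop_unique)
  assume a: "positive_bop a"
  show "bop_comp a a = bop_comp (adjoint_bop a) a"
  proof (intro bop_eqI cinner_eqI)
    fix u v
    show "cinner u (bop_apply (bop_comp a a) v) = cinner u (bop_apply (bop_comp (adjoint_bop a) a) v)"
      using positive_bop_selfadjoint[OF a, of u "bop_apply a v"] cinner_adjoint[of a u "bop_apply a v"]
      by (simp add: bop_ops)
  qed
qed

section \<open>Compact operators\<close>

lemma compact_bop_iff_totally_bounded:
  "compact_bop x \<longleftrightarrow>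
    (\<forall>\<epsilon>>0. \<exists>K. finite K \<and> bop_apply x ` cball 0 1 \<subseteq> (\<Union>k\<in>K. ball k \<epsilon>))"
proof
  assume "compact_bop x"
  then show "\<forall>\<epsilon>>0. \<exists>K. finite K \<and> bop_apply x ` cball 0 1 \<subseteq> (\<Union>k\<in>K. ball k \<epsilon>)"
    unfolding compact_bop_def compact_eq_totally_bounded using closure_subset by fast
next
  assume R: "\<forall>\<epsilon>>0. \<exists>K. finite K \<and> bop_apply x ` cball 0 1 \<subseteq> (\<Union>k\<in>K. ball k \<epsilon>)"
  have "\<exists>K. finite K \<and> closure (bop_apply x ` cball 0 1) \<subseteq> (\<Union>k\<in>K. ball k \<epsilon>)" if "0 < \<epsilon>" for \<epsilon>
  proof -
    obtain K where K: "finite K" "bop_apply x ` cball 0 1 \<subseteq> (\<Union>k\<in>K. ball k (\<epsilon>/2))"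
      using R half_gt_zero[OF \<open>0 < \<epsilon>\<close>] by meson
    have "closure (bop_apply x ` cball 0 1) \<subseteq> (\<Union>k\<in>K. cball k (\<epsilon>/2))"
      using K by (intro closure_minimal closed_UN) (auto simp: subset_iff less_imp_le intro!: less_imp_le)
    also have "\<dots> \<subseteq> (\<Union>k\<in>K. ball k \<epsilon>)"
      using \<open>0 < \<epsilon>\<close> by (intro UN_mono) auto
    finally show ?thesis
      using K by blast
  qed
  then show "compact_bop x"
    unfolding compact_bop_def compact_eq_totally_bounded by (simp add: complete_eq_closed)
qed

text \<open>With the centres of the net in the unit ball, total boundedness of the image refers to the
  operator only through the lengths \<open>\<parallel>x (v - k)\<parallel>\<close>, so it passes to every operator dominated by \<open>x\<close>.\<close>

lemma compact_bop_iff_net: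
  "compact_bop x \<longleftrightarrow> (\<forall>\<epsilon>>0. \<exists>K. finite K \<and> K \<subseteq> cball 0 1 \<and>
    (\<forall>v\<in>cball 0 1. \<exists>k\<in>K. norm (bop_apply x (v - k)) < \<epsilon>))" (is "_ \<longleftrightarrow> ?R")
proof
  assume x: "compact_bop x"
  show ?R
  proof (intro allI impI)
    fix \<epsilon> :: real assume "0 < \<epsilon>"
    then have "0 < \<epsilon>/2" by simp
    then obtain K where K: "finite K" "bop_apply x ` cball 0 1 \<subseteq> (\<Union>k\<in>K. ball k (\<epsilon>/2))"
      using x unfolding compact_bop_iff_totally_bounded by meson
    define p where "p k = (SOME v. v \<in> cball 0 1 \<and> bop_apply x v \<in> ball k (\<epsilon>/2))" for k
    define K' where "K' = {k\<in>K. \<exists>v\<in>cball 0 1. bop_apply x v \<in> ball k (\<epsilon>/2)}"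
    have p: "p k \<in> cball 0 1" "bop_apply x (p k) \<in> ball k (\<epsilon>/2)" if "k \<in> K'" for k
    proof -
      have "\<exists>v. v \<in> cball 0 1 \<and> bop_apply x v \<in> ball k (\<epsilon>/2)"
        using that by (auto simp: K'_def)
      from someI_ex[OF this] show "p k \<in> cball 0 1" "bop_apply x (p k) \<in> ball k (\<epsilon>/2)"
        by (auto simp: p_def)
    qed
    have "\<exists>k\<in>p ` K'. norm (bop_apply x (v - k)) < \<epsilon>" if v: "v \<in> cball 0 1" for v
    proof -
      obtain k where k: "k \<in> K" "bop_apply x v \<in> ball k (\<epsilon>/2)"
        using K(2) v by blast
      then have k': "k \<in> K'"
        using v by (auto simp: K'_def)
      have "dist (bop_apply x v) (bop_apply x (p k)) < \<epsilon>"
        using k(2) p(2)[OF k'] by (metis dist_triangle_half_r mem_ball)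
      then show ?thesis
        using k' by (auto simp: dist_norm bop_apply_diff)
    qed
    moreover have "finite (p ` K')"
      using K(1) by (simp add: K'_def)
    moreover have "p ` K' \<subseteq> cball 0 1"
      using p(1) by blast
    ultimately show "\<exists>K. finite K \<and> K \<subseteq> cball 0 1 \<and>
        (\<forall>v\<in>cball 0 1. \<exists>k\<in>K. norm (bop_apply x (v - k)) < \<epsilon>)"
      by blast
  qed
next
  assume R: ?R
  show "compact_bop x"
    unfolding compact_bop_iff_totally_bounded
  proof (intro allI impI)
    fix \<epsilon> :: real assume "0 < \<epsilon>"
    then obtain K where K: "finite K" "\<forall>v\<in>cball 0 1. \<exists>k\<in>K. norm (bop_apply x (v - k)) < \<epsilon>"
      using R by meson
    then have "bop_apply x ` cball 0 1 \<subseteq> (\<Union>k\<in>bop_apply x ` K. ball k \<epsilon>)"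
      by (auto simp: dist_norm norm_minus_commute bop_apply_diff)
    then show "\<exists>K. finite K \<and> bop_apply x ` cball 0 1 \<subseteq> (\<Union>k\<in>K. ball k \<epsilon>)"
      using K(1) by blast
  qed
qed

lemma compact_bop_dominated:
  assumes x: "compact_bop x" and C: "0 \<le> C" "\<And>v. norm (bop_apply y v) \<le> C * norm (bop_apply x v)"
  shows "compact_bop y"
  unfolding compact_bop_iff_net
proof (intro allI impI)
  fix \<epsilon> :: real assume "0 < \<epsilon>"
  then have "0 < \<epsilon> / (C + 1)"
    using C by (intro divide_pos_pos) auto
  then obtain K where K: "finite K" "K \<subseteq> cball 0 1"
      "\<forall>v\<in>cball 0 1. \<exists>k\<in>K. norm (bop_apply x (v - k)) < \<epsilon> / (C + 1)"
    using x unfolding compact_bop_iff_net by meson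
  have "norm (bop_apply y v) < \<epsilon>" if "norm (bop_apply x v) < \<epsilon> / (C + 1)" for v
  proof -
    have "norm (bop_apply y v) \<le> (C + 1) * norm (bop_apply x v)"
      using C(2)[of v] by (auto simp: algebra_simps intro: add_increasing)
    also have "\<dots> < (C + 1) * (\<epsilon> / (C + 1))"
      using that C by (intro mult_strict_left_mono) auto
    finally show ?thesis using C by simp
  qed
  then have "\<forall>v\<in>cball 0 1. \<exists>k\<in>K. norm (bop_apply y (v - k)) < \<epsilon>"
    using K(3) by meson
  then show "\<exists>K. finite K \<and> K \<subseteq> cball 0 1 \<and>
      (\<forall>v\<in>cball 0 1. \<exists>k\<in>K. norm (bop_apply y (v - k)) < \<epsilon>)"
    using K(1,2) by meson
qed

lemma compact_bop_limit:
  assumes X: "\<And>n. compact_bop (X n)" "X \<longlonglongrightarrow> x"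
  shows "compact_bop (x::'a::complex_hilbert bop)"
  unfolding compact_bop_iff_net
proof (intro allI impI)
  fix \<epsilon> :: real assume \<epsilon>: "0 < \<epsilon>"
  then obtain n where n: "norm (X n - x) < \<epsilon> / 4"
    using X(2) unfolding LIMSEQ_iff by (meson divide_pos_pos order_refl zero_less_numeral)
  obtain K where K: "finite K" "K \<subseteq> cball 0 1"
      "\<forall>v\<in>cball 0 1. \<exists>k\<in>K. norm (bop_apply (X n) (v - k)) < \<epsilon> / 2"
    using X(1)[of n] half_gt_zero[OF \<epsilon>] unfolding compact_bop_iff_net by meson
  have "norm (bop_apply x (v - k)) < \<epsilon>"
    if "v \<in> cball 0 1" "k \<in> cball 0 1" "norm (bop_apply (X n) (v - k)) < \<epsilon> / 2" for v k
  proof -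
    have vk: "norm (v - k) \<le> 2"
      using that norm_triangle_ineq4[of v k] by simp
    have "norm (bop_apply (X n - x) (v - k)) \<le> norm (X n - x) * norm (v - k)"
      by (rule norm_bop_apply)
    also have "\<dots> \<le> (\<epsilon> / 4) * 2"
      using n vk \<epsilon> by (intro mult_mono) auto
    finally have "norm (bop_apply (X n) (v - k) - bop_apply x (v - k)) \<le> \<epsilon> / 2"
      by (simp add: bop_ops)
    then show ?thesis
      using that(3) norm_triangle_ineq4[of "bop_apply (X n) (v - k)" "bop_apply (X n) (v - k) - bop_apply x (v - k)"]
      by simp
  qed
  then have "\<forall>v\<in>cball 0 1. \<exists>k\<in>K. norm (bop_apply x (v - k)) < \<epsilon>"
    using K(2,3) by (meson subsetD)
  then show "\<exists>K. finite K \<and> K \<subseteq> cball 0 1 \<and>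
      (\<forall>v\<in>cball 0 1. \<exists>k\<in>K. norm (bop_apply x (v - k)) < \<epsilon>)"
    using K(1,2) by meson
qed

lemma compact_bop_zero: "compact_bop 0"
  by (auto simp: compact_bop_iff_net bop_ops intro!: exI[of _ "{0}"])

lemma compact_bop_add:
  assumes "compact_bop x" "compact_bop y"
  shows "compact_bop (x + y)"
  unfolding compact_bop_iff_totally_bounded
proof (intro allI impI)
  fix \<epsilon> :: real assume "0 < \<epsilon>"
  then have "0 < \<epsilon>/2" by simp
  then obtain K L where K: "finite K" "bop_apply x ` cball 0 1 \<subseteq> (\<Union>k\<in>K. ball k (\<epsilon>/2))"
      and L: "finite L" "bop_apply y ` cball 0 1 \<subseteq> (\<Union>k\<in>L. ball k (\<epsilon>/2))"
    using assms unfolding compact_bop_iff_totally_bounded by meson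
  have "bop_apply (x + y) ` cball 0 1 \<subseteq> (\<Union>k\<in>(\<lambda>(k,l). k + l) ` (K \<times> L). ball k \<epsilon>)"
  proof
    fix w assume "w \<in> bop_apply (x + y) ` cball 0 1"
    then obtain v where v: "v \<in> cball 0 1" "w = bop_apply x v + bop_apply y v"
      by (auto simp: bop_ops)
    obtain k where k: "k \<in> K" "dist k (bop_apply x v) < \<epsilon>/2"
      using K(2) v(1) by fastforce
    obtain l where l: "l \<in> L" "dist l (bop_apply y v) < \<epsilon>/2"
      using L(2) v(1) by fastforce
    have "dist (k + l) w < \<epsilon>"
      unfolding v(2) by (rule dist_triangle_add_half) (use k l in auto)
    then show "w \<in> (\<Union>k\<in>(\<lambda>(k,l). k + l) ` (K \<times> L). ball k \<epsilon>)"
      using k l by force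
  qed
  moreover have "finite ((\<lambda>(k,l). k + l) ` (K \<times> L))"
    using K L by simp
  ultimately show "\<exists>K. finite K \<and> bop_apply (x + y) ` cball 0 1 \<subseteq> (\<Union>k\<in>K. ball k \<epsilon>)"
    by blast
qed

lemma compact_bop_scaleC: "compact_bop x \<Longrightarrow> compact_bop (c *\<^sub>C x)"
  by (rule compact_bop_dominated[of x "cmod c"]) (auto simp: bop_ops norm_scaleC)

lemma compact_bop_scaleR: "compact_bop x \<Longrightarrow> compact_bop (r *\<^sub>R x)"
  unfolding scaleR_scaleC by (rule compact_bop_scaleC)

lemma compact_bop_diff: "compact_bop x \<Longrightarrow> compact_bop y \<Longrightarrow> compact_bop (x - y)"
  using compact_bop_add[of x "(-1) *\<^sub>R y"] compact_bop_scaleR[of y "-1"] by simp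

lemma compact_bop_sum: "(\<And>i. i \<in> A \<Longrightarrow> compact_bop (x i)) \<Longrightarrow> compact_bop (sum x A)"
  by (induction A rule: infinite_finite_induct) (auto simp: compact_bop_zero compact_bop_add)

lemma compact_abs_bop: "compact_bop x \<Longrightarrow> compact_bop (abs_bop x)"
  by (rule compact_bop_dominated[of x 1]) (auto simp: norm_abs_bop_apply)

lemma compact_bop_subseq:
  assumes x: "compact_bop x" and u: "\<And>n::nat. norm (u n) \<le> 1"
  obtains r l where "strict_mono (r :: nat \<Rightarrow> nat)" "(\<lambda>n. bop_apply x (u (r n))) \<longlonglongrightarrow> l"
proof -
  have "\<forall>n. bop_apply x (u n) \<in> closure (bop_apply x ` cball 0 1)"
    using u closure_subset by fastforce
  moreover have "seq_compact (closure (bop_apply x ` cball 0 1))"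
    using x unfolding compact_bop_def by (rule compact_imp_seq_compact)
  ultimately obtain l r where "strict_mono (r :: nat \<Rightarrow> nat)" "((\<lambda>n. bop_apply x (u n)) \<circ> r) \<longlonglongrightarrow> l"
    by (meson seq_compactE)
  then show thesis
    using that by (simp add: o_def)
qed

lift_definition rank_one :: "'a::complex_hilbert \<Rightarrow> 'a \<Rightarrow> 'a bop" is "\<lambda>f e v. cinner v e *\<^sub>C f"
proof -
  fix f e :: 'a
  have "bounded_linear (\<lambda>v. cinner v e *\<^sub>C f)"
  proof (rule bounded_linear_intro[of _ "norm e * norm f"])
    show "norm (cinner v e *\<^sub>C f) \<le> norm v * (norm e * norm f)" for v
      using mult_right_mono[OF cmod_cinner_le[of v e], of "norm f"] by (simp add: norm_scaleC mult_ac)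
  qed (auto simp: cinner_linear scaleC_add_left scaleR_scaleC scaleC_scaleC)
  then show "clinear (\<lambda>v. cinner v e *\<^sub>C f) \<and> bounded_linear (\<lambda>v. cinner v e *\<^sub>C f)"
    by (auto simp: clinear_iff cinner_linear scaleC_add_left scaleC_scaleC)
qed

lemma compact_rank_one: "compact_bop (rank_one f e)"
proof -
  have "continuous_on UNIV (\<lambda>c. c *\<^sub>C f)"
    by (intro linear_continuous_on bounded_linear_intro[of _ "norm f"])
       (auto simp: scaleC_add_left scaleR_scaleC scaleC_scaleC norm_scaleC scaleR_conv_of_real)
  then have K: "compact ((\<lambda>c. c *\<^sub>C f) ` cball 0 (norm e))"
    by (intro compact_continuous_image) (auto intro: continuous_on_subset)
  have "cmod (cinner v e) \<le> norm e" if "norm v \<le> 1" for v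
    using cmod_cinner_le[of v e] mult_right_mono[OF that, of "norm e"] by simp
  then have "bop_apply (rank_one f e) ` cball 0 1 \<subseteq> (\<lambda>c. c *\<^sub>C f) ` cball 0 (norm e)"
    by (auto simp: rank_one.rep_eq intro!: imageI)
  then have "closure (bop_apply (rank_one f e) ` cball 0 1) \<subseteq> (\<lambda>c. c *\<^sub>C f) ` cball 0 (norm e)"
    using K by (simp add: closure_minimal compact_imp_closed)
  then show ?thesis
    unfolding compact_bop_def using K by (metis closed_closure compact_Int_closed inf.absorb_iff2)
qed

subsection \<open>Orthogonal families\<close>

definition orthonormal_on :: "'i set \<Rightarrow> ('i \<Rightarrow> 'a::complex_hilbert) \<Rightarrow> bool"
  where "orthonormal_on A e \<longleftrightarrow> (\<forall>i\<in>A. \<forall>j\<in>A. cinner (e i) (e j) = (if i = j then 1 else 0))"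

text \<open>Families of this kind arise as \<open>x e\<^sub>n / s\<^sub>n\<close> for a singular value decomposition, where
  vanishing singular values leave zero vectors. Bessel's inequality persists.\<close>

definition suborthonormal_on :: "'i set \<Rightarrow> ('i \<Rightarrow> 'a::complex_hilbert) \<Rightarrow> bool"
  where "suborthonormal_on A u \<longleftrightarrow>
    (\<forall>i\<in>A. norm (u i) \<le> 1) \<and> (\<forall>i\<in>A. \<forall>j\<in>A. i \<noteq> j \<longrightarrow> cinner (u i) (u j) = 0)"

lemma orthonormal_on_norm: "orthonormal_on A e \<Longrightarrow> i \<in> A \<Longrightarrow> norm (e i) = 1"
proof -
  assume "orthonormal_on A e" "i \<in> A"
  then have "(norm (e i))\<^sup>2 = 1"
    unfolding orthonormal_on_def Re_cinner_self[symmetric] by (metis one_complex.sel(1))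
  then show ?thesis
    by (metis norm_ge_zero power2_eq_1_iff le_minus_one_simps(3))
qed

lemma orthonormal_imp_suborthonormal: "orthonormal_on A e \<Longrightarrow> suborthonormal_on A e"
  unfolding suborthonormal_on_def by (auto simp: orthonormal_on_norm) (simp add: orthonormal_on_def)

lemma suborthonormal_on_subset: "suborthonormal_on A e \<Longrightarrow> B \<subseteq> A \<Longrightarrow> suborthonormal_on B e"
  by (auto simp: suborthonormal_on_def subset_iff)

lemma orthonormal_on_subset: "orthonormal_on A e \<Longrightarrow> B \<subseteq> A \<Longrightarrow> orthonormal_on B e"
  by (auto simp: orthonormal_on_def subset_iff)

lemma norm_sum_suborthonormal_le:
  assumes "finite A" "suborthonormal_on A u"
  shows "(norm (\<Sum>i\<in>A. c i *\<^sub>C u i))\<^sup>2 \<le> (\<Sum>i\<in>A. (cmod (c i))\<^sup>2)"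
proof -
  have "(norm (\<Sum>i\<in>A. c i *\<^sub>C u i))\<^sup>2 = (\<Sum>i\<in>A. (norm (c i *\<^sub>C u i))\<^sup>2)"
    using assms by (intro norm_sum_sq_orth) (auto simp: cinner_linear suborthonormal_on_def)
  also have "\<dots> \<le> (\<Sum>i\<in>A. (cmod (c i))\<^sup>2)"
  proof (rule sum_mono)
    fix i assume "i \<in> A"
    then have "norm (u i) \<le> 1"
      using assms by (auto simp: suborthonormal_on_def)
    then have "norm (c i *\<^sub>C u i) \<le> cmod (c i)"
      by (simp add: norm_scaleC mult_left_le)
    then show "(norm (c i *\<^sub>C u i))\<^sup>2 \<le> (cmod (c i))\<^sup>2"
      by (simp add: power_mono)
  qed
  finally show ?thesis .
qed

lemma Bessel:
  assumes "finite A" "suborthonormal_on A u"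
  shows "(\<Sum>i\<in>A. (cmod (cinner v (u i)))\<^sup>2) \<le> (norm v)\<^sup>2"
proof -
  define p where "p = (\<Sum>i\<in>A. cinner v (u i) *\<^sub>C u i)"
  define S where "S = (\<Sum>i\<in>A. (cmod (cinner v (u i)))\<^sup>2)"
  have "cinner v p = of_real S"
    unfolding p_def S_def cinner_sum_right cinner_linear of_real_sum
    by (intro sum.cong refl) (metis complex_norm_square mult.commute)
  then have "(norm (v - p))\<^sup>2 = (norm v)\<^sup>2 + (norm p)\<^sup>2 - 2 * S"
    using norm_add_sq[of v "- p"] by (simp add: cinner_minus_right)
  moreover have "(norm p)\<^sup>2 \<le> S"
    unfolding p_def S_def by (rule norm_sum_suborthonormal_le[OF assms])
  ultimately show ?thesis
    unfolding S_def[symmetric] using zero_le_power2[of "norm (v - p)"] by linarith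
qed

definition orth_rest :: "'i set \<Rightarrow> ('i \<Rightarrow> 'a::complex_hilbert) \<Rightarrow> 'a \<Rightarrow> 'a"
  where "orth_rest A e v = v - (\<Sum>i\<in>A. cinner v (e i) *\<^sub>C e i)"

lemma orth_rest_orth:
  assumes "finite A" "orthonormal_on A e" "j \<in> A"
  shows "cinner (orth_rest A e v) (e j) = 0"
proof -
  have "cinner (\<Sum>i\<in>A. cinner v (e i) *\<^sub>C e i) (e j) = (\<Sum>i\<in>A. if i = j then cinner v (e i) else 0)"
    unfolding cinner_sum_left using assms
    by (intro sum.cong refl) (auto simp: cinner_linear orthonormal_on_def)
  then show ?thesis
    using assms by (simp add: orth_rest_def cinner_linear)
qed

lemma norm_orth_rest:
  assumes "finite A" "orthonormal_on A e"
  shows "(norm (orth_rest A e v))\<^sup>2 = (norm v)\<^sup>2 - (\<Sum>i\<in>A. (cmod (cinner v (e i)))\<^sup>2)"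
proof -
  let ?p = "\<Sum>i\<in>A. cinner v (e i) *\<^sub>C e i"
  have "cinner (orth_rest A e v) ?p = 0"
    unfolding cinner_sum_right using orth_rest_orth[OF assms] by (simp add: cinner_linear)
  from norm_add_sq_orth[OF this]
  have "(norm v)\<^sup>2 = (norm (orth_rest A e v))\<^sup>2 + (norm ?p)\<^sup>2"
    by (simp add: orth_rest_def)
  moreover have "(norm ?p)\<^sup>2 = (\<Sum>i\<in>A. (norm (cinner v (e i) *\<^sub>C e i))\<^sup>2)"
    using assms by (intro norm_sum_sq_orth) (auto simp: cinner_linear orthonormal_on_def)
  moreover have "\<dots> = (\<Sum>i\<in>A. (cmod (cinner v (e i)))\<^sup>2)"
    using assms by (intro sum.cong refl) (simp add: norm_scaleC orthonormal_on_norm)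
  ultimately show ?thesis by simp
qed

lemma norm_orth_rest_le:
  assumes "finite A" "orthonormal_on A e"
  shows "norm (orth_rest A e v) \<le> norm v"
proof (rule power2_le_imp_le)
  show "(norm (orth_rest A e v))\<^sup>2 \<le> (norm v)\<^sup>2"
    unfolding norm_orth_rest[OF assms] by (simp add: sum_nonneg)
qed simp

lemma infinite_dimensional_orth_vector:
  fixes e :: "nat \<Rightarrow> 'a::complex_hilbert"
  assumes inf: "infinite_dimensional TYPE('a)" and e: "orthonormal_on {..<n} e"
  shows "\<exists>v. v \<noteq> 0 \<and> (\<forall>i<n. cinner v (e i) = 0)"
proof (rule ccontr)
  assume *: "\<not> ?thesis"
  have "v \<in> cspan (e ` {..<n})" for v
  proof -
    have "orth_rest {..<n} e v = 0"
      using * orth_rest_orth[OF _ e] by auto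
    then have "v = (\<Sum>i<n. cinner v (e i) *\<^sub>C e i)"
      by (simp add: orth_rest_def)
    also have "\<dots> \<in> cspan (e ` {..<n})"
      by (intro complex_vector.span_sum complex_vector.span_scale complex_vector.span_base) auto
    finally show ?thesis .
  qed
  then have "cspan (e ` {..<n}) = UNIV" by blast
  then show False
    using inf unfolding infinite_dimensional_def by blast
qed

subsection \<open>The spectral theorem for positive compact operators\<close>

text \<open>The eigenvalue is the supremum \<open>\<mu>\<close> of \<open>\<langle>a v, v\<rangle>\<close> over unit vectors of the subspace. On a
  maximizing sequence \<open>a u - \<mu> u\<close> tends to 0, since \<open>\<parallel>a u\<parallel>\<^sup>2 \<le> \<mu> \<langle>a u, u\<rangle>\<close>; compactness then
  yields a maximizer.\<close>

lemma positive_compact_top_eigenvector: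
  assumes a: "positive_bop a" "compact_bop a"
    and M: "closed M" "complex_vector.subspace M" "\<And>v. v \<in> M \<Longrightarrow> bop_apply a v \<in> M"
    and ne: "\<exists>v\<in>M. v \<noteq> 0"
  shows "\<exists>e\<in>M. \<exists>\<mu>\<ge>0. norm e = 1 \<and> bop_apply a e = \<mu> *\<^sub>R e
    \<and> (\<forall>v\<in>M. norm (bop_apply a v) \<le> \<mu> * norm v)"
proof -
  define R where "R v = Re (cinner (bop_apply a v) v)" for v
  define U where "U = {v\<in>M. norm v = 1}"
  have Msc: "r *\<^sub>R v \<in> M" if "v \<in> M" for r v
    unfolding scaleR_scaleC using M(2) that by (rule complex_vector.subspace_scale)
  have R0: "0 \<le> R v" for v
    using a by (auto simp: R_def positive_bop_def)
  have bdd: "bdd_above (R ` U)"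
  proof (rule bdd_aboveI[of _ "norm a"])
    fix r assume "r \<in> R ` U"
    then obtain v where v: "norm v = 1" "r = R v" by (auto simp: U_def)
    have "R v \<le> norm (bop_apply a v) * norm v"
      unfolding R_def using cmod_cinner_le complex_Re_le_cmod order_trans by blast
    also have "\<dots> \<le> norm a"
      using v norm_bop_apply[of a v] by simp
    finally show "r \<le> norm a" using v by simp
  qed
  have normalize: "(1 / norm v) *\<^sub>R v \<in> U" if "v \<in> M" "v \<noteq> 0" for v
    using that Msc by (auto simp: U_def)
  then have Une: "U \<noteq> {}"
    using ne by auto
  define \<mu> where "\<mu> = Sup (R ` U)"
  have Rle: "R u \<le> \<mu>" if "u \<in> U" for u
    unfolding \<mu>_def using bdd that by (intro cSup_upper) auto
  then have \<mu>0: "0 \<le> \<mu>"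
    using Une R0 by (meson ex_in_conv order_trans)
  have RleM: "R v \<le> \<mu> * (norm v)\<^sup>2" if v: "v \<in> M" for v
  proof (cases "v = 0")
    case False
    have "R v = (norm v)\<^sup>2 * R ((1 / norm v) *\<^sub>R v)"
      using False by (simp add: R_def bop_apply_linear cinner_linear field_simps power2_eq_square)
    also have "\<dots> \<le> (norm v)\<^sup>2 * \<mu>"
      using v False by (intro mult_left_mono Rle normalize) auto
    finally show ?thesis by (simp add: mult.commute)
  qed (simp add: R_def)
  have nle: "(norm (bop_apply a v))\<^sup>2 \<le> \<mu> * R v" if "v \<in> M" for v
    unfolding R_def using positive_bop_norm_sq_le[OF a(1), of v \<mu>] RleM[OF M(3)[OF that]]
    by (simp add: R_def)
  have nle': "norm (bop_apply a v) \<le> \<mu> * norm v" if v: "v \<in> M" for v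
  proof (rule power2_le_imp_le)
    have "(norm (bop_apply a v))\<^sup>2 \<le> \<mu> * (\<mu> * (norm v)\<^sup>2)"
      using nle[OF v] mult_left_mono[OF RleM[OF v] \<mu>0] by simp
    then show "(norm (bop_apply a v))\<^sup>2 \<le> (\<mu> * norm v)\<^sup>2"
      by (simp add: power2_eq_square mult_ac)
  qed (simp add: \<mu>0)
  have "\<exists>e\<in>U. bop_apply a e = \<mu> *\<^sub>R e"
  proof (cases "\<mu> = 0")
    case True
    obtain e where e: "e \<in> U" using Une by blast
    then have "bop_apply a e = 0"
      using nle'[of e] True by (simp add: U_def)
    then show ?thesis using e True by auto
  next
    case False
    then have \<mu>: "0 < \<mu>" using \<mu>0 by simp
    have "\<exists>u\<in>U. \<mu> - 1 / real (Suc n) < R u" for n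
      using less_cSupD[of "R ` U" "\<mu> - 1 / real (Suc n)"] Une by (auto simp: \<mu>_def)
    then obtain u where u: "\<And>n. u n \<in> U" "\<And>n. \<mu> - 1 / real (Suc n) < R (u n)"
      by metis
    have u1: "norm (u n) = 1" "u n \<in> M" for n
      using u(1)[of n] by (auto simp: U_def)
    have app: "(norm (bop_apply a (u n) - \<mu> *\<^sub>R u n))\<^sup>2 \<le> \<mu> * (1 / real (Suc n))" for n
    proof -
      have "(norm (bop_apply a (u n) - \<mu> *\<^sub>R u n))\<^sup>2
        = (norm (bop_apply a (u n)))\<^sup>2 + \<mu>\<^sup>2 - 2 * \<mu> * R (u n)"
        using norm_add_sq[of "bop_apply a (u n)" "- (\<mu> *\<^sub>R u n)"]
        by (simp add: cinner_linear R_def u1)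
      also have "\<dots> \<le> \<mu> * R (u n) + \<mu>\<^sup>2 - 2 * \<mu> * R (u n)"
        using nle[OF u1(2)[of n]] by simp
      also have "\<dots> = \<mu> * (\<mu> - R (u n))"
        by (simp add: power2_eq_square algebra_simps)
      also have "\<dots> \<le> \<mu> * (1 / real (Suc n))"
        using u(2)[of n] \<mu> by (intro mult_left_mono) auto
      finally show ?thesis .
    qed
    have lim0: "(\<lambda>n. \<mu> * (1 / real (Suc n))) \<longlonglongrightarrow> \<mu> * 0"
      using LIMSEQ_inverse_real_of_nat by (intro tendsto_mult tendsto_const) (simp add: inverse_eq_divide)
    have "(\<lambda>n. (norm (bop_apply a (u n) - \<mu> *\<^sub>R u n))\<^sup>2) \<longlonglongrightarrow> 0"
      by (rule tendsto_sandwich[where f = "\<lambda>_. 0", OF _ _ tendsto_const lim0[simplified mult_zero_right]])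
         (intro always_eventually allI zero_le_power2 app)+
    then have "(\<lambda>n. sqrt ((norm (bop_apply a (u n) - \<mu> *\<^sub>R u n))\<^sup>2)) \<longlonglongrightarrow> sqrt 0"
      by (rule tendsto_real_sqrt)
    then have diff: "(\<lambda>n. bop_apply a (u n) - \<mu> *\<^sub>R u n) \<longlonglongrightarrow> 0"
      by (simp add: tendsto_norm_zero_iff)
    obtain r l where r: "strict_mono r" and l: "(\<lambda>n. bop_apply a (u (r n))) \<longlonglongrightarrow> l"
      using compact_bop_subseq[OF a(2), of u] u1 by auto
    have "(\<lambda>n. bop_apply a (u (r n)) - (bop_apply a (u (r n)) - \<mu> *\<^sub>R u (r n))) \<longlonglongrightarrow> l - 0"
      using LIMSEQ_subseq_LIMSEQ[OF diff r] by (intro tendsto_diff l) (simp add: o_def)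
    then have "(\<lambda>n. (1/\<mu>) *\<^sub>R (\<mu> *\<^sub>R u (r n))) \<longlonglongrightarrow> (1/\<mu>) *\<^sub>R l"
      by (intro tendsto_scaleR tendsto_const) simp
    then have lim: "(\<lambda>n. u (r n)) \<longlonglongrightarrow> (1/\<mu>) *\<^sub>R l"
      using False by simp
    define e where "e = (1/\<mu>) *\<^sub>R l"
    have "e \<in> M"
      using closed_sequentially[OF M(1), of "\<lambda>n. u (r n)" e] u1 lim by (auto simp: e_def)
    moreover have "norm e = 1"
    proof -
      have "(\<lambda>n::nat. 1::real) \<longlonglongrightarrow> norm e"
        using tendsto_norm[OF lim] by (simp only: u1 e_def)
      then show ?thesis by (simp add: LIMSEQ_const_iff)
    qed
    moreover have "(\<lambda>n. bop_apply a (u (r n))) \<longlonglongrightarrow> bop_apply a e"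
      unfolding e_def by (rule bounded_linear.tendsto[OF bounded_linear_bop lim])
    then have "bop_apply a e = l"
      using l LIMSEQ_unique by blast
    moreover have "\<mu> *\<^sub>R e = l"
      using False by (simp add: e_def)
    ultimately show ?thesis
      by (intro bexI[of _ e]) (simp_all add: U_def)
  qed
  then obtain e where "e \<in> M" "norm e = 1" "bop_apply a e = \<mu> *\<^sub>R e"
    by (auto simp: U_def)
  then show ?thesis
    using \<mu>0 nle' by blast
qed

text \<open>Infinite dimension is what allows the sequence of eigenvectors to continue forever; once
  the positive eigenvalues are exhausted it runs through the kernel.\<close>

theorem positive_compact_spectral:
  fixes a :: "'a::complex_hilbert bop"
  assumes inf: "infinite_dimensional TYPE('a)" and a: "positive_bop a" "compact_bop a"
  obtains e :: "nat \<Rightarrow> 'a" and s where "orthonormal_on UNIV e" "decseq s" "\<And>n. 0 \<le> s n" "s \<longlonglongrightarrow> 0"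
    "\<And>n. bop_apply a (e n) = s n *\<^sub>R e n"
    "\<And>n v. (\<And>i. i < n \<Longrightarrow> cinner v (e i) = 0) \<Longrightarrow> norm (bop_apply a v) \<le> s n * norm v"
proof -
  define M where "M S = {v. \<forall>b\<in>S. cinner v b = 0}" for S :: "'a set"
  define P where "P S e \<mu> \<longleftrightarrow> e \<in> M S \<and> 0 \<le> \<mu> \<and> norm e = 1 \<and> bop_apply a e = \<mu> *\<^sub>R e
    \<and> (\<forall>v\<in>M S. norm (bop_apply a v) \<le> \<mu> * norm v)" for S e and \<mu> :: real
  define pick where "pick S = (SOME e. \<exists>\<mu>. P S e \<mu>)" for S
  define S where "S = rec_nat {} (\<lambda>n T. insert (pick T) T)"
  define e where "e n = pick (S n)" for n
  have S_eq: "S n = e ` {..<n}" for n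
    by (induction n) (auto simp: S_def e_def lessThan_Suc)
  have P: "\<exists>\<mu>. P (S n) (e n) \<mu>" for n
  proof (induction n rule: less_induct)
    case (less n)
    have "closed (M (S n))"
    proof -
      have "closed {v. cinner v b = 0}" for b :: 'a
        by (intro closed_Collect_eq linear_continuous_on bounded_linear_cinner_left continuous_on_const)
      moreover have "M (S n) = (\<Inter>b\<in>S n. {v. cinner v b = 0})"
        by (auto simp: M_def)
      ultimately show ?thesis by auto
    qed
    moreover have "complex_vector.subspace (M (S n))"
      by (auto simp: complex_vector.subspace_def M_def cinner_linear)
    moreover have "bop_apply a v \<in> M (S n)" if v: "v \<in> M (S n)" for v
    proof -
      have "cinner (bop_apply a v) (e i) = 0" if i: "i < n" for i
      proof -
        obtain \<mu> where "bop_apply a (e i) = \<mu> *\<^sub>R e i"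
          using less[OF i] by (auto simp: P_def)
        then show ?thesis
          using v i by (simp add: positive_bop_selfadjoint[OF a(1)] cinner_linear M_def S_eq)
      qed
      then show ?thesis by (auto simp: M_def S_eq)
    qed
    moreover have "\<exists>v\<in>M (S n). v \<noteq> 0"
    proof -
      have "cinner (e i) (e j) = 0" if "i < n" "j < i" for i j
        using less[OF that(1)] that by (auto simp: P_def M_def S_eq)
      moreover have "cinner (e i) (e i) = 1" if "i < n" for i
        using less[OF that] by (auto simp: P_def cinner_norm)
      ultimately have "orthonormal_on {..<n} e"
        unfolding orthonormal_on_def by (metis cinner_eq_0_commute lessThan_iff linorder_neqE_nat)
      from infinite_dimensional_orth_vector[OF inf this] show ?thesis
        by (auto simp: M_def S_eq)
    qed
    ultimately have "\<exists>e. \<exists>\<mu>. P (S n) e \<mu>"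
      using positive_compact_top_eigenvector[OF a, of "M (S n)"] unfolding P_def by metis
    then show ?case
      unfolding e_def pick_def by (rule someI_ex)
  qed
  then obtain s where s: "\<And>n. P (S n) (e n) (s n)"
    by metis
  have on: "orthonormal_on UNIV e"
  proof -
    have "cinner (e i) (e j) = 0" if "j < i" for i j
      using s[of i] that by (auto simp: P_def M_def S_eq)
    moreover have "cinner (e i) (e i) = 1" for i
      using s[of i] by (auto simp: P_def cinner_norm)
    ultimately show ?thesis
      unfolding orthonormal_on_def by (metis cinner_eq_0_commute linorder_neqE_nat)
  qed
  have eig: "bop_apply a (e n) = s n *\<^sub>R e n" and s0: "0 \<le> s n" for n
    using s[of n] by (auto simp: P_def)
  have le: "norm (bop_apply a v) \<le> s n * norm v" if "\<And>i. i < n \<Longrightarrow> cinner v (e i) = 0" for n v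
    using s[of n] that by (auto simp: P_def M_def S_eq)
  have dec: "decseq s"
  proof (rule decseq_SucI)
    fix n
    have "norm (bop_apply a (e (Suc n))) \<le> s n * norm (e (Suc n))"
      using on by (intro le) (simp add: orthonormal_on_def)
    then show "s (Suc n) \<le> s n"
      using s0[of "Suc n"] on by (simp add: eig orthonormal_on_norm)
  qed
  obtain L where L: "s \<longlonglongrightarrow> L" "\<And>n. L \<le> s n"
    using decseq_convergent[OF dec, of 0] s0 by auto
  have L0: "0 \<le> L"
    using L(1) s0 by (intro LIMSEQ_le_const) auto
  have "L = 0"
  proof (rule ccontr)
    assume "L \<noteq> 0"
    then have "0 < L" using L0 by simp
    obtain r l where r: "strict_mono (r::nat\<Rightarrow>nat)" "(\<lambda>n. bop_apply a (e (r n))) \<longlonglongrightarrow> l"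
      using compact_bop_subseq[OF a(2), of e] on by (auto simp: orthonormal_on_norm)
    then have "Cauchy (\<lambda>n. bop_apply a (e (r n)))"
      using LIMSEQ_imp_Cauchy by blast
    then obtain N where N: "\<And>m n. N \<le> m \<Longrightarrow> N \<le> n \<Longrightarrow>
        norm (bop_apply a (e (r m)) - bop_apply a (e (r n))) < L"
      using CauchyD[OF _ \<open>0 < L\<close>] by meson
    define i where "i = r N"
    define j where "j = r (Suc N)"
    have "i \<noteq> j"
      using r(1) by (simp add: i_def j_def strict_mono_eq)
    then have "cinner (s i *\<^sub>R e i) (- (s j *\<^sub>R e j)) = 0"
      using on by (simp add: cinner_linear orthonormal_on_def)
    from norm_add_sq_orth[OF this] have "(norm (bop_apply a (e i) - bop_apply a (e j)))\<^sup>2 = (s i)\<^sup>2 + (s j)\<^sup>2"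
      using on by (simp add: eig orthonormal_on_norm)
    moreover have "L\<^sup>2 \<le> (s i)\<^sup>2"
      using L(2) L0 by (simp add: power_mono)
    moreover have "(norm (bop_apply a (e i) - bop_apply a (e j)))\<^sup>2 < L\<^sup>2"
      using N[of N "Suc N"] by (simp add: i_def j_def power_strict_mono)
    ultimately show False
      using zero_le_power2[of "s j"] by linarith
  qed
  then show thesis
    using that[OF on dec s0 _ eig le] L(1) by blast
qed

subsection \<open>Singular values\<close>

text \<open>A non-increasing sequence is determined by the multiplicities of its positive values: at
  the first place where two such sequences differ, the larger value would occur once more in
  the one than in the other.\<close>

lemma decseq_multiplicity_le:
  fixes s t :: "nat \<Rightarrow> real"
  assumes s: "decseq s" and t: "decseq t" "\<And>n. 0 \<le> t n"
    and mult: "\<And>r. 0 < r \<Longrightarrow> finite {n. s n = r} \<and> card {n. s n = r} = card {n. t n = r}"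
    and agree: "\<And>i. i < n \<Longrightarrow> s i = t i"
  shows "s n \<le> t n"
proof (rule ccontr)
  assume "\<not> ?thesis"
  then have less: "t n < s n" by simp
  then have pos: "0 < s n"
    using t(2)[of n] by simp
  have "{i. t i = s n} \<subseteq> {i. i < n \<and> t i = s n}"
  proof safe
    fix i assume i: "t i = s n"
    show "i < n"
    proof (rule ccontr)
      assume "\<not> i < n"
      then have "t i \<le> t n"
        using t(1) by (simp add: decseq_def)
      then show False using less i by simp
    qed
  qed
  also have "\<dots> = {i. i < n \<and> s i = s n}"
    using agree by auto
  finally have "card {i. t i = s n} \<le> card {i. i < n \<and> s i = s n}"
    by (intro card_mono) auto
  also have "\<dots> < card {i. s i = s n}"
    using mult[OF pos] by (intro psubset_card_mono) auto
  finally show False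
    using mult[OF pos] by simp
qed

lemma decseq_multiplicity_unique:
  fixes s t :: "nat \<Rightarrow> real"
  assumes s: "decseq s" "\<And>n. 0 \<le> s n" and t: "decseq t" "\<And>n. 0 \<le> t n"
    and mult: "\<And>r. 0 < r \<Longrightarrow> finite {n. s n = r} \<and> finite {n. t n = r} \<and> card {n. s n = r} = card {n. t n = r}"
  shows "s = t"
proof
  fix n
  show "s n = t n"
  proof (induction n rule: less_induct)
    case (less n)
    have "s n \<le> t n"
      by (rule decseq_multiplicity_le[OF s(1) t]) (use mult less in metis)+
    moreover have "t n \<le> s n"
      by (rule decseq_multiplicity_le[OF t(1) s]) (use mult less in metis)+
    ultimately show ?case by simp
  qed
qed

lemma singular_values_eqI:
  assumes "decseq s" "\<And>n. 0 \<le> s n"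
    and "\<And>t. 0 < t \<Longrightarrow> finite {n. s n = t} \<and> card {n. s n = t} = cdim (eigenspace_bop (abs_bop x) t)"
  shows "singular_values x = s"
  unfolding singular_values_def
proof (rule the_equality)
  show "decseq s \<and> (\<forall>n. 0 \<le> s n) \<and> (\<forall>t>0. finite {n. s n = t} \<and>
      card {n. s n = t} = cdim (eigenspace_bop (abs_bop x) t))"
    by (intro conjI allI impI; use assms in simp)
next
  fix t assume t: "decseq t \<and> (\<forall>n. 0 \<le> t n) \<and> (\<forall>r>0. finite {n. t n = r} \<and>
      card {n. t n = r} = cdim (eigenspace_bop (abs_bop x) r))"
  show "t = s"
  proof (rule decseq_multiplicity_unique)
    show "finite {n. t n = r} \<and> finite {n. s n = r} \<and> card {n. t n = r} = card {n. s n = r}"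
      if "0 < r" for r
      using t assms(3)[OF that] that by metis
  qed (use t assms in auto)
qed

lemma orthonormal_cdim_span:
  assumes "finite A" "orthonormal_on A e"
  shows "cdim (cspan (e ` A)) = card A"
proof -
  have inj: "inj_on e A"
    using assms(2) unfolding inj_on_def orthonormal_on_def by (metis zero_neq_one)
  have "\<not> complex_vector.dependent (e ` A)"
  proof (rule complex_vector.independent_if_scalars_zero)
    fix f x assume sum: "(\<Sum>x\<in>e ` A. f x *\<^sub>C x) = 0" and "x \<in> e ` A"
    then obtain j where j: "j \<in> A" "x = e j" by blast
    have "(\<Sum>x\<in>e ` A. f x *\<^sub>C x) = (\<Sum>i\<in>A. f (e i) *\<^sub>C e i)"
      using inj by (simp add: sum.reindex)
    then have "0 = cinner (\<Sum>i\<in>A. f (e i) *\<^sub>C e i) (e j)"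
      using sum by simp
    also have "\<dots> = (\<Sum>i\<in>A. if i = j then f (e i) else 0)"
      unfolding cinner_sum_left using assms(2) j
      by (intro sum.cong refl) (auto simp: cinner_linear orthonormal_on_def)
    also have "\<dots> = f x"
      using j assms(1) by simp
    finally show "f x = 0" by simp
  qed (use assms in simp)
  then show ?thesis
    using inj by (simp add: complex_vector.dim_eq_card_independent card_image)
qed

text \<open>The data of a singular value decomposition \<open>x = \<Sum> s\<^sub>n \<langle>\<cdot>, e\<^sub>n\<rangle> f\<^sub>n\<close>. Instead of the
  series, the last clause records what is used: beyond the first \<open>n\<close> vectors \<open>e\<^sub>i\<close> the operator
  is bounded by \<open>s\<^sub>n\<close> and maps into the complement of the first \<open>n\<close> vectors \<open>f\<^sub>i\<close>.\<close>

definition svd :: "'a::complex_hilbert bop \<Rightarrow> (nat \<Rightarrow> real) \<Rightarrow> (nat \<Rightarrow> 'a) \<Rightarrow> (nat \<Rightarrow> 'a) \<Rightarrow> bool"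
  where "svd x s e f \<longleftrightarrow> orthonormal_on UNIV e \<and> suborthonormal_on UNIV f
    \<and> decseq s \<and> (\<forall>n. 0 \<le> s n) \<and> s \<longlonglongrightarrow> 0
    \<and> (\<forall>n. bop_apply x (e n) = s n *\<^sub>R f n) \<and> (\<forall>n. 0 < s n \<longrightarrow> norm (f n) = 1)
    \<and> (\<forall>n v. (\<forall>i<n. cinner v (e i) = 0) \<longrightarrow>
         norm (bop_apply x v) \<le> s n * norm v \<and> (\<forall>i<n. cinner (bop_apply x v) (f i) = 0))"

text \<open>Take eigenvectors \<open>e\<^sub>n\<close> of \<open>|x|\<close> and \<open>f\<^sub>n = x e\<^sub>n / s\<^sub>n\<close>. The eigenvalue sequence is the singular
  value sequence because a \<open>t\<close>-eigenvector with \<open>t > 0\<close> that is orthogonal to all \<open>e\<^sub>n\<close> with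
  \<open>s\<^sub>n = t\<close> is orthogonal to every \<open>e\<^sub>n\<close>, hence in the kernel and equal to 0.\<close>

theorem compact_svd:
  fixes x :: "'a::complex_hilbert bop"
  assumes inf: "infinite_dimensional TYPE('a)" and x: "compact_bop x"
  obtains e f where "svd x (singular_values x) e f"
    and "\<And>n. bop_apply (abs_bop x) (e n) = singular_values x n *\<^sub>R e n"
proof -
  define a where "a = abs_bop x"
  obtain e s where on: "orthonormal_on UNIV e" and s: "decseq s" "\<And>n. 0 \<le> s n" "s \<longlonglongrightarrow> 0"
    and eig: "\<And>n. bop_apply a (e n) = s n *\<^sub>R e n"
    and le: "\<And>n v. (\<And>i. i < n \<Longrightarrow> cinner v (e i) = 0) \<Longrightarrow> norm (bop_apply a v) \<le> s n * norm v"
    using positive_compact_spectral[OF inf positive_abs_bop[of x] compact_abs_bop[OF x]]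
    unfolding a_def by blast
  have sa: "cinner (bop_apply a u) v = cinner u (bop_apply a v)" for u v
    unfolding a_def by (rule positive_bop_selfadjoint[OF positive_abs_bop])
  have "singular_values x = s"
  proof (rule singular_values_eqI)
    fix t :: real assume t: "0 < t"
    define A where "A = {n. s n = t}"
    have fin: "finite A"
    proof -
      obtain N where "\<And>n. N \<le> n \<Longrightarrow> s n < t"
        using order_tendstoD(2)[OF s(3) t] by (auto simp: eventually_sequentially)
      then have "A \<subseteq> {..<N}"
        by (auto simp: A_def) (metis leI less_irrefl)
      then show ?thesis using finite_subset by blast
    qed
    have onA: "orthonormal_on A e"
      using on orthonormal_on_subset by blast
    have "eigenspace_bop a t = cspan (e ` A)"
    proof
      show "cspan (e ` A) \<subseteq> eigenspace_bop a t"
      proof (rule complex_vector.span_minimal)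
        show "e ` A \<subseteq> eigenspace_bop a t"
          by (auto simp: eigenspace_bop_def eig A_def)
        show "complex_vector.subspace (eigenspace_bop a t)"
          by (auto simp: complex_vector.subspace_def eigenspace_bop_def bop_apply_linear scaleC_add_right
              scaleR_scaleC scaleC_scaleC mult.commute)
      qed
      show "eigenspace_bop a t \<subseteq> cspan (e ` A)"
      proof
        fix v assume "v \<in> eigenspace_bop a t"
        then have v: "bop_apply a v = t *\<^sub>R v" by (simp add: eigenspace_bop_def)
        define w where "w = orth_rest A e v"
        have aw: "bop_apply a w = t *\<^sub>R w"
          unfolding w_def orth_rest_def
          by (simp add: bop_apply_linear v eig scaleC_diff complex_vector.scale_sum_right A_def
              scaleR_scaleC scaleC_scaleC mult.commute)
        have "cinner w (e i) = 0" for i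
        proof (cases "i \<in> A")
          case True
          then show ?thesis unfolding w_def by (rule orth_rest_orth[OF fin onA])
        next
          case False
          have "of_real t * cinner w (e i) = of_real (s i) * cinner w (e i)"
            using sa[of w "e i"] by (simp add: aw eig cinner_linear)
          then show ?thesis using False by (simp add: A_def)
        qed
        then have "norm (bop_apply a w) \<le> s n * norm w" for n
          using le by blast
        moreover have "(\<lambda>n. s n * norm w) \<longlonglongrightarrow> 0 * norm w"
          by (intro tendsto_intros s)
        ultimately have "norm (bop_apply a w) \<le> 0"
          by (intro LIMSEQ_le_const[of "\<lambda>n. s n * norm w"]) auto
        then have "w = 0" using aw t by (simp add: mult_le_0_iff)
        then have "v = (\<Sum>i\<in>A. cinner v (e i) *\<^sub>C e i)"
          by (simp add: w_def orth_rest_def)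
        also have "\<dots> \<in> cspan (e ` A)"
          by (intro complex_vector.span_sum complex_vector.span_scale complex_vector.span_base) auto
        finally show "v \<in> cspan (e ` A)" .
      qed
    qed
    then show "finite {n. s n = t} \<and> card {n. s n = t} = cdim (eigenspace_bop (abs_bop x) t)"
      using fin orthonormal_cdim_span[OF fin onA] by (simp add: A_def a_def)
  qed (use s in auto)
  moreover
  \<comment> \<open>If \<open>s n = 0\<close>, division by zero makes \<open>f n = 0\<close>, which is consistent with \<open>x (e n) = 0\<close>.\<close>
  define f where "f n = (1 / s n) *\<^sub>R bop_apply x (e n)" for n
  have xcin: "cinner (bop_apply x u) (bop_apply x v) = cinner (bop_apply a u) (bop_apply a v)" for u v
    by (simp add: a_def cinner_abs_bop)
  have nx: "norm (bop_apply x v) = norm (bop_apply a v)" for v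
    by (simp add: a_def norm_abs_bop_apply)
  have nxe: "norm (bop_apply x (e n)) = s n" for n
    using on s by (simp add: nx eig orthonormal_on_norm)
  have "bop_apply x (e n) = s n *\<^sub>R f n" for n
    using nxe[of n] by (cases "s n = 0") (auto simp: f_def)
  moreover have nf: "norm (f n) = (if s n = 0 then 0 else 1)" for n
    using s(2)[of n] by (simp add: f_def nxe)
  moreover have "cinner (f i) (f j) = 0" if "i \<noteq> j" for i j
    using that on by (simp add: f_def cinner_linear xcin eig orthonormal_on_def)
  moreover have "cinner (bop_apply x v) (f i) = 0" if "cinner v (e i) = 0" for v i
    using that by (simp add: f_def cinner_linear xcin eig sa)
  ultimately have "svd x (singular_values x) e f"
    unfolding svd_def suborthonormal_on_def using on s le by (auto simp: nx)
  then show thesis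
    by (rule that) (simp add: \<open>singular_values x = s\<close> eig flip: a_def)
qed

subsection \<open>Ky Fan sums\<close>

text \<open>\<open>kyfan_le k x C\<close> says that the Ky Fan \<open>k\<close>-norm of \<open>x\<close> is at most \<open>C\<close>. For compact
  \<open>x\<close> this norm is the sum of the first \<open>k\<close> singular values, but the definition makes sense for
  all bounded operators and is visibly subadditive.\<close>

definition kyfan_le :: "nat \<Rightarrow> 'a::complex_hilbert bop \<Rightarrow> real \<Rightarrow> bool"
  where "kyfan_le k x C \<longleftrightarrow> (\<forall>u v. suborthonormal_on {..<k} u \<longrightarrow> suborthonormal_on {..<k} v \<longrightarrow>
    (\<Sum>i<k. cmod (cinner (bop_apply x (u i)) (v i))) \<le> C)"

lemma kyfan_leD:
  "kyfan_le k x C \<Longrightarrow> suborthonormal_on {..<k} u \<Longrightarrow> suborthonormal_on {..<k} v \<Longrightarrow>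
    (\<Sum>i<k. cmod (cinner (bop_apply x (u i)) (v i))) \<le> C"
  by (auto simp: kyfan_le_def)

lemma kyfan_le_mono: "kyfan_le k x C \<Longrightarrow> C \<le> D \<Longrightarrow> kyfan_le k x D"
  unfolding kyfan_le_def by (meson order_trans)

lemma kyfan_le_add:
  assumes "kyfan_le k x C" "kyfan_le k y D"
  shows "kyfan_le k (x + y) (C + D)"
  unfolding kyfan_le_def
proof (intro allI impI)
  fix u v :: "nat \<Rightarrow> 'a"
  assume uv: "suborthonormal_on {..<k} u" "suborthonormal_on {..<k} v"
  have "(\<Sum>i<k. cmod (cinner (bop_apply (x + y) (u i)) (v i)))
    \<le> (\<Sum>i<k. cmod (cinner (bop_apply x (u i)) (v i)) + cmod (cinner (bop_apply y (u i)) (v i)))"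
    by (intro sum_mono) (simp add: bop_ops cinner_linear norm_triangle_ineq)
  also have "\<dots> \<le> C + D"
    unfolding sum.distrib using assms uv by (intro add_mono kyfan_leD)
  finally show "(\<Sum>i<k. cmod (cinner (bop_apply (x + y) (u i)) (v i))) \<le> C + D" .
qed

lemma kyfan_le_scaleR:
  assumes "kyfan_le k x C"
  shows "kyfan_le k (r *\<^sub>R x) (\<bar>r\<bar> * C)"
  unfolding kyfan_le_def
proof (intro allI impI)
  fix u v :: "nat \<Rightarrow> 'a"
  assume uv: "suborthonormal_on {..<k} u" "suborthonormal_on {..<k} v"
  have "(\<Sum>i<k. cmod (cinner (bop_apply (r *\<^sub>R x) (u i)) (v i)))
    = \<bar>r\<bar> * (\<Sum>i<k. cmod (cinner (bop_apply x (u i)) (v i)))"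
    by (simp add: bop_ops cinner_linear norm_mult sum_distrib_left)
  also have "\<dots> \<le> \<bar>r\<bar> * C"
    using kyfan_leD[OF assms uv] by (intro mult_left_mono) auto
  finally show "(\<Sum>i<k. cmod (cinner (bop_apply (r *\<^sub>R x) (u i)) (v i))) \<le> \<bar>r\<bar> * C" .
qed

lemma kyfan_le_zero: "kyfan_le k 0 0"
  by (auto simp: kyfan_le_def bop_ops)

lemma kyfan_le_sum:
  "(\<And>i. i \<in> A \<Longrightarrow> kyfan_le k (x i) (C i)) \<Longrightarrow> kyfan_le k (sum x A) (sum C A)"
  by (induction A rule: infinite_finite_induct) (auto simp: kyfan_le_zero kyfan_le_add)

lemma kyfan_le_norm: "kyfan_le k x (real k * norm x)"
  unfolding kyfan_le_def
proof (intro allI impI)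
  fix u v :: "nat \<Rightarrow> 'a"
  assume uv: "suborthonormal_on {..<k} u" "suborthonormal_on {..<k} v"
  have "cmod (cinner (bop_apply x (u i)) (v i)) \<le> norm x" if "i < k" for i
  proof -
    have ui: "norm (u i) \<le> 1" "norm (v i) \<le> 1"
      using uv that by (auto simp: suborthonormal_on_def)
    have "cmod (cinner (bop_apply x (u i)) (v i)) \<le> (norm x * norm (u i)) * norm (v i)"
      by (rule order_trans[OF cmod_cinner_le]) (intro mult_right_mono norm_bop_apply norm_ge_zero)
    also have "\<dots> \<le> (norm x * 1) * 1"
      using ui by (intro mult_mono) auto
    finally show ?thesis by simp
  qed
  then have "(\<Sum>i<k. cmod (cinner (bop_apply x (u i)) (v i))) \<le> (\<Sum>i<k. norm x)"
    by (intro sum_mono) auto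
  then show "(\<Sum>i<k. cmod (cinner (bop_apply x (u i)) (v i))) \<le> real k * norm x"
    by simp
qed

text \<open>\<open>2 |\<langle>u\<^sub>i, e\<rangle>| |\<langle>f, v\<^sub>i\<rangle>|\<close> is at most the sum of the squares, and Bessel's inequality bounds both sums.\<close>

lemma kyfan_le_rank_one:
  assumes "norm e \<le> 1" "norm f \<le> 1"
  shows "kyfan_le k (rank_one f e) 1"
  unfolding kyfan_le_def
proof (intro allI impI)
  fix u v :: "nat \<Rightarrow> 'a"
  assume uv: "suborthonormal_on {..<k} u" "suborthonormal_on {..<k} v"
  define a where "a i = cmod (cinner e (u i))" for i
  define b where "b i = cmod (cinner f (v i))" for i
  have "(\<Sum>i<k. cmod (cinner (bop_apply (rank_one f e) (u i)) (v i))) = (\<Sum>i<k. a i * b i)"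
    by (intro sum.cong refl)
       (simp add: rank_one.rep_eq cinner_linear norm_mult a_def b_def cmod_cinner_commute[of e])
  also have "\<dots> \<le> (\<Sum>i<k. ((a i)\<^sup>2 + (b i)\<^sup>2) / 2)"
    using sum_squares_bound by (intro sum_mono) (simp add: field_simps)
  also have "\<dots> = ((\<Sum>i<k. (a i)\<^sup>2) + (\<Sum>i<k. (b i)\<^sup>2)) / 2"
    by (simp add: sum.distrib flip: sum_divide_distrib)
  also have "\<dots> \<le> ((norm e)\<^sup>2 + (norm f)\<^sup>2) / 2"
    using Bessel[OF _ uv(1), of e] Bessel[OF _ uv(2), of f] by (simp add: a_def b_def)
  also have "\<dots> \<le> 1"
    using assms power_le_one[of "norm e" 2] power_le_one[of "norm f" 2] by simp
  finally show "(\<Sum>i<k. cmod (cinner (bop_apply (rank_one f e) (u i)) (v i))) \<le> 1" .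
qed

lemma kyfan_le_limit:
  assumes "X \<longlonglongrightarrow> x" "C \<longlonglongrightarrow> D" "\<And>n. kyfan_le k (X n) (C n)"
  shows "kyfan_le k x D"
  unfolding kyfan_le_def
proof (intro allI impI)
  fix u v :: "nat \<Rightarrow> 'a"
  assume uv: "suborthonormal_on {..<k} u" "suborthonormal_on {..<k} v"
  have "(\<lambda>n. \<Sum>i<k. cmod (cinner (bop_apply (X n) (u i)) (v i)))
    \<longlonglongrightarrow> (\<Sum>i<k. cmod (cinner (bop_apply x (u i)) (v i)))"
    by (intro tendsto_sum tendsto_norm tendsto_cinner_left tendsto_bop_apply assms(1))
  then show "(\<Sum>i<k. cmod (cinner (bop_apply x (u i)) (v i))) \<le> D"
    using assms(2) by (rule LIMSEQ_le) (use kyfan_leD[OF assms(3) uv] in blast)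
qed

subsection \<open>Truncation of singular value decompositions\<close>

definition svd_head :: "(nat \<Rightarrow> real) \<Rightarrow> (nat \<Rightarrow> 'a::complex_hilbert) \<Rightarrow> (nat \<Rightarrow> 'a) \<Rightarrow> nat \<Rightarrow> 'a bop"
  where "svd_head s e f N = (\<Sum>n<N. s n *\<^sub>R rank_one (f n) (e n))"

lemma svd_facts:
  assumes "svd x s e f"
  shows "orthonormal_on UNIV e" "suborthonormal_on UNIV f" "decseq s" "0 \<le> s n" "s \<longlonglongrightarrow> 0"
    "bop_apply x (e n) = s n *\<^sub>R f n" "0 < s n \<Longrightarrow> norm (f n) = 1" "norm (e n) = 1" "norm (f n) \<le> 1"
    "i < n \<Longrightarrow> s n \<le> s i"
    "(\<And>i. i < n \<Longrightarrow> cinner v (e i) = 0) \<Longrightarrow> norm (bop_apply x v) \<le> s n * norm v"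
    "(\<And>i. i < n \<Longrightarrow> cinner v (e i) = 0) \<Longrightarrow> i < n \<Longrightarrow> cinner (bop_apply x v) (f i) = 0"
proof -
  show "(\<And>i. i < n \<Longrightarrow> cinner v (e i) = 0) \<Longrightarrow> i < n \<Longrightarrow> cinner (bop_apply x v) (f i) = 0"
    using assms unfolding svd_def by metis
qed (use assms in \<open>auto simp: svd_def suborthonormal_on_def decseq_def intro: orthonormal_on_norm\<close>)

lemma svd_tail_apply:
  assumes "svd x s e f"
  shows "bop_apply (x - svd_head s e f N) v = bop_apply x (orth_rest {..<N} e v)"
  by (simp add: svd_head_def orth_rest_def bop_ops bop_sum bop_apply_linear rank_one.rep_eq
      svd_facts(6)[OF assms] scaleR_scaleC scaleC_scaleC mult.commute)

text \<open>The truncated operator exceeds \<open>\<Sum> (s\<^sub>n - s\<^sub>M) \<langle>\<cdot>, e\<^sub>n\<rangle> f\<^sub>n\<close> by an operator of norm at most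
  \<open>s\<^sub>M\<close>. This is the decomposition that realizes the K-functional between the trace norm and the
  operator norm.\<close>

lemma svd_decomposition:
  assumes svd: "svd x s e f" and "N \<le> M"
  obtains Q where "x - svd_head s e f N = (\<Sum>n=N..<M. (s n - s M) *\<^sub>R rank_one (f n) (e n)) + Q"
    "norm Q \<le> s M"
proof
  note sf = svd_facts[OF svd]
  define Q where "Q = (x - svd_head s e f M) + s M *\<^sub>R (\<Sum>n=N..<M. rank_one (f n) (e n))"
  have "svd_head s e f M = svd_head s e f N + (\<Sum>n=N..<M. s n *\<^sub>R rank_one (f n) (e n))"
    unfolding svd_head_def using \<open>N \<le> M\<close>
    by (metis (no_types, lifting) lessThan_atLeast0 le0 sum.atLeastLessThan_concat)
  then show "x - svd_head s e f N = (\<Sum>n=N..<M. (s n - s M) *\<^sub>R rank_one (f n) (e n)) + Q"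
    by (simp add: Q_def scaleR_diff_left sum_subtractf scaleR_sum_right)
  show "norm Q \<le> s M"
  proof (rule norm_bop_le)
    fix v
    define w where "w = orth_rest {..<M} e v"
    have on: "orthonormal_on {..<M} e"
      using sf(1) orthonormal_on_subset by blast
    have w: "cinner w (e i) = 0" if "i < M" for i
      unfolding w_def using orth_rest_orth[OF _ on] that by simp
    define p where "p = (\<Sum>n=N..<M. cinner v (e n) *\<^sub>C f n)"
    have Qv: "bop_apply Q v = bop_apply x w + s M *\<^sub>R p"
      by (simp add: Q_def w_def p_def svd_tail_apply[OF svd] bop_ops(1,5) bop_sum rank_one.rep_eq)
    have "cinner (bop_apply x w) (s M *\<^sub>R p) = 0"
      unfolding p_def cinner_linear cinner_sum_right using sf(12)[OF w] by simp
    from norm_add_sq_orth[OF this]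
    have "(norm (bop_apply Q v))\<^sup>2 = (norm (bop_apply x w))\<^sup>2 + (s M)\<^sup>2 * (norm p)\<^sup>2"
      by (simp add: Qv power_mult_distrib)
    also have "\<dots> \<le> (s M * norm w)\<^sup>2 + (s M)\<^sup>2 * (\<Sum>n=N..<M. (cmod (cinner v (e n)))\<^sup>2)"
      unfolding p_def using sf(11)[OF w]
      by (intro add_mono power_mono mult_left_mono norm_sum_suborthonormal_le
          suborthonormal_on_subset[OF sf(2)]) auto
    also have "\<dots> \<le> (s M * norm w)\<^sup>2 + (s M)\<^sup>2 * (\<Sum>n<M. (cmod (cinner v (e n)))\<^sup>2)"
      by (intro add_mono mult_left_mono sum_mono2) auto
    also have "\<dots> = (s M * norm v)\<^sup>2"
      by (simp add: w_def power_mult_distrib norm_orth_rest[OF finite_lessThan on] algebra_simps)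
    finally show "norm (bop_apply Q v) \<le> s M * norm v"
      by (rule power2_le_imp_le) (simp add: sf(4))
  qed (rule sf(4))
qed

text \<open>A map that does not increase the operator norm and sends the rank one operators of the
  decomposition to operators of trace norm at most 1 does not increase Ky Fan sums.\<close>

lemma kyfan_le_transfer:
  fixes T :: "'a::complex_hilbert bop \<Rightarrow> 'a bop"
  assumes svd: "svd x s e f" and T: "linear T" "\<And>z. norm (T z) \<le> norm z"
    and rank: "\<And>n. kyfan_le k (T (rank_one (f n) (e n))) 1"
  shows "kyfan_le k (T (x - svd_head s e f N)) (\<Sum>i<k. s (N + i))"
proof -
  obtain Q where Q: "x - svd_head s e f N = (\<Sum>n=N..<N+k. (s n - s (N+k)) *\<^sub>R rank_one (f n) (e n)) + Q"
    "norm Q \<le> s (N + k)"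
    using svd_decomposition[OF svd, of N "N + k"] by auto
  have "kyfan_le k ((s n - s (N+k)) *\<^sub>R T (rank_one (f n) (e n))) (s n - s (N+k))"
    if "n \<in> {N..<N+k}" for n
    using kyfan_le_scaleR[OF rank[of n], of "s n - s (N+k)"] svd_facts(10)[OF svd, of n "N+k"] that
    by simp
  then have "kyfan_le k (\<Sum>n=N..<N+k. (s n - s (N+k)) *\<^sub>R T (rank_one (f n) (e n)))
      (\<Sum>n=N..<N+k. s n - s (N+k))"
    by (rule kyfan_le_sum)
  moreover have "kyfan_le k (T Q) (real k * s (N + k))"
    using kyfan_le_norm[of k "T Q"]
    by (rule kyfan_le_mono) (use T(2)[of Q] Q(2) in \<open>auto intro!: mult_left_mono\<close>)
  ultimately have "kyfan_le k ((\<Sum>n=N..<N+k. (s n - s (N+k)) *\<^sub>R T (rank_one (f n) (e n))) + T Q)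
    ((\<Sum>n=N..<N+k. s n - s (N+k)) + real k * s (N + k))"
    by (rule kyfan_le_add)
  moreover have "(\<Sum>n=N..<N+k. s n - s (N+k)) + real k * s (N + k) = (\<Sum>i<k. s (N + i))"
    using sum.shift_bounds_nat_ivl[of s 0 N k]
    by (simp add: sum_subtractf lessThan_atLeast0 add.commute)
  ultimately show ?thesis
    unfolding Q(1) by (simp add: linear_add[OF T(1)] linear_sum[OF T(1)] linear_scale[OF T(1)])
qed

lemma svd_tail_kyfan:
  assumes "svd x s e f"
  shows "kyfan_le k (x - svd_head s e f N) (\<Sum>i<k. s (N + i))"
  using assms by (rule kyfan_le_transfer[of x s e f "\<lambda>z. z"])
    (auto simp: linear_iff intro!: kyfan_le_rank_one svd_facts(9)[OF assms] eq_refl[OF svd_facts(8)[OF assms]])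

lemma svd_kyfan:
  assumes "svd x s e f"
  shows "kyfan_le k x (\<Sum>i<k. s i)"
  using svd_tail_kyfan[OF assms, of k 0] by (simp add: svd_head_def)

text \<open>The Ky Fan norm is attained at the families \<open>e\<close> and \<open>f\<close> of the decomposition.\<close>

lemma svd_kyfan_attained:
  assumes "svd x s e f" and "kyfan_le k x C"
  shows "(\<Sum>i<k. s i) \<le> C"
proof -
  note sf = svd_facts[OF assms(1)]
  have "s i = cmod (cinner (bop_apply x (e i)) (f i))" for i
    using sf(4)[of i] sf(7)[of i] by (cases "s i = 0") (auto simp: sf(6) cinner_linear cinner_norm)
  then have "(\<Sum>i<k. s i) = (\<Sum>i<k. cmod (cinner (bop_apply x (e i)) (f i)))"
    by simp
  also have "\<dots> \<le> C"
    using sf(1,2) orthonormal_imp_suborthonormal suborthonormal_on_subset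
    by (intro kyfan_leD[OF assms(2)]) blast+
  finally show ?thesis .
qed

lemma svd_tail_norm:
  assumes "svd x s e f"
  shows "norm (x - svd_head s e f N) \<le> s N"
  using svd_decomposition[OF assms, of N N] by auto

lemma svd_head_tendsto:
  assumes "svd x s e f"
  shows "svd_head s e f \<longlonglongrightarrow> x"
proof -
  have "(\<lambda>N. norm (x - svd_head s e f N)) \<longlonglongrightarrow> 0"
    by (rule tendsto_sandwich[where f = "\<lambda>_. 0", OF _ _ tendsto_const svd_facts(5)[OF assms]])
       (intro always_eventually allI norm_ge_zero svd_tail_norm[OF assms])+
  then show ?thesis
    by (subst (asm) norm_minus_commute) (simp add: tendsto_norm_zero_iff LIM_zero_cancel)
qed

lemma compact_svd_head: "compact_bop (svd_head s e f N)"
  unfolding svd_head_def by (intro compact_bop_sum compact_bop_scaleR compact_rank_one)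

text \<open>From here on decompositions are replaced by the equivalence of Ky Fan bounds with bounds for
  sums of singular values.\<close>

context
  assumes inf: "infinite_dimensional TYPE('a::complex_hilbert)"
begin

lemma singular_values_props:
  fixes x :: "'a bop"
  assumes "compact_bop x"
  shows "decseq (singular_values x)" "0 \<le> singular_values x n" "singular_values x \<longlonglongrightarrow> 0"
  using compact_svd[OF inf assms] svd_facts(3,4,5) by metis+

lemma kyfan_le_iff:
  fixes x :: "'a bop"
  assumes "compact_bop x"
  shows "kyfan_le k x C \<longleftrightarrow> (\<Sum>i<k. singular_values x i) \<le> C"
proof -
  obtain e f where "svd x (singular_values x) e f"
    using compact_svd[OF inf assms] by blast
  then show ?thesis
    using svd_kyfan svd_kyfan_attained kyfan_le_mono by metis
qed

lemma singular_values_0: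
  fixes x :: "'a bop"
  assumes "compact_bop x"
  shows "singular_values x 0 = norm x"
proof -
  obtain e f where svd: "svd x (singular_values x) e f"
    using compact_svd[OF inf assms] by blast
  have "norm x \<le> singular_values x 0"
    using svd_tail_norm[OF svd, of 0] by (simp add: svd_head_def)
  moreover have "singular_values x 0 \<le> norm x"
    using svd_kyfan_attained[OF svd kyfan_le_norm[of 1]] by simp
  ultimately show ?thesis by simp
qed

lemma singular_values_scaleR_sum:
  fixes x :: "'a bop"
  assumes "compact_bop x"
  shows "(\<Sum>i<k. singular_values (r *\<^sub>R x) i) \<le> \<bar>r\<bar> * (\<Sum>i<k. singular_values x i)"
  using assms kyfan_le_scaleR[of k x _ r] by (auto simp: compact_bop_scaleR simp flip: kyfan_le_iff)
    (simp add: kyfan_le_iff)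

lemma singular_values_add_sum:
  fixes x :: "'a bop"
  assumes "compact_bop x" "compact_bop y"
  shows "(\<Sum>i<k. singular_values (x + y) i) \<le> (\<Sum>i<k. singular_values x i) + (\<Sum>i<k. singular_values y i)"
proof -
  have "kyfan_le k (x + y) ((\<Sum>i<k. singular_values x i) + (\<Sum>i<k. singular_values y i))"
    using assms by (intro kyfan_le_add) (auto simp: kyfan_le_iff)
  then show ?thesis
    using assms by (simp add: kyfan_le_iff compact_bop_add)
qed

end

section \<open>Orthonormal bases, the trace norm and the Hilbert-Schmidt norm\<close>

subsection \<open>Existence of orthonormal bases\<close>

lemma closure_complex_subspace:
  assumes M: "complex_vector.subspace (M :: 'a::complex_hilbert set)"
  shows "complex_vector.subspace (closure M)"
  unfolding complex_vector.subspace_def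
proof (intro conjI ballI allI)
  show "0 \<in> closure M"
    using complex_vector.subspace_0[OF M] closure_subset by blast
  fix x assume "x \<in> closure M"
  then obtain X where X: "\<And>n::nat. X n \<in> M" "X \<longlonglongrightarrow> x"
    unfolding closure_sequential by blast
  show "c *\<^sub>C x \<in> closure M" for c
    unfolding closure_sequential
  proof (intro exI[of _ "\<lambda>n. c *\<^sub>C X n"] conjI allI)
    show "c *\<^sub>C X n \<in> M" for n
      using M X(1) by (rule complex_vector.subspace_scale)
    show "(\<lambda>n. c *\<^sub>C X n) \<longlonglongrightarrow> c *\<^sub>C x"
      by (rule bounded_linear.tendsto[OF bounded_linear_scaleC X(2)])
  qed
  fix y assume "y \<in> closure M"
  then obtain Y where Y: "\<And>n::nat. Y n \<in> M" "Y \<longlonglongrightarrow> y"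
    unfolding closure_sequential by blast
  show "x + y \<in> closure M"
    unfolding closure_sequential
  proof (intro exI[of _ "\<lambda>n. X n + Y n"] conjI allI)
    show "X n + Y n \<in> M" for n
      using M X(1) Y(1) by (rule complex_vector.subspace_add)
    show "(\<lambda>n. X n + Y n) \<longlonglongrightarrow> x + y"
      by (rule tendsto_add[OF X(2) Y(2)])
  qed
qed

text \<open>A maximal orthonormal set spans a dense subspace: otherwise the difference between a vector
  and its projection would extend the set.\<close>

lemma orthonormal_basis_exists: "\<exists>B::'a::complex_hilbert set. orthonormal_basis B"
proof -
  define ON where "ON = {B::'a set. \<forall>e\<in>B. \<forall>f\<in>B. cinner e f = (if e = f then 1 else 0)}"
  have "\<exists>M\<in>ON. \<forall>X\<in>ON. M \<subseteq> X \<longrightarrow> X = M"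
  proof (rule subset_Zorn')
    fix \<C> assume "subset.chain ON \<C>"
    then have C: "\<C> \<subseteq> ON" "\<And>X Y. X \<in> \<C> \<Longrightarrow> Y \<in> \<C> \<Longrightarrow> X \<subseteq> Y \<or> Y \<subseteq> X"
      by (auto simp: subset_chain_def)
    show "\<Union>\<C> \<in> ON"
      unfolding ON_def
    proof (intro CollectI ballI)
      fix e f assume "e \<in> \<Union>\<C>" "f \<in> \<Union>\<C>"
      then obtain X Y where XY: "X \<in> \<C>" "e \<in> X" "Y \<in> \<C>" "f \<in> Y" by blast
      then have "\<exists>Z\<in>\<C>. e \<in> Z \<and> f \<in> Z"
        using C(2)[of X Y] by blast
      then show "cinner e f = (if e = f then 1 else 0)"
        using C(1) by (auto simp: ON_def)
    qed
  qed
  then obtain B where B: "B \<in> ON" "\<And>X. X \<in> ON \<Longrightarrow> B \<subseteq> X \<Longrightarrow> X = B"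
    by blast
  have "closure (cspan B) = UNIV"
  proof (rule ccontr)
    assume "closure (cspan B) \<noteq> UNIV"
    then obtain x where x: "x \<notin> closure (cspan B)" by blast
    have sub: "complex_vector.subspace (closure (cspan B))"
      by (intro closure_complex_subspace complex_vector.subspace_span)
    have "\<exists>y\<in>closure (cspan B). \<forall>v\<in>closure (cspan B). cinner v x = cinner v y"
      by (rule Riesz_subspace[OF sub, where C = "norm x"])
         (auto simp: cinner_linear mult.commute[of "norm x"] intro: cmod_cinner_le)
    then obtain y where y: "y \<in> closure (cspan B)" "\<And>v. v \<in> closure (cspan B) \<Longrightarrow> cinner v x = cinner v y"
      by blast
    define z where "z = (1 / norm (x - y)) *\<^sub>R (x - y)"
    have "x \<noteq> y" using x y(1) by blast
    then have nz: "norm z = 1" by (simp add: z_def)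
    have orth: "cinner b z = 0" if "b \<in> B" for b
    proof -
      have "b \<in> closure (cspan B)"
        using that complex_vector.span_base closure_subset by blast
      then show ?thesis
        using y(2) by (simp add: z_def cinner_linear)
    qed
    then have "cinner z b = 0" if "b \<in> B" for b
      using that cinner_eq_0_commute by blast
    moreover have "z \<notin> B"
      using orth[of z] nz by (auto simp: cinner_norm)
    ultimately have "insert z B \<in> ON"
      using B(1) orth nz by (auto simp: ON_def cinner_norm)
    then show False
      using B(2)[of "insert z B"] \<open>z \<notin> B\<close> by blast
  qed
  then show ?thesis
    using B(1) unfolding orthonormal_basis_def ON_def by blast
qed

text \<open>The basis chosen in the definition of the trace.\<close>

definition onb :: "'a::complex_hilbert set"
  where "onb = (SOME B. orthonormal_basis B)"

lemma orthonormal_basis_onb: "orthonormal_basis onb"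
  unfolding onb_def using orthonormal_basis_exists by (rule someI_ex)

lemma orthonormal_on_onb: "F \<subseteq> (onb :: 'a::complex_hilbert set) \<Longrightarrow> orthonormal_on F (\<lambda>b. b)"
  using orthonormal_basis_onb[where 'a = 'a] by (auto simp: orthonormal_basis_def orthonormal_on_def subset_iff)

text \<open>An element of the linear span that is close to \<open>v\<close> involves finitely many basis vectors, and the
  orthogonal projection onto their span is at least as close.\<close>

lemma Parseval_approx:
  assumes "0 < \<epsilon>"
  obtains F where "finite F" "F \<subseteq> onb" "(norm (v::'a::complex_hilbert))\<^sup>2 - \<epsilon> \<le> (\<Sum>b\<in>F. (cmod (cinner v b))\<^sup>2)"
proof -
  have "v \<in> closure (cspan onb)"
    using orthonormal_basis_onb by (auto simp: orthonormal_basis_def)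
  then obtain w where w: "w \<in> cspan onb" "dist w v < sqrt \<epsilon>"
    unfolding closure_approachable using assms real_sqrt_gt_zero by blast
  then obtain F c where F: "finite F" "F \<subseteq> onb" and w_eq: "w = (\<Sum>b\<in>F. c b *\<^sub>C b)"
    unfolding complex_vector.span_explicit by blast
  have on: "orthonormal_on F (\<lambda>b. b)"
    using F(2) by (rule orthonormal_on_onb)
  have coeff: "cinner w b = c b" if "b \<in> F" for b
  proof -
    have "cinner w b = (\<Sum>b'\<in>F. if b' = b then c b' else 0)"
      unfolding w_eq cinner_sum_left using on that
      by (intro sum.cong refl) (auto simp: cinner_linear orthonormal_on_def)
    then show ?thesis using F(1) that by simp
  qed
  have "orth_rest F (\<lambda>b. b) (v - w) = orth_rest F (\<lambda>b. b) v - (w - (\<Sum>b\<in>F. cinner w b *\<^sub>C b))"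
    by (simp add: orth_rest_def cinner_linear complex_vector.scale_left_diff_distrib sum_subtractf)
  also have "w - (\<Sum>b\<in>F. cinner w b *\<^sub>C b) = 0"
    using coeff by (simp add: w_eq cong: sum.cong)
  finally have "norm (orth_rest F (\<lambda>b. b) v) \<le> norm (v - w)"
    using norm_orth_rest_le[OF F(1) on, of "v - w"] by simp
  then have "(norm (orth_rest F (\<lambda>b. b) v))\<^sup>2 \<le> (sqrt \<epsilon>)\<^sup>2"
    using w(2) by (intro power_mono) (auto simp: dist_norm norm_minus_commute)
  then show thesis
    using F assms norm_orth_rest[OF F(1) on, of v] by (intro that) auto
qed

text \<open>Basis independence of the trace and of the Hilbert-Schmidt norm enters through this
  consequence of Parseval's identity: diagonal sums over the chosen basis dominate spectral data
  that belong to some other orthonormal family.\<close>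

lemma basis_sum_dominates:
  fixes e :: "nat \<Rightarrow> 'a::complex_hilbert"
  assumes c: "\<And>m. m < k \<Longrightarrow> 0 \<le> c m" and e: "\<And>m. m < k \<Longrightarrow> norm (e m) = 1"
    and g: "\<And>b. b \<in> onb \<Longrightarrow> (\<Sum>m<k. c m * (cmod (cinner b (e m)))\<^sup>2) \<le> g b"
    and \<tau>: "\<And>F. finite F \<Longrightarrow> F \<subseteq> onb \<Longrightarrow> sum g F \<le> \<tau>"
  shows "(\<Sum>m<k. c m) \<le> \<tau>"
proof (rule field_le_mult_one_interval)
  fix z :: real assume z: "0 < z" "z < 1"
  have "\<exists>F. finite F \<and> F \<subseteq> onb \<and> (m < k \<longrightarrow> z \<le> (\<Sum>b\<in>F. (cmod (cinner b (e m)))\<^sup>2))" for m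
  proof -
    obtain F where "finite F" "F \<subseteq> onb" "(norm (e m))\<^sup>2 - (1 - z) \<le> (\<Sum>b\<in>F. (cmod (cinner (e m) b))\<^sup>2)"
      using Parseval_approx[of "1 - z" "e m"] z by auto
    then show ?thesis
      using e[of m] by (auto simp: cmod_cinner_commute[of _ "e m"])
  qed
  then obtain F where F: "\<And>m. finite (F m)" "\<And>m. F m \<subseteq> onb"
    "\<And>m. m < k \<Longrightarrow> z \<le> (\<Sum>b\<in>F m. (cmod (cinner b (e m)))\<^sup>2)"
    by metis
  define G where "G = (\<Union>m<k. F m)"
  have G: "finite G" "G \<subseteq> onb"
    using F by (auto simp: G_def)
  have "z * (\<Sum>m<k. c m) = (\<Sum>m<k. c m * z)"
    by (simp add: sum_distrib_left mult.commute)
  also have "\<dots> \<le> (\<Sum>m<k. c m * (\<Sum>b\<in>G. (cmod (cinner b (e m)))\<^sup>2))"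
  proof (intro sum_mono mult_left_mono)
    fix m assume "m \<in> {..<k}"
    then have "z \<le> (\<Sum>b\<in>F m. (cmod (cinner b (e m)))\<^sup>2)"
      using F by simp
    also have "\<dots> \<le> (\<Sum>b\<in>G. (cmod (cinner b (e m)))\<^sup>2)"
      using \<open>m \<in> {..<k}\<close> G by (intro sum_mono2) (auto simp: G_def)
    finally show "z \<le> (\<Sum>b\<in>G. (cmod (cinner b (e m)))\<^sup>2)" .
  qed (use c in auto)
  also have "\<dots> = (\<Sum>b\<in>G. \<Sum>m<k. c m * (cmod (cinner b (e m)))\<^sup>2)"
    unfolding sum_distrib_left by (rule sum.swap)
  also have "\<dots> \<le> sum g G"
    using g G by (intro sum_mono) auto
  also have "\<dots> \<le> \<tau>"
    using \<tau> G by blast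
  finally show "z * (\<Sum>m<k. c m) \<le> \<tau>" .
qed

lemma infsum_ennreal_le_iff:
  assumes g: "\<And>b. b \<in> A \<Longrightarrow> 0 \<le> g b" and "0 \<le> C"
  shows "(\<Sum>\<^sub>\<infinity>b\<in>A. ennreal (g b)) \<le> ennreal C \<longleftrightarrow> (\<forall>F. finite F \<and> F \<subseteq> A \<longrightarrow> sum g F \<le> C)"
proof -
  have "(\<Sum>\<^sub>\<infinity>b\<in>A. ennreal (g b)) = (SUP F\<in>{F. finite F \<and> F \<subseteq> A}. \<Sum>b\<in>F. ennreal (g b))"
    by (rule nonneg_infsum_complete) auto
  moreover have "(\<Sum>b\<in>F. ennreal (g b)) \<le> ennreal C \<longleftrightarrow> sum g F \<le> C" if "F \<subseteq> A" for F
    using that g \<open>0 \<le> C\<close> by (subst sum_ennreal) (auto simp: subset_iff)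
  ultimately show ?thesis
    by (auto simp: SUP_le_iff)
qed

subsection \<open>The trace norm and Ky Fan sums\<close>

lemma trace_norm_le_iff:
  assumes "0 \<le> C"
  shows "trace_norm x \<le> ennreal C \<longleftrightarrow>
    (\<forall>F. finite F \<and> F \<subseteq> onb \<longrightarrow> (\<Sum>b\<in>F. Re (cinner (bop_apply (abs_bop x) b) b)) \<le> C)"
  unfolding trace_norm_def trace_bop_def onb_def[symmetric]
  using assms positive_abs_bop[of x] by (intro infsum_ennreal_le_iff) (auto simp: positive_bop_def)

text \<open>Beyond a large finite part \<open>F\<close> of the basis the diagonal of \<open>a = |x|\<close> is small, hence so is
  \<open>(1 - P\<^sub>F) a\<close>, because \<open>\<parallel>a b\<parallel>\<^sup>2 \<le> \<parallel>a\<parallel> \<langle>a b, b\<rangle>\<close>. So \<open>a\<close> is a norm limit of the finite rank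
  operators \<open>P\<^sub>F a\<close>.\<close>

lemma trace_class_compact:
  assumes le: "trace_norm x \<le> ennreal C" and "0 \<le> C"
  shows "compact_bop x"
proof -
  define a where "a = abs_bop x"
  define g where "g b = Re (cinner (bop_apply a b) b)" for b
  have pos: "positive_bop a"
    by (simp add: a_def positive_abs_bop)
  have g0: "0 \<le> g b" for b
    using pos by (auto simp: g_def positive_bop_def)
  define S where "S = sum g ` {F. finite F \<and> F \<subseteq> onb}"
  have S: "S \<noteq> {}" "bdd_above S"
    using le[unfolded trace_norm_le_iff[OF \<open>0 \<le> C\<close>]]
    by (auto simp: S_def g_def a_def intro!: bdd_aboveI[of _ C])
  have nab: "(norm (bop_apply a b))\<^sup>2 \<le> norm a * g b" for b
    unfolding g_def
  proof (rule positive_bop_norm_sq_le[OF pos])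
    have "Re (cinner (bop_apply a (bop_apply a b)) (bop_apply a b))
        \<le> norm (bop_apply a (bop_apply a b)) * norm (bop_apply a b)"
      using cmod_cinner_le complex_Re_le_cmod order_trans by blast
    also have "\<dots> \<le> (norm a * norm (bop_apply a b)) * norm (bop_apply a b)"
      by (intro mult_right_mono norm_bop_apply) auto
    finally show "Re (cinner (bop_apply a (bop_apply a b)) (bop_apply a b)) \<le> norm a * (norm (bop_apply a b))\<^sup>2"
      by (simp add: power2_eq_square mult_ac)
  qed
  have approx: "\<exists>y. compact_bop y \<and> norm (a - y) \<le> sqrt (norm a * \<delta>)" if "0 < \<delta>" for \<delta>
  proof -
    have "\<exists>r\<in>S. Sup S - \<delta> < r"
      using S that by (intro less_cSupD) auto
    then obtain F where F: "finite F" "F \<subseteq> onb" "Sup S - \<delta> < sum g F"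
      by (auto simp: S_def)
    have small: "sum g G \<le> \<delta>" if "finite G" "G \<subseteq> onb - F" for G
    proof -
      have "sum g F + sum g G = sum g (F \<union> G)"
        using that F by (intro sum.union_disjoint[symmetric]) auto
      also have "\<dots> \<le> Sup S"
        using that F S by (intro cSup_upper) (auto simp: S_def)
      finally show ?thesis using F(3) by simp
    qed
    have on: "orthonormal_on F (\<lambda>b. b)"
      using F(2) by (rule orthonormal_on_onb)
    define y where "y = (\<Sum>b\<in>F. rank_one b (bop_apply a b))"
    have "norm (a - y) \<le> sqrt (norm a * \<delta>)"
    proof (rule norm_bop_le)
      fix v
      define w where "w = orth_rest F (\<lambda>b. b) (bop_apply a v)"
      have ay: "bop_apply (a - y) v = w"
        by (simp add: y_def w_def orth_rest_def bop_ops bop_sum rank_one.rep_eq positive_bop_selfadjoint[OF pos])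
      have wle: "(norm w)\<^sup>2 \<le> norm a * \<delta> * (norm v)\<^sup>2"
      proof (rule field_le_epsilon)
        fix \<eta> :: real assume "0 < \<eta>"
        then obtain G where G: "finite G" "G \<subseteq> onb" "(norm w)\<^sup>2 - \<eta> \<le> (\<Sum>b\<in>G. (cmod (cinner w b))\<^sup>2)"
          using Parseval_approx by blast
        have "(\<Sum>b\<in>G. (cmod (cinner w b))\<^sup>2) = (\<Sum>b\<in>G-F. (cmod (cinner w b))\<^sup>2)"
          using G(1) orth_rest_orth[OF F(1) on] by (intro sum.mono_neutral_right) (auto simp: w_def)
        also have "\<dots> \<le> (\<Sum>b\<in>G-F. (norm v)\<^sup>2 * (norm a * g b))"
        proof (rule sum_mono)
          fix b assume b: "b \<in> G - F"
          have "cinner (\<Sum>i\<in>F. cinner (bop_apply a v) i *\<^sub>C i) b = 0"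
            unfolding cinner_sum_left using b G(2) F(2) orthonormal_on_onb[of "F \<union> G"]
            by (intro sum.neutral) (auto simp: cinner_linear orthonormal_on_def)
          then have "cinner w b = cinner v (bop_apply a b)"
            by (simp add: w_def orth_rest_def cinner_linear positive_bop_selfadjoint[OF pos])
          then have "(cmod (cinner w b))\<^sup>2 \<le> (norm v * norm (bop_apply a b))\<^sup>2"
            using cmod_cinner_le by (simp add: power_mono)
          also have "\<dots> \<le> (norm v)\<^sup>2 * (norm a * g b)"
            unfolding power_mult_distrib by (intro mult_left_mono nab) auto
          finally show "(cmod (cinner w b))\<^sup>2 \<le> (norm v)\<^sup>2 * (norm a * g b)" .
        qed
        also have "\<dots> = (norm v)\<^sup>2 * (norm a * sum g (G - F))"
          by (simp add: sum_distrib_left)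
        also have "\<dots> \<le> (norm v)\<^sup>2 * (norm a * \<delta>)"
          using G by (intro mult_left_mono small) auto
        finally show "(norm w)\<^sup>2 \<le> norm a * \<delta> * (norm v)\<^sup>2 + \<eta>"
          using G(3) by (simp add: mult_ac)
      qed
      have "norm w = sqrt ((norm w)\<^sup>2)" by simp
      also have "\<dots> \<le> sqrt (norm a * \<delta> * (norm v)\<^sup>2)"
        using wle by (rule real_sqrt_le_mono)
      finally show "norm (bop_apply (a - y) v) \<le> sqrt (norm a * \<delta>) * norm v"
        by (simp add: ay real_sqrt_mult)
    qed (use that in simp)
    moreover have "compact_bop y"
      unfolding y_def by (intro compact_bop_sum compact_rank_one)
    ultimately show ?thesis by blast
  qed
  have "\<exists>y. compact_bop y \<and> norm (a - y) \<le> sqrt (norm a * (1 / real (Suc n)))" for n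
    by (rule approx) simp
  then obtain Y where Y: "\<And>n. compact_bop (Y n)" "\<And>n. norm (a - Y n) \<le> sqrt (norm a * (1 / real (Suc n)))"
    by metis
  have "(\<lambda>n. sqrt (norm a * (1 / real (Suc n)))) \<longlonglongrightarrow> sqrt (norm a * 0)"
    using LIMSEQ_inverse_real_of_nat
    by (intro tendsto_real_sqrt tendsto_mult tendsto_const) (simp add: inverse_eq_divide)
  then have lim0: "(\<lambda>n. sqrt (norm a * (1 / real (Suc n)))) \<longlonglongrightarrow> 0"
    by simp
  have "(\<lambda>n. norm (a - Y n)) \<longlonglongrightarrow> 0"
    by (rule tendsto_sandwich[where f = "\<lambda>_. 0", OF _ _ tendsto_const lim0])
       (intro always_eventually allI norm_ge_zero Y(2))+
  then have "Y \<longlonglongrightarrow> a"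
    by (subst (asm) norm_minus_commute) (simp add: tendsto_norm_zero_iff LIM_zero_cancel)
  with Y(1) have "compact_bop a"
    by (rule compact_bop_limit)
  then show ?thesis
    by (rule compact_bop_dominated[where C = 1]) (auto simp: a_def norm_abs_bop_apply)
qed

lemma singular_values_abs_bop: "singular_values (abs_bop x) = singular_values x"
  unfolding singular_values_def by (simp add: abs_bop_positive positive_abs_bop)

lemma dunford_schwartz_linear: "dunford_schwartz T \<Longrightarrow> linear T"
  by (auto simp: dunford_schwartz_def clinear_iff linear_iff scaleR_scaleC)

context
  assumes inf: "infinite_dimensional TYPE('a::complex_hilbert)"
begin

text \<open>For \<open>a = |x|\<close> the operator \<open>a - \<Sum>\<^bsub>m<k\<^esub> s\<^sub>m \<langle>\<cdot>, e\<^sub>m\<rangle> e\<^sub>m\<close> is positive, so the diagonal of \<open>a\<close>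
  dominates that of the sum.\<close>

lemma trace_norm_le_imp_kyfan:
  fixes x :: "'a bop"
  assumes le: "trace_norm x \<le> ennreal C" and "0 \<le> C"
  shows "kyfan_le k x C"
proof -
  have x: "compact_bop x"
    using assms by (rule trace_class_compact)
  define a where "a = abs_bop x"
  define s where "s = singular_values x"
  have pos: "positive_bop a"
    by (simp add: a_def positive_abs_bop)
  obtain e f where svd: "svd x s e f" and eig: "\<And>n. bop_apply a (e n) = s n *\<^sub>R e n"
    using compact_svd[OF inf x] unfolding a_def s_def by blast
  have on: "orthonormal_on {..<k} e"
    using svd_facts(1)[OF svd] orthonormal_on_subset by blast
  have "(\<Sum>m<k. s m) \<le> C"
  proof (rule basis_sum_dominates)
    fix b
    define w where "w = orth_rest {..<k} e b"
    have w: "cinner w (e i) = 0" if "i < k" for i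
      unfolding w_def using orth_rest_orth[OF _ on] that by simp
    have b: "b = w + (\<Sum>m<k. cinner b (e m) *\<^sub>C e m)"
      by (simp add: w_def orth_rest_def)
    have ab: "bop_apply a b = bop_apply a w + (\<Sum>m<k. (of_real (s m) * cinner b (e m)) *\<^sub>C e m)"
      by (subst b) (simp add: bop_apply_linear eig scaleR_scaleC scaleC_scaleC mult.commute)
    have "cinner (bop_apply a w) b = cinner (bop_apply a w) w"
      by (subst b) (simp add: cinner_linear cinner_sum_right positive_bop_selfadjoint[OF pos] eig w)
    moreover have "cinner (\<Sum>m<k. (of_real (s m) * cinner b (e m)) *\<^sub>C e m) b
        = of_real (\<Sum>m<k. s m * (cmod (cinner b (e m)))\<^sup>2)"
      unfolding cinner_sum_left of_real_sum
    proof (rule sum.cong[OF refl])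
      fix m
      have "cinner (e m) b = cnj (cinner b (e m))"
        by (rule cinner_commute)
      then show "cinner ((of_real (s m) * cinner b (e m)) *\<^sub>C e m) b
          = of_real (s m * (cmod (cinner b (e m)))\<^sup>2)"
        by (simp only: cinner_linear of_real_mult complex_norm_square mult.assoc)
    qed
    ultimately have "cinner (bop_apply a b) b
        = cinner (bop_apply a w) w + of_real (\<Sum>m<k. s m * (cmod (cinner b (e m)))\<^sup>2)"
      by (subst ab) (simp only: cinner_add_left)
    then show "(\<Sum>m<k. s m * (cmod (cinner b (e m)))\<^sup>2) \<le> Re (cinner (bop_apply a b) b)"
      using pos by (simp add: positive_bop_def)
  next
    show "(\<Sum>b\<in>F. Re (cinner (bop_apply a b) b)) \<le> C" if "finite F" "F \<subseteq> onb" for F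
      using le that unfolding trace_norm_le_iff[OF \<open>0 \<le> C\<close>] a_def by blast
  qed (use svd_facts[OF svd] in auto)
  then show ?thesis
    using kyfan_le_iff[OF inf x] by (simp add: s_def)
qed

text \<open>A finite part of the basis is itself an admissible family in the definition of the Ky Fan norm of
  \<open>|x|\<close>.\<close>

lemma trace_norm_leI:
  fixes x :: "'a bop"
  assumes x: "compact_bop x" and le: "\<And>k. kyfan_le k x C" and "0 \<le> C"
  shows "trace_norm x \<le> ennreal C"
  unfolding trace_norm_le_iff[OF \<open>0 \<le> C\<close>]
proof (intro allI impI, elim conjE)
  fix F :: "'a set" assume F: "finite F" "F \<subseteq> onb"
  define a where "a = abs_bop x"
  have "kyfan_le k a C" for k
    using le[of k] kyfan_le_iff[OF inf x] kyfan_le_iff[OF inf compact_abs_bop[OF x]]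
    by (simp add: a_def singular_values_abs_bop)
  obtain h where h: "bij_betw h {..<card F} F"
    using ex_bij_betw_nat_finite[OF F(1)] by (auto simp: lessThan_atLeast0)
  have "orthonormal_on {..<card F} h"
    using orthonormal_on_onb[OF F(2)] h bij_betw_apply[OF h] bij_betw_imp_inj_on[OF h]
    unfolding orthonormal_on_def by (simp add: inj_on_eq_iff)
  then have sub: "suborthonormal_on {..<card F} h"
    by (rule orthonormal_imp_suborthonormal)
  have "(\<Sum>b\<in>F. Re (cinner (bop_apply a b) b)) = (\<Sum>i<card F. Re (cinner (bop_apply a (h i)) (h i)))"
    using h by (rule sum.reindex_bij_betw[symmetric])
  also have "\<dots> \<le> (\<Sum>i<card F. cmod (cinner (bop_apply a (h i)) (h i)))"
    by (intro sum_mono complex_Re_le_cmod)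
  also have "\<dots> \<le> C"
    using \<open>kyfan_le (card F) a C\<close> sub sub by (rule kyfan_leD)
  finally show "(\<Sum>b\<in>F. Re (cinner (bop_apply (abs_bop x) b) b)) \<le> C"
    by (simp add: a_def)
qed

lemma trace_norm_rank_one_le:
  fixes e f :: 'a
  assumes "norm e \<le> 1" "norm f \<le> 1"
  shows "trace_norm (rank_one f e) \<le> ennreal 1"
  by (intro trace_norm_leI compact_rank_one kyfan_le_rank_one assms) simp

subsection \<open>Dunford-Schwartz operators and singular values\<close>

lemma dunford_schwartz_rank_one:
  fixes T :: "'a bop \<Rightarrow> 'a bop"
  assumes T: "dunford_schwartz T" and "norm e \<le> 1" "norm f \<le> 1"
  shows "trace_norm (T (rank_one f e)) \<le> ennreal 1"
proof -
  have le: "trace_norm (rank_one f e) \<le> ennreal 1"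
    using assms(2,3) by (rule trace_norm_rank_one_le)
  then have "rank_one f e \<in> trace_class"
    unfolding trace_class_def by (auto intro: le_less_trans)
  then show ?thesis
    using T le unfolding dunford_schwartz_def by (meson order_trans)
qed

text \<open>The images of the finite rank truncations are sums of trace class operators, hence compact, and
  they converge in norm.\<close>

lemma dunford_schwartz_compact:
  fixes T :: "'a bop \<Rightarrow> 'a bop"
  assumes T: "dunford_schwartz T" and x: "compact_bop x"
  shows "compact_bop (T x)"
proof -
  obtain e f where svd: "svd x (singular_values x) e f"
    using compact_svd[OF inf x] by blast
  have lin: "linear T"
    using T by (rule dunford_schwartz_linear)
  have "bounded_linear T"
    using T lin by (intro bounded_linear_intro[of T 1])
      (auto simp: dunford_schwartz_def linear_add linear_scale)
  then have "(\<lambda>N. T (svd_head (singular_values x) e f N)) \<longlonglongrightarrow> T x"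
    using svd_head_tendsto[OF svd] by (rule bounded_linear.tendsto)
  moreover have "compact_bop (T (svd_head (singular_values x) e f N))" for N
    unfolding svd_head_def linear_sum[OF lin] linear_scale[OF lin]
    by (intro compact_bop_sum compact_bop_scaleR trace_class_compact[where C = 1]
        dunford_schwartz_rank_one[OF T] eq_refl[OF svd_facts(8)[OF svd]] svd_facts(9)[OF svd]) simp
  ultimately show ?thesis
    by (rule compact_bop_limit[rotated])
qed

text \<open>A Dunford-Schwartz operator decreases singular values in the sense of submajorization, since
  Ky Fan sums interpolate between the trace norm and the operator norm.\<close>

theorem dunford_schwartz_singular_values:
  fixes T :: "'a bop \<Rightarrow> 'a bop"
  assumes T: "dunford_schwartz T" and x: "compact_bop x"
  shows "(\<Sum>i<k. singular_values (T x) i) \<le> (\<Sum>i<k. singular_values x i)"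
proof -
  obtain e f where svd: "svd x (singular_values x) e f"
    using compact_svd[OF inf x] by blast
  have "kyfan_le k (T (rank_one (f n) (e n))) 1" for n
    by (intro trace_norm_le_imp_kyfan dunford_schwartz_rank_one[OF T]
        eq_refl[OF svd_facts(8)[OF svd]] svd_facts(9)[OF svd]) simp
  then have "kyfan_le k (T (x - svd_head (singular_values x) e f 0)) (\<Sum>i<k. singular_values x (0 + i))"
    using T by (intro kyfan_le_transfer[OF svd] dunford_schwartz_linear) (auto simp: dunford_schwartz_def)
  then show ?thesis
    using kyfan_le_iff[OF inf dunford_schwartz_compact[OF T x]] by (simp add: svd_head_def)
qed

end

subsection \<open>The Hilbert-Schmidt norm\<close>

lemma sum_by_parts_nonneg:
  fixes w d :: "nat \<Rightarrow> real"
  assumes w: "decseq w" "\<And>n. 0 \<le> w n" and d: "\<And>m. 0 \<le> (\<Sum>i<m. d i)"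
  shows "0 \<le> (\<Sum>i<k. w i * d i)"
proof -
  have "(\<Sum>i<k. w i * d i) = w k * (\<Sum>i<k. d i) + (\<Sum>i<k. (w i - w (Suc i)) * (\<Sum>j<Suc i. d j))"
    by (induction k) (auto simp: algebra_simps)
  also have "0 \<le> \<dots>"
    using w(1) by (intro add_nonneg_nonneg mult_nonneg_nonneg sum_nonneg w(2) d) (simp add: decseq_Suc_iff)
  finally show ?thesis .
qed

text \<open>Submajorization is inherited by squares: \<open>\<Sum> s\<^sub>i\<^sup>2 \<le> \<Sum> s\<^sub>i t\<^sub>i \<le> \<Sum> t\<^sub>i\<^sup>2\<close>, both by
  summation by parts.\<close>

lemma submajorized_sum_squares_le:
  fixes s t :: "nat \<Rightarrow> real"
  assumes s: "decseq s" "\<And>n. 0 \<le> s n" and t: "decseq t" "\<And>n. 0 \<le> t n"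
    and le: "\<And>m. (\<Sum>i<m. s i) \<le> (\<Sum>i<m. t i)"
  shows "(\<Sum>i<k. (s i)\<^sup>2) \<le> (\<Sum>i<k. (t i)\<^sup>2)"
proof -
  have d: "0 \<le> (\<Sum>i<m. t i - s i)" for m
    using le[of m] by (simp add: sum_subtractf)
  have "0 \<le> (\<Sum>i<k. s i * (t i - s i)) + (\<Sum>i<k. t i * (t i - s i))"
    using sum_by_parts_nonneg[OF s d] sum_by_parts_nonneg[OF t d] by (intro add_nonneg_nonneg)
  also have "\<dots> = (\<Sum>i<k. (t i)\<^sup>2) - (\<Sum>i<k. (s i)\<^sup>2)"
    by (simp add: power2_eq_square algebra_simps flip: sum.distrib sum_subtractf)
  finally show ?thesis by simp
qed

definition hs_sq :: "'a::complex_hilbert bop \<Rightarrow> ennreal"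
  where "hs_sq x = (\<Sum>\<^sub>\<infinity>b\<in>onb. ennreal ((norm (bop_apply x b))\<^sup>2))"

definition hs_norm :: "'a::complex_hilbert bop \<Rightarrow> real"
  where "hs_norm x = sqrt (enn2real (hs_sq x))"

definition hilbert_schmidt :: "'a::complex_hilbert bop set"
  where "hilbert_schmidt = {x. compact_bop x \<and> hs_sq x < \<infinity>}"

lemma hs_sq_le_iff:
  assumes "0 \<le> C"
  shows "hs_sq x \<le> ennreal C \<longleftrightarrow>
    (\<forall>F. finite F \<and> F \<subseteq> onb \<longrightarrow> (\<Sum>b\<in>F. (norm (bop_apply x b))\<^sup>2) \<le> C)"
  unfolding hs_sq_def using assms by (intro infsum_ennreal_le_iff) auto

lemma hs_norm_nonneg: "0 \<le> hs_norm x"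
  by (simp add: hs_norm_def)

lemma hs_sq_eq: "x \<in> hilbert_schmidt \<Longrightarrow> hs_sq x = ennreal ((hs_norm x)\<^sup>2)"
  by (auto simp: hilbert_schmidt_def hs_norm_def)

lemma hs_norm_leI: "hs_sq x \<le> ennreal (C\<^sup>2) \<Longrightarrow> 0 \<le> C \<Longrightarrow> hs_norm x \<le> C"
  unfolding hs_norm_def by (rule real_le_lsqrt) (auto simp: enn2real_leI)

lemma hs_sq_parallelogram: "hs_sq (x + y) + hs_sq (x - y) = 2 * hs_sq x + 2 * hs_sq y"
proof -
  have "hs_sq (x + y) + hs_sq (x - y)
    = (\<Sum>\<^sub>\<infinity>b\<in>onb. ennreal ((norm (bop_apply (x + y) b))\<^sup>2) + ennreal ((norm (bop_apply (x - y) b))\<^sup>2))"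
    unfolding hs_sq_def by (rule infsum_add[symmetric]) (auto intro: nonneg_summable_on_complete)
  also have "\<dots> = (\<Sum>\<^sub>\<infinity>b\<in>onb. (ennreal ((norm (bop_apply x b))\<^sup>2) + ennreal ((norm (bop_apply x b))\<^sup>2))
      + (ennreal ((norm (bop_apply y b))\<^sup>2) + ennreal ((norm (bop_apply y b))\<^sup>2)))"
    using parallelogram by (intro infsum_cong) (simp add: bop_ops flip: ennreal_plus)
  also have "\<dots> = (hs_sq x + hs_sq x) + (hs_sq y + hs_sq y)"
    unfolding hs_sq_def by (simp add: infsum_add nonneg_summable_on_complete)
  finally show ?thesis
    by (simp add: mult_2)
qed

lemma hs_sq_scaleR: "hs_sq (r *\<^sub>R x) = ennreal (r\<^sup>2) * hs_sq x"
proof (cases "r = 0")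
  case True
  then show ?thesis by (simp add: hs_sq_def bop_ops)
next
  case False
  have le: "hs_sq (t *\<^sub>R z) \<le> ennreal (t\<^sup>2) * hs_sq z" for t and z :: "'a bop"
  proof -
    have "(\<Sum>b\<in>F. ennreal ((norm (bop_apply (t *\<^sub>R z) b))\<^sup>2)) \<le> ennreal (t\<^sup>2) * hs_sq z"
      if F: "finite F" "F \<subseteq> onb" for F
    proof -
      have "(\<Sum>b\<in>F. ennreal ((norm (bop_apply (t *\<^sub>R z) b))\<^sup>2))
        = ennreal (t\<^sup>2) * (\<Sum>b\<in>F. ennreal ((norm (bop_apply z b))\<^sup>2))"
        unfolding sum_distrib_left
        by (intro sum.cong refl) (simp add: bop_ops power_mult_distrib ennreal_mult)
      also have "(\<Sum>b\<in>F. ennreal ((norm (bop_apply z b))\<^sup>2)) \<le> hs_sq z"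
        unfolding hs_sq_def using F
        by (subst nonneg_infsum_complete) (auto intro!: SUP_upper)
      finally show ?thesis by (simp add: mult_left_mono)
    qed
    then show ?thesis
      unfolding hs_sq_def[of "t *\<^sub>R z"]
      by (subst nonneg_infsum_complete) (auto simp: SUP_le_iff)
  qed
  have "ennreal (r\<^sup>2) * hs_sq x = ennreal (r\<^sup>2) * hs_sq ((1/r) *\<^sub>R r *\<^sub>R x)"
    using False by simp
  also have "\<dots> \<le> ennreal (r\<^sup>2) * (ennreal ((1/r)\<^sup>2) * hs_sq (r *\<^sub>R x))"
    by (intro mult_left_mono le) auto
  also have "\<dots> = hs_sq (r *\<^sub>R x)"
    using False by (simp add: power_divide flip: mult.assoc ennreal_mult)
  finally show ?thesis
    using le[of r x] by (simp add: order_antisym)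
qed

lemma hilbert_schmidt_add:
  fixes x y :: "'a::complex_hilbert bop"
  assumes "x \<in> hilbert_schmidt" "y \<in> hilbert_schmidt"
  shows "x + y \<in> hilbert_schmidt"
proof -
  have "hs_sq (x + y) \<le> 2 * hs_sq x + 2 * hs_sq y"
    unfolding hs_sq_parallelogram[symmetric] by simp
  also have "\<dots> < \<infinity>"
    using assms by (simp add: hilbert_schmidt_def ennreal_mult_less_top)
  finally show ?thesis
    using assms by (simp add: hilbert_schmidt_def compact_bop_add)
qed

lemma hilbert_schmidt_scaleR:
  fixes x y :: "'a::complex_hilbert bop"
  assumes "x \<in> hilbert_schmidt"
  shows "r *\<^sub>R x \<in> hilbert_schmidt"
  using assms by (simp add: hilbert_schmidt_def compact_bop_scaleR hs_sq_scaleR ennreal_mult_less_top)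

lemma hilbert_schmidt_diff:
  fixes x y :: "'a::complex_hilbert bop"
  assumes "x \<in> hilbert_schmidt" "y \<in> hilbert_schmidt"
  shows "x - y \<in> hilbert_schmidt"
  using hilbert_schmidt_add[OF assms(1) hilbert_schmidt_scaleR[OF assms(2), of "-1"]] by simp

lemma hs_norm_scaleR:
  shows "hs_norm (r *\<^sub>R x) = \<bar>r\<bar> * hs_norm x"
  by (simp add: hs_norm_def hs_sq_scaleR enn2real_mult real_sqrt_mult)

lemma hs_norm_parallelogram:
  fixes x y :: "'a::complex_hilbert bop"
  assumes "x \<in> hilbert_schmidt" "y \<in> hilbert_schmidt"
  shows "(hs_norm (x + y))\<^sup>2 + (hs_norm (x - y))\<^sup>2 = 2 * (hs_norm x)\<^sup>2 + 2 * (hs_norm y)\<^sup>2"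
proof -
  have "ennreal ((hs_norm (x + y))\<^sup>2 + (hs_norm (x - y))\<^sup>2) = hs_sq (x + y) + hs_sq (x - y)"
    using assms by (simp add: hs_sq_eq hilbert_schmidt_add hilbert_schmidt_diff)
  also have "\<dots> = 2 * hs_sq x + 2 * hs_sq y"
    by (rule hs_sq_parallelogram)
  also have "\<dots> = ennreal (2 * (hs_norm x)\<^sup>2 + 2 * (hs_norm y)\<^sup>2)"
    using assms by (simp add: hs_sq_eq ennreal_mult ennreal_plus)
  finally show ?thesis
    by (subst (asm) ennreal_inj) auto
qed

text \<open>Minkowski's inequality on finite parts of the basis.\<close>

lemma hs_norm_add_le:
  fixes x y :: "'a::complex_hilbert bop"
  assumes x: "x \<in> hilbert_schmidt" and y: "y \<in> hilbert_schmidt"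
  shows "hs_norm (x + y) \<le> hs_norm x + hs_norm y"
proof (rule hs_norm_leI)
  have L2: "L2_set (\<lambda>b. norm (bop_apply z b)) F \<le> hs_norm z"
    if z: "z \<in> hilbert_schmidt" and F: "finite F" "F \<subseteq> onb" for z :: "'a bop" and F
  proof -
    have "(\<Sum>b\<in>F. (norm (bop_apply z b))\<^sup>2) \<le> (hs_norm z)\<^sup>2"
      using hs_sq_le_iff[of "(hs_norm z)\<^sup>2" z] F eq_refl[OF hs_sq_eq[OF z]] by simp
    then show ?thesis
      unfolding L2_set_def using hs_norm_nonneg by (intro real_le_lsqrt) auto
  qed
  have "(\<Sum>b\<in>F. (norm (bop_apply (x + y) b))\<^sup>2) \<le> (hs_norm x + hs_norm y)\<^sup>2"
    if F: "finite F" "F \<subseteq> onb" for F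
  proof -
    have "L2_set (\<lambda>b. norm (bop_apply (x + y) b)) F
        \<le> L2_set (\<lambda>b. norm (bop_apply x b) + norm (bop_apply y b)) F"
      by (intro L2_set_mono) (auto simp: bop_ops norm_triangle_ineq)
    also have "\<dots> \<le> L2_set (\<lambda>b. norm (bop_apply x b)) F + L2_set (\<lambda>b. norm (bop_apply y b)) F"
      by (rule L2_set_triangle_ineq)
    also have "\<dots> \<le> hs_norm x + hs_norm y"
      by (intro add_mono L2 x y F)
    finally have "(L2_set (\<lambda>b. norm (bop_apply (x + y) b)) F)\<^sup>2 \<le> (hs_norm x + hs_norm y)\<^sup>2"
      by (intro power_mono L2_set_nonneg)
    then show ?thesis
      by (simp add: L2_set_def sum_nonneg)
  qed
  then show "hs_sq (x + y) \<le> ennreal ((hs_norm x + hs_norm y)\<^sup>2)"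
    by (subst hs_sq_le_iff) auto
qed (intro add_nonneg_nonneg hs_norm_nonneg)

context
  assumes inf: "infinite_dimensional TYPE('a::complex_hilbert)"
begin

text \<open>The two halves of the identity between the square of the Hilbert-Schmidt norm and the sum of
  the squares of the singular values: Bessel's inequality gives the first, Parseval's identity the
  second.\<close>

lemma hs_sq_leI:
  fixes x :: "'a bop"
  assumes x: "compact_bop x" and le: "\<And>k. (\<Sum>i<k. (singular_values x i)\<^sup>2) \<le> C" and "0 \<le> C"
  shows "hs_sq x \<le> ennreal C"
  unfolding hs_sq_le_iff[OF \<open>0 \<le> C\<close>]
proof (intro allI impI; elim conjE)
  fix F :: "'a set" assume F: "finite F" "F \<subseteq> onb"
  define s where "s = singular_values x"
  obtain e f where svd: "svd x s e f"
    using compact_svd[OF inf x] unfolding s_def by blast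
  note sf = svd_facts[OF svd]
  have on: "suborthonormal_on F (\<lambda>b. b)"
    using orthonormal_on_onb[OF F(2)] by (rule orthonormal_imp_suborthonormal)
  have "(\<Sum>b\<in>F. (norm (bop_apply (svd_head s e f N) b))\<^sup>2) \<le> C" for N
  proof -
    have "(\<Sum>b\<in>F. (norm (bop_apply (svd_head s e f N) b))\<^sup>2)
      \<le> (\<Sum>b\<in>F. \<Sum>n<N. (s n)\<^sup>2 * (cmod (cinner (e n) b))\<^sup>2)"
    proof (rule sum_mono)
      fix b
      have "bop_apply (svd_head s e f N) b = (\<Sum>n<N. (of_real (s n) * cinner b (e n)) *\<^sub>C f n)"
        by (simp add: svd_head_def bop_sum bop_ops rank_one.rep_eq scaleR_scaleC scaleC_scaleC)
      also have "(norm \<dots>)\<^sup>2 \<le> (\<Sum>n<N. (cmod (of_real (s n) * cinner b (e n)))\<^sup>2)"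
        using sf(2) suborthonormal_on_subset by (intro norm_sum_suborthonormal_le) auto
      also have "\<dots> = (\<Sum>n<N. (s n)\<^sup>2 * (cmod (cinner (e n) b))\<^sup>2)"
        by (simp add: norm_mult power_mult_distrib cmod_cinner_commute[of b])
      finally show "(norm (bop_apply (svd_head s e f N) b))\<^sup>2
          \<le> (\<Sum>n<N. (s n)\<^sup>2 * (cmod (cinner (e n) b))\<^sup>2)" .
    qed
    also have "\<dots> = (\<Sum>n<N. (s n)\<^sup>2 * (\<Sum>b\<in>F. (cmod (cinner (e n) b))\<^sup>2))"
      unfolding sum_distrib_left by (rule sum.swap)
    also have "\<dots> \<le> (\<Sum>n<N. (s n)\<^sup>2 * 1)"
      using Bessel[OF F(1) on] sf(8) by (intro sum_mono mult_left_mono) (metis one_power2, simp)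
    also have "\<dots> \<le> C"
      using le[of N] by (simp add: s_def)
    finally show ?thesis .
  qed
  moreover have "(\<lambda>N. \<Sum>b\<in>F. (norm (bop_apply (svd_head s e f N) b))\<^sup>2)
      \<longlonglongrightarrow> (\<Sum>b\<in>F. (norm (bop_apply x b))\<^sup>2)"
    by (intro tendsto_intros tendsto_bop_apply svd_head_tendsto[OF svd])
  ultimately show "(\<Sum>b\<in>F. (norm (bop_apply x b))\<^sup>2) \<le> C"
    by (intro LIMSEQ_le_const2) auto
qed

lemma sum_singular_values_sq_le:
  fixes x :: "'a bop"
  assumes x: "compact_bop x" and le: "hs_sq x \<le> ennreal C" and "0 \<le> C"
  shows "(\<Sum>i<k. (singular_values x i)\<^sup>2) \<le> C"
proof -
  define s where "s = singular_values x"
  obtain e f where svd: "svd x s e f"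
    using compact_svd[OF inf x] unfolding s_def by blast
  note sf = svd_facts[OF svd]
  have on: "orthonormal_on {..<k} e"
    using sf(1) orthonormal_on_subset by blast
  have "(\<Sum>m<k. (s m)\<^sup>2) \<le> C"
  proof (rule basis_sum_dominates)
    fix b
    define w where "w = orth_rest {..<k} e b"
    have w: "cinner w (e i) = 0" if "i < k" for i
      unfolding w_def using orth_rest_orth[OF _ on] that by simp
    define p where "p = (\<Sum>m<k. (of_real (s m) * cinner b (e m)) *\<^sub>C f m)"
    have "b = w + (\<Sum>m<k. cinner b (e m) *\<^sub>C e m)"
      by (simp add: w_def orth_rest_def)
    then have "bop_apply x b = bop_apply x (w + (\<Sum>m<k. cinner b (e m) *\<^sub>C e m))"
      by simp
    then have xb: "bop_apply x b = bop_apply x w + p"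
      by (simp add: bop_apply_linear sf(6) p_def scaleR_scaleC scaleC_scaleC mult.commute)
    have "cinner (bop_apply x w) p = 0"
      unfolding p_def cinner_sum_right using sf(12)[OF w] by (simp add: cinner_linear)
    then have "(norm (bop_apply x b))\<^sup>2 = (norm (bop_apply x w))\<^sup>2 + (norm p)\<^sup>2"
      unfolding xb by (rule norm_add_sq_orth)
    moreover have "(norm p)\<^sup>2 = (\<Sum>m<k. (norm ((of_real (s m) * cinner b (e m)) *\<^sub>C f m))\<^sup>2)"
      unfolding p_def using sf(2)
      by (intro norm_sum_sq_orth) (auto simp: cinner_linear suborthonormal_on_def)
    moreover have "\<dots> = (\<Sum>m<k. (s m)\<^sup>2 * (cmod (cinner b (e m)))\<^sup>2)"
    proof (intro sum.cong refl)
      fix m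
      show "(norm ((of_real (s m) * cinner b (e m)) *\<^sub>C f m))\<^sup>2 = (s m)\<^sup>2 * (cmod (cinner b (e m)))\<^sup>2"
        using sf(4)[of m] sf(7)[of m]
        by (cases "s m = 0") (auto simp: norm_scaleC norm_mult power_mult_distrib)
    qed
    ultimately show "(\<Sum>m<k. (s m)\<^sup>2 * (cmod (cinner b (e m)))\<^sup>2) \<le> (norm (bop_apply x b))\<^sup>2"
      by simp
  next
    show "(\<Sum>b\<in>F. (norm (bop_apply x b))\<^sup>2) \<le> C" if "finite F" "F \<subseteq> onb" for F
      using le that hs_sq_le_iff[OF \<open>0 \<le> C\<close>, of x] by blast
  qed (use sf in auto)
  then show ?thesis by (simp add: s_def)
qed

lemma hs_norm_square:
  fixes x :: "'a bop"
  assumes "x \<in> hilbert_schmidt"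
  shows "(\<Sum>i<k. (singular_values x i)\<^sup>2) \<le> (hs_norm x)\<^sup>2"
proof (rule sum_singular_values_sq_le)
  show "compact_bop x"
    using assms by (simp add: hilbert_schmidt_def)
  show "hs_sq x \<le> ennreal ((hs_norm x)\<^sup>2)"
    by (rule eq_refl[OF hs_sq_eq[OF assms]])
qed simp

lemma norm_le_hs_norm:
  fixes x :: "'a bop"
  assumes "x \<in> hilbert_schmidt"
  shows "norm x \<le> hs_norm x"
proof (rule power2_le_imp_le[OF _ hs_norm_nonneg])
  have "compact_bop x" using assms by (simp add: hilbert_schmidt_def)
  then show "(norm x)\<^sup>2 \<le> (hs_norm x)\<^sup>2"
    using hs_norm_square[OF assms, of 1] singular_values_0[OF inf] by simp
qed

lemma dunford_schwartz_hs:
  fixes T :: "'a bop \<Rightarrow> 'a bop"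
  assumes T: "dunford_schwartz T" and x: "x \<in> hilbert_schmidt"
  shows "T x \<in> hilbert_schmidt" "hs_norm (T x) \<le> hs_norm x"
proof -
  have c: "compact_bop x" using x by (simp add: hilbert_schmidt_def)
  note cT = dunford_schwartz_compact[OF inf T c]
  have "(\<Sum>i<k. (singular_values (T x) i)\<^sup>2) \<le> (hs_norm x)\<^sup>2" for k
  proof -
    have "(\<Sum>i<k. (singular_values (T x) i)\<^sup>2) \<le> (\<Sum>i<k. (singular_values x i)\<^sup>2)"
      using singular_values_props[OF inf c] singular_values_props[OF inf cT]
      by (intro submajorized_sum_squares_le dunford_schwartz_singular_values[OF inf T c]) auto
    also have "\<dots> \<le> (hs_norm x)\<^sup>2"
      using x by (rule hs_norm_square)
    finally show ?thesis .
  qed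
  then have le: "hs_sq (T x) \<le> ennreal ((hs_norm x)\<^sup>2)"
    by (intro hs_sq_leI cT) auto
  then show "hs_norm (T x) \<le> hs_norm x"
    by (rule hs_norm_leI) (rule hs_norm_nonneg)
  show "T x \<in> hilbert_schmidt"
    using le cT by (auto simp: hilbert_schmidt_def intro: le_less_trans)
qed

text \<open>The singular values are at most 1 and so are their sums.\<close>

lemma rank_one_hilbert_schmidt:
  fixes e f :: 'a
  assumes "norm e \<le> 1" "norm f \<le> 1"
  shows "rank_one f e \<in> hilbert_schmidt"
proof -
  have "(\<Sum>i<k. (singular_values (rank_one f e) i)\<^sup>2) \<le> 1" for k
  proof -
    note sv = singular_values_props[OF inf compact_rank_one[of f e]]
    have le1: "(\<Sum>i<k. singular_values (rank_one f e) i) \<le> 1" for k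
      using kyfan_le_rank_one[OF assms, of k] by (simp add: kyfan_le_iff[OF inf compact_rank_one])
    have "singular_values (rank_one f e) i \<le> 1" for i
      using le1[of 1] sv(1) by (auto simp: decseq_def intro: order_trans)
    then have "(\<Sum>i<k. (singular_values (rank_one f e) i)\<^sup>2) \<le> (\<Sum>i<k. singular_values (rank_one f e) i)"
      using sv(2) by (intro sum_mono) (simp add: power2_eq_square mult_left_le)
    then show ?thesis using le1 by (rule order_trans)
  qed
  then have "hs_sq (rank_one f e) \<le> ennreal 1"
    by (intro hs_sq_leI compact_rank_one) auto
  then show ?thesis
    by (auto simp: hilbert_schmidt_def compact_rank_one intro: le_less_trans)
qed

end

section \<open>Fully symmetric sequence spaces\<close>

subsection \<open>Non-increasing rearrangements\<close>

lemma linf_bdd_above: "\<xi> \<in> linf \<Longrightarrow> bdd_above ((\<lambda>m. norm (\<xi> m)) ` S)"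
  unfolding linf_def bounded_iff by (auto intro: bdd_aboveI)

lemma rearrangement_bdd_below:
  "\<xi> \<in> linf \<Longrightarrow> bdd_below ((\<lambda>F. SUP m\<in>- F. norm (\<xi> m)) ` {F. finite F \<and> card F \<le> n})"
proof (rule bdd_belowI2[where m = 0])
  fix F :: "nat set" assume \<xi>: "\<xi> \<in> linf" and "F \<in> {F. finite F \<and> card F \<le> n}"
  then obtain m where "m \<in> - F"
    using ex_new_if_finite[OF infinite_UNIV_nat, of F] by auto
  then show "0 \<le> (SUP m\<in>- F. norm (\<xi> m))"
    using linf_bdd_above[OF \<xi>] by (intro cSUP_upper2[where x = m]) auto
qed

lemma rearrangement_leI:
  assumes \<xi>: "\<xi> \<in> linf" and F: "finite F" "card F \<le> n" "\<And>m. m \<notin> F \<Longrightarrow> norm (\<xi> m) \<le> c"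
  shows "rearrangement \<xi> n \<le> c"
proof -
  have ne: "- F \<noteq> {}"
    using ex_new_if_finite[OF infinite_UNIV_nat F(1)] by auto
  have "rearrangement \<xi> n \<le> (SUP m\<in>- F. norm (\<xi> m))"
    unfolding rearrangement_def using F by (intro cINF_lower rearrangement_bdd_below \<xi>) auto
  also have "\<dots> \<le> c"
    using ne F by (intro cSUP_least) auto
  finally show ?thesis .
qed

lemma rearrangement_ge_Sup:
  assumes "\<And>F. finite F \<Longrightarrow> card F \<le> n \<Longrightarrow> c \<le> (SUP m\<in>- F. norm (\<xi> m))"
  shows "c \<le> rearrangement \<xi> n"
  unfolding rearrangement_def using assms
  by (intro cINF_greatest) (auto intro!: exI[of _ "{}"])

lemma rearrangement_geI:
  assumes \<xi>: "\<xi> \<in> linf"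
    and c: "\<And>F. finite F \<Longrightarrow> card F \<le> n \<Longrightarrow> \<exists>m. m \<notin> F \<and> c \<le> norm (\<xi> m)"
  shows "c \<le> rearrangement \<xi> n"
proof (rule rearrangement_ge_Sup)
  fix F :: "nat set" assume "finite F" "card F \<le> n"
  then obtain m where "m \<notin> F" "c \<le> norm (\<xi> m)"
    using c by blast
  then show "c \<le> (SUP m\<in>- F. norm (\<xi> m))"
    using linf_bdd_above[OF \<xi>] by (intro cSUP_upper2[where x = m]) auto
qed

lemma rearrangement_nonneg: "\<xi> \<in> linf \<Longrightarrow> 0 \<le> rearrangement \<xi> n"
  using ex_new_if_finite[OF infinite_UNIV_nat] by (intro rearrangement_geI) auto

lemma rearrangement_decseq: "\<xi> \<in> linf \<Longrightarrow> decseq (rearrangement \<xi>)"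
  unfolding decseq_def rearrangement_def
  by (intro allI impI cINF_superset_mono rearrangement_bdd_below) (auto intro!: exI[of _ "{}"])

lemma rearrangement_mono:
  assumes "\<xi> \<in> linf" "\<eta> \<in> linf" "\<And>n. norm (\<xi> n) \<le> norm (\<eta> n)"
  shows "rearrangement \<xi> n \<le> rearrangement \<eta> n"
proof (rule rearrangement_ge_Sup)
  fix F :: "nat set" assume F: "finite F" "card F \<le> n"
  have "norm (\<xi> m) \<le> (SUP m\<in>- F. norm (\<eta> m))" if "m \<notin> F" for m
    using assms(3)[of m] that linf_bdd_above[OF assms(2)] by (intro cSUP_upper2[where x = m]) auto
  then show "rearrangement \<xi> n \<le> (SUP m\<in>- F. norm (\<eta> m))"
    using F assms(1) by (intro rearrangement_leI[of _ F]) auto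
qed

lemma decseq_linf:
  assumes "decseq s" "\<And>n. 0 \<le> s n"
  shows "(\<lambda>n. complex_of_real (s n)) \<in> linf"
  unfolding linf_def bounded_iff
  using assms by (auto simp: decseq_def intro!: exI[of _ "s 0"])

lemma finite_avoids: "finite F \<Longrightarrow> card F \<le> n \<Longrightarrow> \<exists>m\<in>{k..k+n}. m \<notin> F"
proof (rule ccontr)
  assume F: "finite F" "card F \<le> n" and "\<not> (\<exists>m\<in>{k..k+n}. m \<notin> F)"
  then have "card {k..k+n} \<le> card F"
    by (intro card_mono) auto
  then show False using F by simp
qed

lemma rearrangement_decreasing:
  assumes "decseq s" "\<And>n. 0 \<le> s n"
  shows "rearrangement (\<lambda>n. complex_of_real (s n)) = s"
proof
  fix n
  show "rearrangement (\<lambda>n. complex_of_real (s n)) n = s n"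
  proof (rule order_antisym)
    show "rearrangement (\<lambda>n. complex_of_real (s n)) n \<le> s n"
      using assms by (intro rearrangement_leI[of _ "{..<n}"] decseq_linf) (auto simp: decseq_def)
    show "s n \<le> rearrangement (\<lambda>n. complex_of_real (s n)) n"
    proof (rule rearrangement_geI[OF decseq_linf[OF assms]])
      fix F :: "nat set" assume "finite F" "card F \<le> n"
      from finite_avoids[OF this, of 0] obtain m where "m \<le> n" "m \<notin> F" by auto
      then show "\<exists>m. m \<notin> F \<and> s n \<le> norm (complex_of_real (s m))"
        using assms by (auto simp: decseq_def intro!: exI[of _ m])
    qed
  qed
qed

text \<open>The partial sums of the rearrangement are the suprema of sums over sets of given
  cardinality: the next two lemmas are the two inequalities.\<close>

lemma sum_le_sum_rearrangement:
  assumes \<xi>: "\<xi> \<in> linf" and "finite F"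
  shows "(\<Sum>m\<in>F. norm (\<xi> m)) \<le> (\<Sum>n<card F. rearrangement \<xi> n)"
  using \<open>finite F\<close>
proof (induction "card F" arbitrary: F)
  case (Suc k)
  then have "F \<noteq> {}" by auto
  define m where "m = (ARG_MIN (\<lambda>m. norm (\<xi> m)) m. m \<in> F)"
  have m: "m \<in> F" "\<And>j. j \<in> F \<Longrightarrow> norm (\<xi> m) \<le> norm (\<xi> j)"
    unfolding m_def using arg_min_if_finite[OF Suc(3) \<open>F \<noteq> {}\<close>, of "\<lambda>m. norm (\<xi> m)"]
    by (auto simp: arg_min_on_def not_less)
  have "norm (\<xi> m) \<le> rearrangement \<xi> k"
  proof (rule rearrangement_geI[OF \<xi>])
    fix G :: "nat set" assume "finite G" "card G \<le> k"
    then have "\<not> F \<subseteq> G"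
      using Suc(2) card_mono[of G F] by auto
    then show "\<exists>j. j \<notin> G \<and> norm (\<xi> m) \<le> norm (\<xi> j)"
      using m by blast
  qed
  moreover have "(\<Sum>m\<in>F - {m}. norm (\<xi> m)) \<le> (\<Sum>n<card (F - {m}). rearrangement \<xi> n)"
    using Suc m by (intro Suc(1)) auto
  moreover have "card (F - {m}) = k"
    using Suc m by simp
  ultimately show ?case
    using sum.remove[OF Suc(3) m(1), of "\<lambda>m. norm (\<xi> m)"] by (simp flip: Suc(2))
qed simp

lemma sum_rearrangement_leI:
  assumes \<xi>: "\<xi> \<in> linf" and C: "\<And>G. finite G \<Longrightarrow> card G = m \<Longrightarrow> (\<Sum>j\<in>G. norm (\<xi> j)) \<le> C"
  shows "(\<Sum>n<m. rearrangement \<xi> n) \<le> C"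
proof (rule field_le_epsilon)
  fix \<epsilon> :: real assume "0 < \<epsilon>"
  then have "\<exists>G. finite G \<and> card G = m \<and> (\<Sum>n<m. rearrangement \<xi> n) \<le> (\<Sum>j\<in>G. norm (\<xi> j)) + \<epsilon>"
  proof (induction m arbitrary: \<epsilon>)
    case 0
    then show ?case by (auto intro!: exI[of _ "{}"])
  next
    case (Suc m)
    obtain G where G: "finite G" "card G = m"
      "(\<Sum>n<m. rearrangement \<xi> n) \<le> (\<Sum>j\<in>G. norm (\<xi> j)) + \<epsilon> / 2"
      using Suc.IH[OF half_gt_zero[OF Suc.prems]] by blast
    have ne: "- G \<noteq> {}"
      using ex_new_if_finite[OF infinite_UNIV_nat G(1)] by auto
    define S where "S = (SUP m\<in>- G. norm (\<xi> m))"
    have "\<exists>j\<in>- G. S - \<epsilon>/2 < norm (\<xi> j)"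
      unfolding S_def using less_cSUP_iff[OF ne linf_bdd_above[OF \<xi>]] Suc(2) by (metis S_def diff_less_eq half_gt_zero less_add_same_cancel1)
    then obtain j where j: "j \<notin> G" "S - \<epsilon>/2 < norm (\<xi> j)" by auto
    have "rearrangement \<xi> m \<le> S"
      unfolding S_def using G linf_bdd_above[OF \<xi>] by (intro rearrangement_leI[OF \<xi> G(1)] cSUP_upper) auto
    then show ?case
      using G j by (intro exI[of _ "insert j G"]) auto
  qed
  then obtain G where "finite G" "card G = m" "(\<Sum>n<m. rearrangement \<xi> n) \<le> (\<Sum>j\<in>G. norm (\<xi> j)) + \<epsilon>"
    by blast
  then show "(\<Sum>n<m. rearrangement \<xi> n) \<le> C + \<epsilon>"
    using C[of G] by linarith
qed

subsection \<open>Norm estimates\<close>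

text \<open>Averages of a non-increasing sequence decrease, here without denominators.\<close>

lemma decseq_average:
  fixes r :: "nat \<Rightarrow> real"
  assumes "decseq r" "m \<le> k"
  shows "real m * (\<Sum>n<k. r n) \<le> real k * (\<Sum>n<m. r n)"
proof -
  have split: "(\<Sum>n<k. r n) = (\<Sum>n<m. r n) + (\<Sum>n=m..<k. r n)"
    using assms(2) by (metis lessThan_atLeast0 le0 sum.atLeastLessThan_concat)
  have "(\<Sum>n=m..<k. r n) \<le> (\<Sum>n=m..<k. r m)"
    using assms by (intro sum_mono) (auto simp: decseq_def)
  then have 1: "(\<Sum>n=m..<k. r n) \<le> real (k - m) * r m" by simp
  have "(\<Sum>n<m. r m) \<le> (\<Sum>n<m. r n)"
    using assms by (intro sum_mono) (auto simp: decseq_def)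
  then have 2: "real m * r m \<le> (\<Sum>n<m. r n)" by simp
  have "real m * (\<Sum>n<k. r n) \<le> real m * (\<Sum>n<m. r n) + real m * (real (k - m) * r m)"
    unfolding split distrib_left by (intro add_left_mono mult_left_mono 1) auto
  also have "\<dots> \<le> real m * (\<Sum>n<m. r n) + real (k - m) * (\<Sum>n<m. r n)"
    using mult_left_mono[OF 2, of "real (k - m)"] by (simp add: mult_ac)
  also have "\<dots> = real k * (\<Sum>n<m. r n)"
    using assms(2) by (simp add: of_nat_diff algebra_simps)
  finally show ?thesis .
qed

context fully_symmetric_space
begin

abbreviation embed :: "(nat \<Rightarrow> real) \<Rightarrow> nat \<Rightarrow> complex"
  where "embed s \<equiv> (\<lambda>n. complex_of_real (s n))"

definition block :: "nat \<Rightarrow> nat \<Rightarrow> real"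
  where "block k n = (if n < k then 1 else 0)"

text \<open>The fundamental function of the space.\<close>

definition \<phi> :: "nat \<Rightarrow> real"
  where "\<phi> k = norm_E (embed (block k))"

lemma block_facts: "decseq (block k)" "0 \<le> block k n"
  by (auto simp: block_def decseq_def)

lemma sum_block: "(\<Sum>n<m. block k n) = real (min m k)"
  by (induction m) (auto simp: block_def)

lemma linfD: "\<xi> \<in> E \<Longrightarrow> \<xi> \<in> linf"
  using subset_linf by blast

lemma dominated:
  assumes "decseq s" "\<And>n. 0 \<le> s n" "\<xi> \<in> E" "\<And>m. (\<Sum>n<m. s n) \<le> (\<Sum>n<m. rearrangement \<xi> n)"
  shows "embed s \<in> E" "norm_E (embed s) \<le> norm_E \<xi>"
  using assms fully_symmetric_mem[OF assms(3) decseq_linf[OF assms(1,2)]]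
    fully_symmetric_norm[OF assms(3) decseq_linf[OF assms(1,2)]]
  by (auto simp: submajorized_def rearrangement_decreasing)

lemma dominated_decreasing:
  assumes "decseq s" "\<And>n. 0 \<le> s n" "decseq t" "\<And>n. 0 \<le> t n" "embed t \<in> E"
    "\<And>m. (\<Sum>n<m. s n) \<le> (\<Sum>n<m. t n)"
  shows "embed s \<in> E" "norm_E (embed s) \<le> norm_E (embed t)"
  using dominated[OF assms(1,2,5)] assms by (simp_all add: rearrangement_decreasing)

lemma solid:
  assumes "\<eta> \<in> E" "\<And>n. norm (\<xi> n) \<le> norm (\<eta> n)"
  shows "\<xi> \<in> E" "norm_E \<xi> \<le> norm_E \<eta>"
proof -
  have \<eta>: "\<eta> \<in> linf" using assms(1) by (rule linfD)
  then have \<xi>: "\<xi> \<in> linf"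
    using assms(2) unfolding linf_def bounded_iff by (auto intro: order_trans)
  have "\<xi> \<prec>\<prec> \<eta>"
    unfolding submajorized_def by (intro allI sum_mono rearrangement_mono \<xi> \<eta> assms(2))
  then show "\<xi> \<in> E" "norm_E \<xi> \<le> norm_E \<eta>"
    using fully_symmetric_mem fully_symmetric_norm assms(1) \<xi> by blast+
qed

lemma diff_mem: "\<xi> \<in> E \<Longrightarrow> \<eta> \<in> E \<Longrightarrow> (\<lambda>n. \<xi> n - \<eta> n) \<in> E"
  using add_mem[OF _ scale_mem[of \<eta> "-1"]] by simp

lemma norm_diff_commute:
  assumes "\<xi> \<in> E" "\<eta> \<in> E"
  shows "norm_E (\<lambda>n. \<xi> n - \<eta> n) = norm_E (\<lambda>n. \<eta> n - \<xi> n)"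
  using norm_scale[OF diff_mem[OF assms], of "-1"] by simp

lemma sum_mem:
  assumes "\<And>j. j \<in> A \<Longrightarrow> X j \<in> E"
  shows "(\<lambda>n. \<Sum>j\<in>A. X j n) \<in> E \<and> norm_E (\<lambda>n. \<Sum>j\<in>A. X j n) \<le> (\<Sum>j\<in>A. norm_E (X j))"
  using assms
proof (induction A rule: infinite_finite_induct)
  case (insert j A)
  then show ?case
    using add_mem[of "X j" "\<lambda>n. \<Sum>j\<in>A. X j n"] norm_triangle[of "X j" "\<lambda>n. \<Sum>j\<in>A. X j n"] by auto
qed (use zero_mem norm_eq_0[OF zero_mem] in auto)

lemma rearrangement_mem:
  assumes "\<xi> \<in> E"
  shows "embed (rearrangement \<xi>) \<in> E"
  using linfD[OF assms] by (intro dominated(1)[OF _ _ assms] rearrangement_decseq rearrangement_nonneg) auto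

lemma scaled_unit_le:
  assumes "\<xi> \<in> E"
  shows "embed (\<lambda>n. norm (\<xi> j) * block 1 n) \<in> E"
    "norm_E (embed (\<lambda>n. norm (\<xi> j) * block 1 n)) \<le> norm_E \<xi>"
proof -
  have le: "(\<Sum>n<m. norm (\<xi> j) * block 1 n) \<le> (\<Sum>n<m. rearrangement \<xi> n)" for m
  proof (cases "m = 0")
    case False
    have "(\<Sum>n<m. norm (\<xi> j) * block 1 n) = norm (\<xi> j)"
      using False by (simp flip: sum_distrib_left add: sum_block)
    also have "\<dots> \<le> rearrangement \<xi> 0"
      using sum_le_sum_rearrangement[OF linfD[OF assms], of "{j}"] by simp
    also have "\<dots> \<le> (\<Sum>n<m. rearrangement \<xi> n)"
      using False rearrangement_nonneg[OF linfD[OF assms]] by (intro member_le_sum) auto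
    finally show ?thesis .
  qed simp
  have dec: "decseq (\<lambda>n. norm (\<xi> j) * block 1 n)" "\<And>n. 0 \<le> norm (\<xi> j) * block 1 n"
    by (auto simp: block_def decseq_def)
  show "embed (\<lambda>n. norm (\<xi> j) * block 1 n) \<in> E"
    "norm_E (embed (\<lambda>n. norm (\<xi> j) * block 1 n)) \<le> norm_E \<xi>"
    by (rule dominated[OF dec assms le])+
qed

lemma unit_mem: "embed (block 1) \<in> E"
proof -
  obtain \<eta> where \<eta>: "\<eta> \<in> E" "\<eta> \<noteq> (\<lambda>_. 0)"
    using nonzero zero_mem by blast
  then obtain j where j: "\<eta> j \<noteq> 0" by auto
  have "(\<lambda>n. complex_of_real (1 / norm (\<eta> j)) * embed (\<lambda>n. norm (\<eta> j) * block 1 n) n) \<in> E"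
    by (intro scale_mem scaled_unit_le \<eta>)
  then show ?thesis
    using j by simp
qed

lemma \<phi>_1_pos: "0 < \<phi> 1"
proof -
  have "embed (block 1) \<noteq> (\<lambda>_. 0)"
    by (auto simp: block_def fun_eq_iff)
  then show ?thesis
    using norm_eq_0[OF unit_mem] norm_nonneg[OF unit_mem] by (simp add: \<phi>_def order_less_le)
qed

lemma coordinate_le:
  assumes "\<xi> \<in> E"
  shows "norm (\<xi> j) * \<phi> 1 \<le> norm_E \<xi>"
  using scaled_unit_le(2)[OF assms, of j] norm_scale[OF unit_mem, of "complex_of_real (norm (\<xi> j))"]
  by (simp add: \<phi>_def)

text \<open>Such a sequence is submajorized by \<open>(C, 0, 0, ...)\<close>.\<close>

lemma l1_bounded_mem:
  assumes C: "\<And>G. finite G \<Longrightarrow> (\<Sum>j\<in>G. norm (\<xi> j)) \<le> C"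
  shows "\<xi> \<in> E" "norm_E \<xi> \<le> C * \<phi> 1"
proof -
  have C0: "0 \<le> C" using C[of "{}"] by simp
  have "norm (\<xi> n) \<le> C" for n
    using C[of "{n}"] by simp
  then have \<xi>: "\<xi> \<in> linf"
    by (auto simp: linf_def bounded_iff)
  have mem: "(\<lambda>n. complex_of_real C * embed (block 1) n) \<in> E"
    by (intro scale_mem unit_mem)
  have "rearrangement (embed (\<lambda>n. C * block 1 n)) = (\<lambda>n. C * block 1 n)"
    using C0 by (intro rearrangement_decreasing) (auto simp: block_def decseq_def)
  then have r: "(\<Sum>n<m. rearrangement (\<lambda>n. complex_of_real C * embed (block 1) n) n) = C * real (min m 1)" for m
    by (simp add: sum_block flip: sum_distrib_left)
  have "\<xi> \<prec>\<prec> (\<lambda>n. complex_of_real C * embed (block 1) n)"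
    unfolding submajorized_def r
  proof
    fix m
    have "(\<Sum>n<m. rearrangement \<xi> n) \<le> C"
      using \<xi> C by (intro sum_rearrangement_leI) auto
    then show "(\<Sum>n<m. rearrangement \<xi> n) \<le> C * real (min m 1)"
      by (cases m) auto
  qed
  then show "\<xi> \<in> E" "norm_E \<xi> \<le> C * \<phi> 1"
    using fully_symmetric_mem[OF mem \<xi>] fully_symmetric_norm[OF mem \<xi>] norm_scale[OF unit_mem, of "complex_of_real C"] C0
    by (auto simp: \<phi>_def)
qed

lemma l1_subset: "l1 \<subseteq> E"
proof
  fix \<xi> assume "\<xi> \<in> l1"
  then have s: "summable (\<lambda>n. norm (\<xi> n))" by (simp add: l1_def)
  then show "\<xi> \<in> E"
    by (intro l1_bounded_mem(1)[of _ "\<Sum>n. norm (\<xi> n)"] sum_le_suminf) auto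
qed

lemma finite_support_mem:
  assumes "finite F" "\<And>n. n \<notin> F \<Longrightarrow> \<xi> n = 0"
  shows "\<xi> \<in> E" "norm_E \<xi> \<le> (\<Sum>n\<in>F. norm (\<xi> n)) * \<phi> 1"
proof -
  have bd: "(\<Sum>j\<in>G. norm (\<xi> j)) \<le> (\<Sum>n\<in>F. norm (\<xi> n))" if "finite G" for G
  proof -
    have "(\<Sum>j\<in>G. norm (\<xi> j)) = (\<Sum>j\<in>G \<inter> F. norm (\<xi> j))"
      using assms that by (intro sum.mono_neutral_right) auto
    also have "\<dots> \<le> (\<Sum>n\<in>F. norm (\<xi> n))"
      using assms by (intro sum_mono2) auto
    finally show ?thesis .
  qed
  show "\<xi> \<in> E" "norm_E \<xi> \<le> (\<Sum>n\<in>F. norm (\<xi> n)) * \<phi> 1"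
    using l1_bounded_mem[OF bd] by blast+
qed

lemma block_mem: "embed (block k) \<in> E"
  by (rule finite_support_mem(1)[of "{..<k}"]) (auto simp: block_def)

lemma \<phi>_nonneg: "0 \<le> \<phi> k"
  unfolding \<phi>_def by (intro norm_nonneg block_mem)

text \<open>The block of length \<open>k\<close> and height \<open>(\<xi>*\<^sub>0 + ... + \<xi>*\<^bsub>k-1\<^esub>) / k\<close> is submajorized by \<open>\<xi>\<close>.\<close>

lemma average_block_le:
  assumes \<xi>: "\<xi> \<in> E" and "0 < k"
  shows "(\<Sum>n<k. rearrangement \<xi> n) / real k * \<phi> k \<le> norm_E \<xi>"
proof -
  define A where "A = (\<Sum>n<k. rearrangement \<xi> n) / real k"
  note r = rearrangement_decseq[OF linfD[OF \<xi>]] rearrangement_nonneg[OF linfD[OF \<xi>]]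
  have A0: "0 \<le> A"
    unfolding A_def by (intro divide_nonneg_nonneg sum_nonneg r) auto
  have kA: "real k * A = (\<Sum>n<k. rearrangement \<xi> n)"
    using \<open>0 < k\<close> by (simp add: A_def)
  have "(\<Sum>n<m. A * block k n) \<le> (\<Sum>n<m. rearrangement \<xi> n)" for m
  proof (cases "m \<le> k")
    case True
    have "real k * (\<Sum>n<m. A * block k n) = real m * (\<Sum>n<k. rearrangement \<xi> n)"
      using True by (simp add: sum_block mult_ac flip: sum_distrib_left kA)
    also have "\<dots> \<le> real k * (\<Sum>n<m. rearrangement \<xi> n)"
      by (rule decseq_average[OF r(1) True])
    finally show ?thesis using \<open>0 < k\<close> by simp
  next
    case False
    then have "(\<Sum>n<m. A * block k n) = (\<Sum>n<k. rearrangement \<xi> n)"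
      by (simp add: sum_block mult.commute flip: sum_distrib_left kA)
    also have "\<dots> \<le> (\<Sum>n<m. rearrangement \<xi> n)"
      using False r by (intro sum_mono2) auto
    finally show ?thesis .
  qed
  moreover have "decseq (\<lambda>n. A * block k n)"
    using A0 by (auto simp: block_def decseq_def)
  ultimately have "norm_E (embed (\<lambda>n. A * block k n)) \<le> norm_E \<xi>"
    using A0 block_facts by (intro dominated(2)[OF _ _ \<xi>]) auto
  moreover have "norm_E (embed (\<lambda>n. A * block k n)) = A * \<phi> k"
    using norm_scale[OF block_mem[of k], of "complex_of_real A"] A0 by (simp add: \<phi>_def)
  ultimately show ?thesis
    unfolding A_def[symmetric] by simp
qed

lemma \<phi>_ratio_antimono:
  assumes "0 < m" "m \<le> k"
  shows "\<phi> k / real k \<le> \<phi> m / real m"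
proof -
  have "(\<Sum>n<k. rearrangement (embed (block m)) n) = real m"
    using assms by (simp add: rearrangement_decreasing block_facts sum_block)
  then show ?thesis
    using average_block_le[OF block_mem[of m], of k] assms
    by (simp add: \<phi>_def[symmetric] field_simps)
qed

text \<open>A non-increasing sequence with sum at most \<open>C\<close> and first term at most \<open>C / N\<close> is submajorized by
  the block of length \<open>N\<close> and height \<open>C / N\<close>, of norm \<open>C \<phi> N / N\<close>.\<close>

lemma small_trace_norm_bounded:
  assumes lim: "(\<lambda>n. \<phi> n / real n) \<longlonglongrightarrow> 0" and "0 < C" "0 < \<eta>"
  shows "\<exists>\<epsilon>>0. \<forall>s. decseq s \<and> (\<forall>n. 0 \<le> s n) \<and> s 0 \<le> \<epsilon> \<and> (\<forall>m. (\<Sum>n<m. s n) \<le> C) \<longrightarrow>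
    embed s \<in> E \<and> norm_E (embed s) < \<eta>"
proof -
  have "\<forall>\<^sub>F n in sequentially. \<phi> n / real n < \<eta> / C"
    using lim assms by (intro order_tendstoD(2)) auto
  then obtain N0 where "\<And>n. N0 \<le> n \<Longrightarrow> \<phi> n / real n < \<eta> / C"
    by (auto simp: eventually_sequentially)
  then obtain N where N: "0 < N" "\<phi> N / real N < \<eta> / C"
    by (metis le_add1 zero_less_Suc le_SucI order_refl)
  define \<epsilon> where "\<epsilon> = C / real N"
  have "0 < \<epsilon>" using N \<open>0 < C\<close> by (simp add: \<epsilon>_def)
  then show ?thesis
  proof (intro exI[of _ \<epsilon>] conjI[of "0 < \<epsilon>"] allI impI)
    fix s assume "decseq s \<and> (\<forall>n. 0 \<le> s n) \<and> s 0 \<le> \<epsilon> \<and> (\<forall>m. (\<Sum>n<m. s n) \<le> C)"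
    then have s: "decseq s" "\<And>n. 0 \<le> s n" "s 0 \<le> \<epsilon>" "\<And>m. (\<Sum>n<m. s n) \<le> C" by auto
    have le: "(\<Sum>n<m. s n) \<le> (\<Sum>n<m. \<epsilon> * block N n)" for m
    proof (cases "m \<le> N")
      case True
      have "(\<Sum>n<m. s n) \<le> (\<Sum>n<m. \<epsilon>)"
        using s(1,3) by (intro sum_mono) (auto simp: decseq_def intro: order_trans)
      also have "\<dots> = (\<Sum>n<m. \<epsilon> * block N n)"
        using True by (simp add: sum_block flip: sum_distrib_left)
      finally show ?thesis .
    next
      case False
      then have "(\<Sum>n<m. \<epsilon> * block N n) = \<epsilon> * real N"
        by (simp add: sum_block flip: sum_distrib_left)
      then have "(\<Sum>n<m. \<epsilon> * block N n) = C"
        using N by (simp add: \<epsilon>_def)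
      then show ?thesis using s(4) by simp
    qed
    have mem: "embed (\<lambda>n. \<epsilon> * block N n) \<in> E"
      using scale_mem[OF block_mem, of "complex_of_real \<epsilon>" N] by simp
    have nrm: "norm_E (embed (\<lambda>n. \<epsilon> * block N n)) = \<epsilon> * \<phi> N"
      using norm_scale[OF block_mem, of "complex_of_real \<epsilon>" N] \<open>0 < \<epsilon>\<close> by (simp add: \<phi>_def)
    have dec: "decseq (\<lambda>n. \<epsilon> * block N n)" "\<And>n. 0 \<le> \<epsilon> * block N n"
      using \<open>0 < \<epsilon>\<close> by (auto simp: block_def decseq_def)
    have "\<epsilon> * \<phi> N < \<eta>"
      using N \<open>0 < C\<close> by (simp add: \<epsilon>_def field_simps)
    then show "embed s \<in> E \<and> norm_E (embed s) < \<eta>"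
      using dominated_decreasing[OF s(1,2) dec mem le] nrm by simp
  qed
qed

end

context fully_symmetric_space
begin

subsection \<open>Absolutely convergent series\<close>

text \<open>Coordinate functionals are bounded with respect to the norm.\<close>

lemma norm_limit_coordinates:
  assumes X: "\<And>k. X k \<in> E" and \<xi>: "\<xi> \<in> E" and lim: "(\<lambda>k. norm_E (\<lambda>n. X k n - \<xi> n)) \<longlonglongrightarrow> 0"
  shows "(\<lambda>k. X k n) \<longlonglongrightarrow> \<xi> n"
proof -
  have le: "norm (X k n - \<xi> n) \<le> norm_E (\<lambda>n. X k n - \<xi> n) / \<phi> 1" for k
    using coordinate_le[OF diff_mem[OF X[of k] \<xi>], of n] \<phi>_1_pos by (simp add: field_simps)
  have "(\<lambda>k. norm_E (\<lambda>n. X k n - \<xi> n) / \<phi> 1) \<longlonglongrightarrow> 0 / \<phi> 1"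
    by (intro tendsto_divide lim tendsto_const) (use \<phi>_1_pos in simp)
  then have lim': "(\<lambda>k. norm_E (\<lambda>n. X k n - \<xi> n) / \<phi> 1) \<longlonglongrightarrow> 0"
    by simp
  have "(\<lambda>k. norm (X k n - \<xi> n)) \<longlonglongrightarrow> 0"
    by (rule tendsto_sandwich[where f = "\<lambda>_. 0", OF _ _ tendsto_const lim'])
       (intro always_eventually allI norm_ge_zero le)+
  then show ?thesis
    by (simp add: tendsto_norm_zero_iff LIM_zero_cancel)
qed

lemma summable_series:
  assumes x: "\<And>j. x j \<in> E" and sm: "summable (\<lambda>j. norm_E (x j))"
  obtains \<xi> where "\<xi> \<in> E" "\<And>n. (\<lambda>J. \<Sum>j<J. x j n) \<longlonglongrightarrow> \<xi> n" "norm_E \<xi> \<le> (\<Sum>j. norm_E (x j))"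
proof -
  define X where "X J n = (\<Sum>j<J. x j n)" for J n
  define S where "S J = (\<Sum>j<J. norm_E (x j))" for J
  have nn: "0 \<le> norm_E (x j)" for j
    by (intro norm_nonneg x)
  have X: "X J \<in> E" "norm_E (X J) \<le> S J" for J
    using sum_mem[of "{..<J}" x] x by (simp_all add: X_def[abs_def] S_def)
  have diff: "norm_E (\<lambda>n. X k n - X l n) \<le> \<bar>S k - S l\<bar>" for k l
  proof -
    have *: "norm_E (\<lambda>n. X k n - X l n) \<le> S k - S l" if "l \<le> k" for k l
    proof -
      have "X k n - X l n = (\<Sum>j=l..<k. x j n)" for n
        using sum_diff_nat_ivl[of 0 l k "\<lambda>j. x j n"] that by (simp add: X_def lessThan_atLeast0)
      moreover have "S k - S l = (\<Sum>j=l..<k. norm_E (x j))"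
        using sum_diff_nat_ivl[of 0 l k "\<lambda>j. norm_E (x j)"] that by (simp add: S_def lessThan_atLeast0)
      ultimately show ?thesis
        using sum_mem[of "{l..<k}" x] x by simp
    qed
    show ?thesis
    proof (cases "l \<le> k")
      case True
      then show ?thesis using *[OF True] by linarith
    next
      case False
      then show ?thesis
        using *[of k l] norm_diff_commute[OF X(1)[of k] X(1)[of l]] by simp
    qed
  qed
  have "convergent S"
    using sm by (simp add: S_def[abs_def] summable_iff_convergent)
  then have "Cauchy S"
    by (rule convergent_Cauchy)
  have "\<exists>\<xi>\<in>E. (\<lambda>k. norm_E (\<lambda>n. X k n - \<xi> n)) \<longlonglongrightarrow> 0"
  proof (rule norm_complete[OF X(1)], intro allI impI)
    fix \<epsilon> :: real assume "0 < \<epsilon>"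
    from CauchyD[OF \<open>Cauchy S\<close> this] obtain K where "\<forall>k\<ge>K. \<forall>l\<ge>K. norm (S k - S l) < \<epsilon>" by blast
    then have "norm_E (\<lambda>n. X k n - X l n) < \<epsilon>" if "K \<le> k" "K \<le> l" for k l
      using diff[of k l] that by (auto intro: le_less_trans)
    then show "\<exists>K. \<forall>k\<ge>K. \<forall>l\<ge>K. norm_E (\<lambda>n. X k n - X l n) < \<epsilon>" by blast
  qed
  then obtain \<xi> where \<xi>: "\<xi> \<in> E" and lim: "(\<lambda>k. norm_E (\<lambda>n. X k n - \<xi> n)) \<longlonglongrightarrow> 0"
    by blast
  have "norm_E \<xi> \<le> suminf (\<lambda>j. norm_E (x j)) + norm_E (\<lambda>n. X k n - \<xi> n)" for k
  proof -
    have "norm_E (\<lambda>n. X k n + (\<xi> n - X k n)) \<le> norm_E (X k) + norm_E (\<lambda>n. \<xi> n - X k n)"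
      by (intro norm_triangle X diff_mem \<xi>)
    moreover have "norm_E (X k) \<le> suminf (\<lambda>j. norm_E (x j))"
      using X(2)[of k] sum_le_suminf[OF sm, of "{..<k}"] nn by (simp add: S_def)
    ultimately show ?thesis
      using norm_diff_commute[OF X(1)[of k] \<xi>] by simp
  qed
  moreover have "(\<lambda>k. suminf (\<lambda>j. norm_E (x j)) + norm_E (\<lambda>n. X k n - \<xi> n)) \<longlonglongrightarrow> suminf (\<lambda>j. norm_E (x j)) + 0"
    by (intro tendsto_add lim tendsto_const)
  ultimately have "norm_E \<xi> \<le> suminf (\<lambda>j. norm_E (x j)) + 0"
    by (intro LIMSEQ_le_const[of _ "suminf (\<lambda>j. norm_E (x j)) + 0"]) auto
  then show thesis
    using that[OF \<xi>] norm_limit_coordinates[OF X(1) \<xi> lim] by (simp add: X_def)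
qed

subsection \<open>The fundamental function and the space of summable sequences\<close>

text \<open>If \<open>\<phi> n / n\<close> stays above some \<open>c > 0\<close>, then \<open>\<parallel>\<xi>\<parallel> \<ge> c \<Sum> \<xi>*\<^sub>n\<close> by averaging, and
  the space is contained in \<open>l\<^sup>1\<close>.\<close>

lemma \<phi>_ratio_tendsto_0:
  assumes "E \<noteq> l1"
  shows "(\<lambda>n. \<phi> n / real n) \<longlonglongrightarrow> 0"
proof (rule ccontr)
  assume "\<not> ?thesis"
  then obtain c where c: "0 < c" "\<And>N. \<exists>n\<ge>N. c \<le> \<phi> n / real n"
    using \<phi>_nonneg unfolding LIMSEQ_iff by (auto simp: not_less)
  have ratio: "c \<le> \<phi> k / real k" if "0 < k" for k
    using c(2)[of k] \<phi>_ratio_antimono[OF that] by (meson order_trans)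
  have "E \<subseteq> l1"
  proof
    fix \<xi> assume \<xi>: "\<xi> \<in> E"
    have "(\<Sum>n<k. norm (\<xi> n)) \<le> norm_E \<xi> / c" for k
    proof (cases "k = 0")
      case True
      then show ?thesis using norm_nonneg[OF \<xi>] c(1) by simp
    next
      case False
      define R where "R = (\<Sum>n<k. rearrangement \<xi> n)"
      have R0: "0 \<le> R"
        unfolding R_def by (intro sum_nonneg rearrangement_nonneg linfD[OF \<xi>])
      have "R * c \<le> R * (\<phi> k / real k)"
        using False by (intro mult_left_mono ratio R0) auto
      also have "\<dots> = R / real k * \<phi> k" by simp
      also have "\<dots> \<le> norm_E \<xi>"
        unfolding R_def using False by (intro average_block_le \<xi>) auto
      finally have "R \<le> norm_E \<xi> / c"
        using c(1) by (simp add: field_simps)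
      then show ?thesis
        using sum_le_sum_rearrangement[OF linfD[OF \<xi>], of "{..<k}"] by (simp add: R_def)
    qed
    then show "\<xi> \<in> l1"
      by (auto simp: l1_def intro!: summableI_nonneg_bounded)
  qed
  then show False using assms l1_subset by blast
qed

text \<open>Conversely, blocks of length \<open>N\<^sub>j\<close> and height \<open>2\<^sup>j / N\<^sub>j\<close> with \<open>\<phi> N\<^sub>j / N\<^sub>j \<le> 4\<^bsup>-j\<^esup>\<close> add up
  to an element of the space that is not summable.\<close>

lemma \<phi>_ratio_imp_not_l1:
  assumes lim: "(\<lambda>n. \<phi> n / real n) \<longlonglongrightarrow> 0"
  shows "E \<noteq> l1"
proof
  assume El1: "E = l1"
  have "\<exists>n>0. \<phi> n / real n \<le> (1/4)^j" for j :: nat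
  proof -
    have "\<forall>\<^sub>F n in sequentially. \<phi> n / real n < (1/4)^j"
      using lim by (rule order_tendstoD(2)) simp
    then obtain N where "\<And>n. N \<le> n \<Longrightarrow> \<phi> n / real n < (1/4)^j"
      by (auto simp: eventually_sequentially)
    then have "\<phi> (Suc N) / real (Suc N) < (1/4)^j" by (metis le_SucI order_refl)
    then show ?thesis
      by (meson less_imp_le zero_less_Suc)
  qed
  then obtain N where N: "\<And>j. 0 < N j" "\<And>j. \<phi> (N j) / real (N j) \<le> (1/4)^j"
    by metis
  define h where "h j = 2^j / real (N j)" for j
  have h0: "0 \<le> h j" for j by (simp add: h_def)
  define x where "x j = embed (\<lambda>n. h j * block (N j) n)" for j
  have x: "x j \<in> E" for j
    using scale_mem[OF block_mem, of "complex_of_real (h j)" "N j"] by (simp add: x_def)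
  have nx: "norm_E (x j) \<le> (1/2)^j" for j
  proof -
    have "norm_E (x j) = h j * \<phi> (N j)"
      using norm_scale[OF block_mem, of "complex_of_real (h j)" "N j"] h0[of j]
      by (simp add: x_def \<phi>_def)
    also have "\<dots> = 2^j * (\<phi> (N j) / real (N j))"
      by (simp add: h_def)
    also have "\<dots> \<le> 2^j * (1/4)^j"
      by (intro mult_left_mono N) auto
    also have "\<dots> = (1/2)^j"
      by (simp flip: power_mult_distrib)
    finally show ?thesis .
  qed
  have sm_x: "summable (\<lambda>j. norm_E (x j))"
    by (rule summable_comparison_test'[OF summable_geometric[of "1/2::real"], of 0])
       (use nx norm_nonneg[OF x] in auto)
  obtain \<xi> where \<xi>: "\<xi> \<in> E" "\<And>n. (\<lambda>J. \<Sum>j<J. x j n) \<longlonglongrightarrow> \<xi> n"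
      "norm_E \<xi> \<le> (\<Sum>j. norm_E (x j))"
    by (rule summable_series[OF x sm_x], rule that)
  have ge: "h j * block (N j) n \<le> norm (\<xi> n)" for j n
  proof (rule LIMSEQ_le_const[OF tendsto_norm[OF \<xi>(2)]], intro exI[of _ "Suc j"] allI impI)
    fix J assume J: "Suc j \<le> J"
    have nonneg: "0 \<le> h i * block (N i) n" for i
      by (intro mult_nonneg_nonneg h0 block_facts)
    have "h j * block (N j) n \<le> (\<Sum>i<J. h i * block (N i) n)"
      using J nonneg by (intro member_le_sum[of j "{..<J}" "\<lambda>i. h i * block (N i) n"]) auto
    also have "\<dots> \<le> \<bar>\<Sum>i<J. h i * block (N i) n\<bar>" by simp
    also have "\<dots> = norm (complex_of_real (\<Sum>i<J. h i * block (N i) n))"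
      by (rule norm_of_real[symmetric])
    also have "complex_of_real (\<Sum>i<J. h i * block (N i) n) = (\<Sum>j<J. x j n)"
      unfolding x_def by (rule of_real_sum)
    finally show "h j * block (N j) n \<le> norm (\<Sum>j<J. x j n)" .
  qed
  have sm: "summable (\<lambda>n. norm (\<xi> n))"
    using \<xi>(1) El1 by (simp add: l1_def)
  have "2^j \<le> suminf (\<lambda>n. norm (\<xi> n))" for j :: nat
  proof -
    have "2^j = (\<Sum>n<N j. h j)"
      using N(1)[of j] by (simp add: h_def)
    also have "\<dots> = (\<Sum>n<N j. h j * block (N j) n)"
      by (intro sum.cong refl) (simp add: block_def)
    also have "\<dots> \<le> (\<Sum>n<N j. norm (\<xi> n))"
      by (intro sum_mono ge)
    also have "\<dots> \<le> suminf (\<lambda>n. norm (\<xi> n))"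
      using sm by (intro sum_le_suminf) auto
    finally show ?thesis .
  qed
  moreover obtain j :: nat where "suminf (\<lambda>n. norm (\<xi> n)) < 2^j"
    using real_arch_pow[of 2 "suminf (\<lambda>n. norm (\<xi> n))"] by auto
  ultimately show False
    using linorder_not_less by blast
qed

subsection \<open>Separability\<close>

text \<open>A set of at most \<open>j\<close> indices misses one of \<open>n, ..., n + j\<close>, where \<open>s\<close> is at least
  \<open>s (j + n)\<close>. So the shift is submajorized by the truncation.\<close>

lemma shift_le_tail:
  assumes s: "decseq s" "\<And>n. 0 \<le> s n" "embed s \<in> E"
  shows "embed (\<lambda>k. s (k + n)) \<in> E"
    "norm_E (embed (\<lambda>k. s (k + n))) \<le> norm_E (embed (\<lambda>k. if n \<le> k then s k else 0))"
proof -
  have mem: "embed (\<lambda>k. if n \<le> k then s k else 0) \<in> E"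
    by (rule solid(1)[OF s(3)]) (use s(2) in auto)
  have "s (j + n) \<le> rearrangement (embed (\<lambda>k. if n \<le> k then s k else 0)) j" for j
  proof (rule rearrangement_geI[OF linfD[OF mem]])
    fix F :: "nat set" assume "finite F" "card F \<le> j"
    from finite_avoids[OF this, of n] obtain m where m: "n \<le> m" "m \<le> n + j" "m \<notin> F" by auto
    then have "s (j + n) \<le> s m"
      using s(1) by (simp add: decseq_def)
    then show "\<exists>m. m \<notin> F \<and> s (j + n) \<le> norm (complex_of_real (if n \<le> m then s m else 0))"
      using m s(2) by (intro exI[of _ m]) simp
  qed
  moreover have "decseq (\<lambda>k. s (k + n))"
    using s(1) by (auto simp: decseq_def)
  ultimately show "embed (\<lambda>k. s (k + n)) \<in> E"
    "norm_E (embed (\<lambda>k. s (k + n))) \<le> norm_E (embed (\<lambda>k. if n \<le> k then s k else 0))"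
    using s(2) mem by (auto intro!: dominated sum_mono)
qed

lemma uncountable_nat_sets: "\<not> countable (UNIV :: nat set set)"
proof
  assume "countable (UNIV :: nat set set)"
  then obtain f :: "nat set \<Rightarrow> nat" where "inj f"
    by (auto simp: countable_def)
  then have "surj (inv f)" by (rule inj_imp_surj_inv)
  then show False
    using Cantors_theorem[of UNIV] by (metis Pow_UNIV)
qed

text \<open>In a separable space the truncations \<open>s 1\<^bsub>[0,n)\<^esub>\<close> form a Cauchy sequence: otherwise
  there would be disjoint blocks of \<open>s\<close> with norms bounded below, and sums of these blocks over
  all sets of indices would be an uncountable separated family. By completeness the truncations
  then converge, necessarily to \<open>s\<close>.\<close>

lemma separable_imp_shift_tendsto_0:
  assumes sep: "separable_seq_space E norm_E" and s: "decseq s" "\<And>n. 0 \<le> s n" "embed s \<in> E"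
  shows "(\<lambda>n. norm_E (embed (\<lambda>k. s (k + n)))) \<longlonglongrightarrow> 0"
proof -
  define X where "X n = embed (\<lambda>k. if k < n then s k else 0)" for n
  have X: "X n \<in> E" for n
    unfolding X_def by (rule solid(1)[OF s(3)]) (use s(2) in auto)
  have cauchy: "\<forall>\<epsilon>>0. \<exists>K. \<forall>k\<ge>K. \<forall>l\<ge>K. norm_E (\<lambda>n. X k n - X l n) < \<epsilon>"
  proof (rule ccontr)
    assume "\<not> ?thesis"
    then obtain \<delta> where \<delta>: "0 < \<delta>" "\<And>K. \<exists>k\<ge>K. \<exists>l\<ge>K. \<delta> \<le> norm_E (\<lambda>n. X k n - X l n)"
      by (auto simp: not_less)
    define Y where "Y k l = embed (\<lambda>n. if k \<le> n \<and> n < l then s n else 0)" for k l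
    have Y: "Y k l \<in> E" for k l
      unfolding Y_def by (rule solid(1)[OF s(3)]) (use s(2) in auto)
    have XY: "(\<lambda>n. X l n - X k n) = Y k l" if "k \<le> l" for k l
      using that by (auto simp: X_def Y_def fun_eq_iff)
    have "\<exists>k l. K \<le> k \<and> k < l \<and> \<delta> \<le> norm_E (Y k l)" for K
    proof -
      obtain k l where kl: "K \<le> k" "K \<le> l" "\<delta> \<le> norm_E (\<lambda>n. X k n - X l n)"
        using \<delta>(2) by blast
      have "k \<noteq> l"
        using kl(3) \<delta>(1) norm_eq_0[OF zero_mem] by auto
      then consider "k < l" | "l < k" by linarith
      then show ?thesis
      proof cases
        case 1
        then show ?thesis
          using kl XY[of k l] norm_diff_commute[OF X[of k] X[of l]] by (intro exI[of _ k] exI[of _ l]) auto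
      next
        case 2
        then show ?thesis
          using kl XY[of l k] by (intro exI[of _ l] exI[of _ k]) auto
      qed
    qed
    then obtain p q where pq: "\<And>K. K \<le> p K" "\<And>K. p K < q K" "\<And>K. \<delta> \<le> norm_E (Y (p K) (q K))"
      by metis
    define t where "t i = (q ^^ i) 0" for i
    have t_Suc: "t (Suc i) = q (t i)" for i by (simp add: t_def)
    have "t i \<le> t (Suc i)" for i
      using pq(1)[of "t i"] pq(2)[of "t i"] by (simp add: t_Suc)
    then have t_mono: "i \<le> j \<Longrightarrow> t i \<le> t j" for i j
      by (rule lift_Suc_mono_le)
    define B where "B i = {p (t i)..<q (t i)}" for i
    have disj: "i = j" if "n \<in> B i" "n \<in> B j" for i j n
    proof (rule ccontr)
      have *: False if "i < j" "n \<in> B i" "n \<in> B j" for i j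
      proof -
        have "q (t i) \<le> t j"
          using t_mono[of "Suc i" j] that by (simp add: t_Suc)
        then show False
          using that(2,3) pq(1)[of "t j"] by (auto simp: B_def)
      qed
      assume "i \<noteq> j"
      then show False
        using *[of i j] *[of j i] that by linarith
    qed
    define \<xi> where "\<xi> A = embed (\<lambda>n. if \<exists>i\<in>A. n \<in> B i then s n else 0)" for A
    have \<xi>: "\<xi> A \<in> E" for A
      unfolding \<xi>_def by (rule solid(1)[OF s(3)]) (use s(2) in auto)
    have sep_\<xi>: "\<delta> \<le> norm_E (\<lambda>n. \<xi> A n - \<xi> A' n)" if A: "A \<noteq> A'" for A A'
    proof -
      obtain i where i: "i \<in> A \<longleftrightarrow> i \<notin> A'" using A by blast
      have "norm_E (Y (p (t i)) (q (t i))) \<le> norm_E (\<lambda>n. \<xi> A n - \<xi> A' n)"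
      proof (rule solid(2)[OF diff_mem[OF \<xi> \<xi>]])
        fix n
        show "norm (Y (p (t i)) (q (t i)) n) \<le> norm (\<xi> A n - \<xi> A' n)"
        proof (cases "n \<in> B i")
          case True
          have "(\<exists>j\<in>A''. n \<in> B j) \<longleftrightarrow> i \<in> A''" for A''
            using disj[OF True] True by blast
          then have "\<xi> A n - \<xi> A' n = complex_of_real (if i \<in> A then s n else 0)
              - complex_of_real (if i \<in> A' then s n else 0)"
            by (simp add: \<xi>_def)
          then have "norm (\<xi> A n - \<xi> A' n) = s n"
            using i s(2)[of n] by (cases "i \<in> A") auto
          then show ?thesis
            using True s(2)[of n] by (simp add: Y_def B_def)
        next
          case False
          then have "Y (p (t i)) (q (t i)) n = 0"
            by (auto simp: Y_def B_def)
          then show ?thesis by simp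
        qed
      qed
      then show ?thesis using pq(3) order_trans by blast
    qed
    obtain D where D: "countable D" "D \<subseteq> E" "\<And>\<xi> \<epsilon>. \<xi> \<in> E \<Longrightarrow> 0 < \<epsilon> \<Longrightarrow> \<exists>d\<in>D. norm_E (\<lambda>n. \<xi> n - d n) < \<epsilon>"
      using sep unfolding separable_seq_space_def by blast
    have "\<exists>d\<in>D. norm_E (\<lambda>n. \<xi> A n - d n) < \<delta>/2" for A
      using D(3)[OF \<xi>, of "\<delta>/2"] \<delta>(1) by simp
    then obtain d where d: "\<And>A. d A \<in> D" "\<And>A. norm_E (\<lambda>n. \<xi> A n - d A n) < \<delta>/2"
      by metis
    have "inj d"
    proof (rule injI, rule ccontr)
      fix A A' assume eq: "d A = d A'" and "A \<noteq> A'"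
      have dE: "d A \<in> E" using d(1) D(2) by blast
      have "norm_E (\<lambda>n. (\<xi> A n - d A n) + (d A n - \<xi> A' n))
          \<le> norm_E (\<lambda>n. \<xi> A n - d A n) + norm_E (\<lambda>n. d A n - \<xi> A' n)"
        by (intro norm_triangle diff_mem \<xi> dE)
      also have "norm_E (\<lambda>n. d A n - \<xi> A' n) = norm_E (\<lambda>n. \<xi> A' n - d A' n)"
        using norm_diff_commute[OF dE \<xi>] eq by simp
      finally show False
        using sep_\<xi>[OF \<open>A \<noteq> A'\<close>] d(2)[of A] d(2)[of A'] by simp
    qed
    moreover have "countable (range d)"
      using D(1) d(1) countable_subset[of "range d" D] by blast
    ultimately have "countable (UNIV :: nat set set)"
      using countable_image_inj_on by blast
    then show False using uncountable_nat_sets by blast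
  qed
  have "\<exists>\<zeta>\<in>E. (\<lambda>k. norm_E (\<lambda>n. X k n - \<zeta> n)) \<longlonglongrightarrow> 0"
    by (rule norm_complete[OF X cauchy])
  then obtain \<zeta> where \<zeta>: "\<zeta> \<in> E" and lim: "(\<lambda>k. norm_E (\<lambda>n. X k n - \<zeta> n)) \<longlonglongrightarrow> 0"
    by blast
  have "\<zeta> n = embed s n" for n
  proof (rule LIMSEQ_unique[OF norm_limit_coordinates[OF X \<zeta> lim]])
    have "\<forall>\<^sub>F k in sequentially. X k n = embed s n"
      using eventually_gt_at_top[of n] by eventually_elim (simp add: X_def)
    then show "(\<lambda>k. X k n) \<longlonglongrightarrow> embed s n"
      by (rule tendsto_eventually)
  qed
  then have \<zeta>_eq: "\<zeta> = embed s" by auto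
  have le: "norm_E (embed (\<lambda>k. s (k + n))) \<le> norm_E (\<lambda>k. X n k - \<zeta> k)" for n
  proof -
    have "embed (\<lambda>k. if n \<le> k then s k else 0) = (\<lambda>k. \<zeta> k - X n k)"
      by (auto simp: \<zeta>_eq X_def fun_eq_iff)
    then show ?thesis
      using shift_le_tail(2)[OF s, of n] norm_diff_commute[OF X \<zeta>] by simp
  qed
  show ?thesis
    by (rule tendsto_sandwich[where f = "\<lambda>_. 0", OF _ _ tendsto_const lim])
       (intro always_eventually allI le norm_nonneg shift_le_tail(1)[OF s])+
qed

text \<open>Conversely, if shifts of non-increasing sequences tend to 0, then finitely supported
  sequences are dense: cutting \<open>\<xi>\<close> off outside the set \<open>{m. \<bar>\<xi>\<^sub>m\<bar> \<ge> t}\<close>, of cardinality \<open>n\<close>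
  say, leaves a sequence whose rearrangement is dominated by \<open>\<xi>*\<close> shifted by \<open>n\<close>.\<close>

lemma finite_cutoff:
  assumes c0: "E \<subseteq> c0"
    and shift: "\<And>s. decseq s \<Longrightarrow> (\<And>n. 0 \<le> s n) \<Longrightarrow> embed s \<in> E \<Longrightarrow>
      (\<lambda>n. norm_E (embed (\<lambda>k. s (k + n)))) \<longlonglongrightarrow> 0"
    and \<xi>: "\<xi> \<in> E" and "0 < \<epsilon>"
  obtains F where "finite F" "norm_E (\<lambda>n. if n \<in> F then 0 else \<xi> n) < \<epsilon>"
proof (cases "finite {n. \<xi> n \<noteq> 0}")
  case True
  have "(\<lambda>n. if n \<in> {n. \<xi> n \<noteq> 0} then 0 else \<xi> n) = (\<lambda>_. 0)" by auto
  then show thesis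
    using that[OF True] norm_eq_0[OF zero_mem] \<open>0 < \<epsilon>\<close> by simp
next
  case False
  define s where "s = rearrangement \<xi>"
  have s: "decseq s" "\<And>n. 0 \<le> s n" "embed s \<in> E"
    unfolding s_def using rearrangement_decseq rearrangement_nonneg rearrangement_mem linfD[OF \<xi>] \<xi> by auto
  have "\<forall>\<^sub>F n in sequentially. norm_E (embed (\<lambda>k. s (k + n))) < \<epsilon>"
    using shift[OF s] \<open>0 < \<epsilon>\<close> by (rule order_tendstoD(2))
  then obtain N where N: "norm_E (embed (\<lambda>k. s (k + N))) < \<epsilon>"
    by (auto simp: eventually_sequentially)
  obtain G where G: "finite G" "card G = N" "G \<subseteq> {n. \<xi> n \<noteq> 0}"
    using infinite_arbitrarily_large[OF False, of N] by auto
  have "\<exists>t>0. \<forall>m\<in>G. t \<le> norm (\<xi> m)"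
    using G(1,3)
  proof (induction G rule: finite_induct)
    case (insert m G)
    then obtain t where "0 < t" "\<forall>m\<in>G. t \<le> norm (\<xi> m)" by auto
    then show ?case
      using insert by (intro exI[of _ "min t (norm (\<xi> m))"]) auto
  qed (auto intro: exI[of _ 1])
  then obtain t where t: "0 < t" "\<And>m. m \<in> G \<Longrightarrow> t \<le> norm (\<xi> m)" by blast
  define F where "F = {m. t \<le> norm (\<xi> m)}"
  have \<xi>_lim: "(\<lambda>n. norm (\<xi> n)) \<longlonglongrightarrow> 0"
    using \<xi> c0 by (auto simp: c0_def intro: tendsto_norm_zero)
  obtain M where M: "\<And>n. M \<le> n \<Longrightarrow> norm (\<xi> n) < t"
    using order_tendstoD(2)[OF \<xi>_lim t(1)] unfolding eventually_sequentially by blast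
  then have "F \<subseteq> {..<M}"
    by (auto simp: F_def) (metis not_less)
  then have F: "finite F" using finite_subset by blast
  have NF: "N \<le> card F"
    using card_mono[OF F, of G] t(2) G(2) by (auto simp: F_def)
  define \<eta> where "\<eta> n = (if n \<in> F then 0 else \<xi> n)" for n
  have \<eta>: "\<eta> \<in> E"
    by (rule solid(1)[OF \<xi>]) (simp add: \<eta>_def)
  have "rearrangement \<eta> k \<le> s (k + N)" for k
  proof -
    have "rearrangement \<eta> k \<le> s (k + card F)"
      unfolding s_def
    proof (rule rearrangement_ge_Sup)
      fix H :: "nat set" assume H: "finite H" "card H \<le> k + card F"
      define c where "c = (SUP m\<in>- H. norm (\<xi> m))"
      have c_ge: "norm (\<xi> m) \<le> c" if "m \<notin> H" for m
        unfolding c_def using that linf_bdd_above[OF linfD[OF \<xi>]] by (intro cSUP_upper) auto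
      show "rearrangement \<eta> k \<le> c"
      proof (cases "F \<subseteq> H")
        case True
        obtain m where "m \<notin> H"
          using ex_new_if_finite[OF infinite_UNIV_nat H(1)] by blast
        then have "0 \<le> c"
          using c_ge[of m] norm_ge_zero order_trans by blast
        then show ?thesis
          using H True F c_ge by (intro rearrangement_leI[OF linfD[OF \<eta>], of "H - F"])
            (auto simp: \<eta>_def card_Diff_subset)
      next
        case False
        then obtain m where m: "m \<in> F" "m \<notin> H" by blast
        have "rearrangement \<eta> k \<le> t"
          using linfD[OF \<eta>] t(1) by (intro rearrangement_leI[of _ "{}"]) (auto simp: \<eta>_def F_def)
        also have "t \<le> c"
          using m c_ge[of m] by (simp add: F_def)
        finally show ?thesis .
      qed
    qed
    also have "\<dots> \<le> s (k + N)"
      using s(1) NF by (simp add: decseq_def)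
    finally show ?thesis .
  qed
  then have "\<eta> \<prec>\<prec> embed (\<lambda>k. s (k + N))"
    unfolding submajorized_def
  proof (intro allI)
    have "rearrangement (embed (\<lambda>k. s (k + N))) = (\<lambda>k. s (k + N))"
      using s by (intro rearrangement_decreasing) (auto simp: decseq_def)
    then show "(\<Sum>n<m. rearrangement \<eta> n) \<le> (\<Sum>n<m. rearrangement (embed (\<lambda>k. s (k + N))) n)" for m
      using \<open>\<And>k. rearrangement \<eta> k \<le> s (k + N)\<close> by (simp add: sum_mono)
  qed
  then have "norm_E \<eta> < \<epsilon>"
    using fully_symmetric_norm[OF shift_le_tail(1)[OF s] linfD[OF \<eta>]] N by (meson le_less_trans)
  then show thesis
    using that[OF F] by (simp add: \<eta>_def[abs_def])
qed

text \<open>Approximate the finite part of \<open>\<xi>\<close> coordinatewise from a countable dense set of numbers.\<close>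

lemma separableI:
  assumes c0: "E \<subseteq> c0"
    and shift: "\<And>s. decseq s \<Longrightarrow> (\<And>n. 0 \<le> s n) \<Longrightarrow> embed s \<in> E \<Longrightarrow>
      (\<lambda>n. norm_E (embed (\<lambda>k. s (k + n)))) \<longlonglongrightarrow> 0"
  shows "separable_seq_space E norm_E"
proof -
  obtain Q :: "complex set" where Q: "countable Q" "\<And>U. open U \<Longrightarrow> U \<noteq> {} \<Longrightarrow> \<exists>z\<in>Q. z \<in> U"
    using countable_dense_setE[where 'a = complex] by metis
  define seq where "seq xs n = (if n < length xs then xs ! n else 0)" for xs :: "complex list" and n
  define D where "D = seq ` lists Q"
  have "countable D"
    unfolding D_def using Q(1) by (intro countable_image countable_lists)
  moreover have "D \<subseteq> E"
  proof -
    have "seq xs \<in> E" for xs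
      by (rule finite_support_mem(1)[of "{..<length xs}"]) (auto simp: seq_def)
    then show ?thesis by (auto simp: D_def)
  qed
  moreover have "\<exists>d\<in>D. norm_E (\<lambda>n. \<xi> n - d n) < \<epsilon>" if \<xi>: "\<xi> \<in> E" and "0 < \<epsilon>" for \<xi> \<epsilon>
  proof -
    obtain F where F: "finite F" "norm_E (\<lambda>n. if n \<in> F then 0 else \<xi> n) < \<epsilon> / 2"
      using finite_cutoff[OF c0 shift \<xi>, of "\<epsilon>/2"] \<open>0 < \<epsilon>\<close> by auto
    obtain L where L: "F \<subseteq> {..<L}"
      using F(1) finite_nat_iff_bounded by blast
    define \<delta> where "\<delta> = \<epsilon> / (2 * (real L + 1) * \<phi> 1)"
    have \<delta>: "0 < \<delta>"
      using \<phi>_1_pos \<open>0 < \<epsilon>\<close> by (simp add: \<delta>_def add_nonneg_pos)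
    define \<zeta> where "\<zeta> n = (if n \<in> F then \<xi> n else 0)" for n
    have "\<exists>z\<in>Q. norm (\<zeta> n - z) < \<delta>" for n
      using Q(2)[of "ball (\<zeta> n) \<delta>"] \<delta> by (auto simp: dist_norm)
    then obtain z where z: "\<And>n. z n \<in> Q" "\<And>n. norm (\<zeta> n - z n) < \<delta>"
      by metis
    define d where "d = seq (map z [0..<L])"
    have dD: "d \<in> D"
      unfolding D_def d_def using z(1) by (intro imageI) auto
    have zero: "\<zeta> n - d n = 0" if "n \<notin> {..<L}" for n
      using that L by (auto simp: \<zeta>_def d_def seq_def)
    have "norm_E (\<lambda>n. \<zeta> n - d n) \<le> (\<Sum>n<L. norm (\<zeta> n - d n)) * \<phi> 1"
      by (rule finite_support_mem(2)) (use zero in auto)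
    also have "\<dots> \<le> (\<Sum>n<L. \<delta>) * \<phi> 1"
      using z(2) \<phi>_1_pos by (intro mult_right_mono sum_mono) (auto simp: d_def seq_def less_imp_le)
    also have "\<dots> < ((real L + 1) * \<delta>) * \<phi> 1"
      using \<delta> \<phi>_1_pos by (intro mult_strict_right_mono) auto
    also have "\<dots> = \<epsilon> / 2"
    proof -
      have "(a * (\<epsilon> / (2 * a * b))) * b = \<epsilon> / 2" if "a \<noteq> 0" "b \<noteq> 0" for a b :: real
        using that by (simp add: field_simps)
      from this[of "real L + 1" "\<phi> 1"] show ?thesis
        using \<phi>_1_pos unfolding \<delta>_def by linarith
    qed
    finally have d2: "norm_E (\<lambda>n. \<zeta> n - d n) < \<epsilon> / 2" .
    have "(\<lambda>n. if n \<in> F then 0 else \<xi> n) \<in> E"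
      by (rule solid(1)[OF \<xi>]) simp
    moreover have "(\<lambda>n. \<zeta> n - d n) \<in> E"
      by (rule finite_support_mem(1)[of "{..<L}"]) (use zero in auto)
    ultimately have "norm_E (\<lambda>n. (if n \<in> F then 0 else \<xi> n) + (\<zeta> n - d n)) < \<epsilon>"
      using norm_triangle[of "\<lambda>n. if n \<in> F then 0 else \<xi> n" "\<lambda>n. \<zeta> n - d n"] F(2) d2 by simp
    moreover have "(\<lambda>n. (if n \<in> F then 0 else \<xi> n) + (\<zeta> n - d n)) = (\<lambda>n. \<xi> n - d n)"
      by (auto simp: \<zeta>_def)
    ultimately show ?thesis
      using dD by auto
  qed
  ultimately show ?thesis
    unfolding separable_seq_space_def by blast
qed

end

section \<open>Mean ergodic theorems\<close>

subsection \<open>Averages of a contraction\<close>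

text \<open>The same elementary estimates are needed for three seminorms on operators: the norm of the
  ideal, the Hilbert-Schmidt norm, and the Ky Fan sums.\<close>

locale contraction_on =
  fixes W :: "'a::complex_hilbert bop set" and p :: "'a bop \<Rightarrow> real" and T :: "'a bop \<Rightarrow> 'a bop"
  assumes W_zero: "0 \<in> W"
    and W_add: "x \<in> W \<Longrightarrow> y \<in> W \<Longrightarrow> x + y \<in> W"
    and W_scale: "x \<in> W \<Longrightarrow> r *\<^sub>R x \<in> W"
    and p_nonneg: "x \<in> W \<Longrightarrow> 0 \<le> p x"
    and p_add: "x \<in> W \<Longrightarrow> y \<in> W \<Longrightarrow> p (x + y) \<le> p x + p y"
    and p_scale: "x \<in> W \<Longrightarrow> p (r *\<^sub>R x) \<le> \<bar>r\<bar> * p x"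
    and T_linear: "linear T"
    and T_mem: "x \<in> W \<Longrightarrow> T x \<in> W"
    and T_le: "x \<in> W \<Longrightarrow> p (T x) \<le> p x"
begin

abbreviation A :: "nat \<Rightarrow> 'a bop \<Rightarrow> 'a bop"
  where "A \<equiv> ergodic_average T"

lemma p_zero: "p 0 = 0"
  using p_scale[OF W_zero, of 0] p_nonneg[OF W_zero] by simp

lemma W_sum: "(\<And>i. i \<in> I \<Longrightarrow> f i \<in> W) \<Longrightarrow> sum f I \<in> W"
  by (induction I rule: infinite_finite_induct) (auto simp: W_zero W_add)

lemma p_sum: "(\<And>i. i \<in> I \<Longrightarrow> f i \<in> W) \<Longrightarrow> p (sum f I) \<le> (\<Sum>i\<in>I. p (f i))"
proof (induction I rule: infinite_finite_induct)
  case (insert i I)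
  then have "p (f i + sum f I) \<le> p (f i) + p (sum f I)"
    by (intro p_add W_sum) auto
  then show ?case using insert by simp
qed (auto simp: p_zero)

lemma W_diff: "x \<in> W \<Longrightarrow> y \<in> W \<Longrightarrow> x - y \<in> W"
  using W_add[of x "(-1) *\<^sub>R y"] W_scale[of y "-1"] by simp

lemma p_diff: "x \<in> W \<Longrightarrow> y \<in> W \<Longrightarrow> p (x - y) \<le> p x + p y"
  using p_add[of x "(-1) *\<^sub>R y"] W_scale[of y "-1"] p_scale[of y "-1"] by simp

lemma T_pow: "x \<in> W \<Longrightarrow> (T ^^ k) x \<in> W \<and> p ((T ^^ k) x) \<le> p x"
  by (induction k) (auto simp: T_mem intro: order_trans[OF T_le])

lemma T_pow_linear: "linear (T ^^ k)"
proof (induction k)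
  case (Suc k)
  then show ?case
    unfolding funpow.simps by (rule linear_compose[OF _ T_linear])
qed (simp add: id_def linear_ident)

lemma A_linear: "linear (A n)"
  unfolding ergodic_average_def
  by (intro linear_compose_scale_right linear_compose_sum ballI T_pow_linear)

lemmas A_add = linear_add[OF A_linear] and A_diff = linear_diff[OF A_linear]
  and A_scale = linear_scale[OF A_linear] and A_sum = linear_sum[OF A_linear]

lemma A_mem: "x \<in> W \<Longrightarrow> A n x \<in> W"
  unfolding ergodic_average_def using T_pow by (intro W_scale W_sum) blast

lemma A_le:
  assumes x: "x \<in> W"
  shows "p (A n x) \<le> p x"
proof -
  have "p (A n x) \<le> \<bar>1 / real (n + 1)\<bar> * p (\<Sum>k=0..n. (T ^^ k) x)"
    unfolding ergodic_average_def using T_pow[OF x] by (intro p_scale W_sum) blast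
  also have "\<dots> \<le> \<bar>1 / real (n + 1)\<bar> * (\<Sum>k=0..n. p x)"
    using T_pow[OF x] by (intro mult_left_mono order_trans[OF p_sum] sum_mono) auto
  also have "\<dots> = p x" by simp
  finally show ?thesis .
qed

text \<open>The sum telescopes.\<close>

lemma A_coboundary_le:
  assumes z: "z \<in> W"
  shows "p (A n (z - T z)) \<le> 2 * p z / real (n + 1)"
proof -
  have "(T ^^ k) (z - T z) = (T ^^ k) z - (T ^^ Suc k) z" for k
    by (simp add: linear_diff[OF T_pow_linear] funpow_swap1)
  then have "(\<Sum>k=0..n. (T ^^ k) (z - T z)) = z - (T ^^ Suc n) z"
    using sum_telescope[of "\<lambda>k. (T ^^ k) z" n] by (simp add: atMost_atLeast0)
  then have "A n (z - T z) = (1 / real (n + 1)) *\<^sub>R (z - (T ^^ Suc n) z)"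
    by (simp add: ergodic_average_def)
  then have "p (A n (z - T z)) \<le> \<bar>1 / real (n + 1)\<bar> * p (z - (T ^^ Suc n) z)"
    using p_scale[OF W_diff[OF z conjunct1[OF T_pow[OF z, of "Suc n"]]], of "1 / real (n + 1)"] by simp
  also have "\<dots> \<le> \<bar>1 / real (n + 1)\<bar> * (p z + p z)"
    using T_pow[OF z, of "Suc n"] z by (intro mult_left_mono order_trans[OF p_diff] add_left_mono) auto
  finally show ?thesis by simp
qed

lemma A_pow_diff_le:
  assumes x: "x \<in> W"
  shows "p (A n (x - (T ^^ k) x)) \<le> real k * (2 * p x / real (n + 1))"
proof (induction k)
  case 0
  then show ?case by (simp add: linear_0[OF A_linear] p_zero)
next
  case (Suc k)
  define z where "z = (T ^^ k) x"
  have z: "z \<in> W" "p z \<le> p x"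
    using T_pow[OF x] by (auto simp: z_def)
  have "A n (x - (T ^^ Suc k) x) = A n (x - z) + A n (z - T z)"
    by (simp add: z_def flip: A_add)
  then have "p (A n (x - (T ^^ Suc k) x)) \<le> p (A n (x - z)) + p (A n (z - T z))"
    using z x by (simp add: p_add A_mem W_diff T_mem)
  also have "\<dots> \<le> real k * (2 * p x / real (n + 1)) + 2 * p x / real (n + 1)"
    using Suc z(2) by (intro add_mono order_trans[OF A_coboundary_le[OF z(1)]])
      (auto simp: z_def divide_right_mono)
  finally show ?case by (simp add: algebra_simps add_divide_distrib)
qed

text \<open>\<open>x - A\<^sub>m x\<close> is the mean of the coboundaries \<open>x - T\<^sup>k x\<close> for \<open>k \<le> m\<close>.\<close>

lemma A_A_diff_le:
  assumes x: "x \<in> W"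
  shows "p (A n (x - A m x)) \<le> real m * (2 * p x / real (n + 1))"
proof -
  have c: "(1 / real (m + 1)) *\<^sub>R (\<Sum>k=0..m. x) = x"
    by (simp add: sum_constant_scaleR)
  have "x - A m x = (1 / real (m + 1)) *\<^sub>R (\<Sum>k=0..m. x - (T ^^ k) x)"
    unfolding sum_subtractf scaleR_diff_right c ergodic_average_def by (rule refl)
  then have eq: "A n (x - A m x) = (1 / real (m + 1)) *\<^sub>R (\<Sum>k=0..m. A n (x - (T ^^ k) x))"
    by (simp add: A_scale A_sum)
  have mem: "A n (x - (T ^^ k) x) \<in> W" for k
    using T_pow[OF x] x by (intro A_mem W_diff) auto
  have "p (A n (x - A m x)) \<le> \<bar>1 / real (m + 1)\<bar> * p (\<Sum>k=0..m. A n (x - (T ^^ k) x))"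
    unfolding eq by (intro p_scale W_sum mem)
  also have "\<dots> \<le> \<bar>1 / real (m + 1)\<bar> * (\<Sum>k=0..m. real m * (2 * p x / real (n + 1)))"
  proof (intro mult_left_mono order_trans[OF p_sum] sum_mono mem)
    fix k assume "k \<in> {0..m}"
    then show "p (A n (x - (T ^^ k) x)) \<le> real m * (2 * p x / real (n + 1))"
      using p_nonneg[OF x] by (intro order_trans[OF A_pow_diff_le[OF x]] mult_right_mono) auto
  qed auto
  also have "\<dots> = real m * (2 * p x / real (n + 1))" by simp
  finally show ?thesis .
qed

lemma A_A_diff_small:
  assumes x: "x \<in> W" and "0 < \<epsilon>"
  obtains N where "\<And>n. N \<le> n \<Longrightarrow> p (A n (x - A m x)) < \<epsilon>"
proof -
  have "(\<lambda>n. real m * (2 * p x / real (n + 1))) \<longlonglongrightarrow> 0"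
    using tendsto_mult[OF tendsto_const[of "real m * (2 * p x)"] LIMSEQ_inverse_real_of_nat]
    by (simp add: divide_inverse mult_ac)
  then have "\<forall>\<^sub>F n in sequentially. real m * (2 * p x / real (n + 1)) < \<epsilon>"
    using \<open>0 < \<epsilon>\<close> by (rule order_tendstoD(2))
  then obtain N where "\<And>n. N \<le> n \<Longrightarrow> real m * (2 * p x / real (n + 1)) < \<epsilon>"
    by (auto simp: eventually_sequentially)
  then show thesis
    using that A_A_diff_le[OF x] by (meson le_less_trans)
qed

definition averages_Cauchy :: "'a bop \<Rightarrow> bool"
  where "averages_Cauchy x \<longleftrightarrow> (\<forall>\<epsilon>>0. \<exists>N. \<forall>m\<ge>N. \<forall>n\<ge>N. p (A m x - A n x) < \<epsilon>)"

lemma averages_Cauchy_approx: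
  assumes x: "x \<in> W" and app: "\<And>\<epsilon>. 0 < \<epsilon> \<Longrightarrow> \<exists>y\<in>W. averages_Cauchy y \<and> p (x - y) < \<epsilon>"
  shows "averages_Cauchy x"
  unfolding averages_Cauchy_def
proof (intro allI impI)
  fix \<epsilon> :: real assume "0 < \<epsilon>"
  then obtain y where y: "y \<in> W" "averages_Cauchy y" "p (x - y) < \<epsilon> / 4"
    using app[of "\<epsilon>/4"] by auto
  from y(2) \<open>0 < \<epsilon>\<close> obtain N where N: "\<And>m n. N \<le> m \<Longrightarrow> N \<le> n \<Longrightarrow> p (A m y - A n y) < \<epsilon> / 2"
    unfolding averages_Cauchy_def by (meson half_gt_zero)
  have "p (A m x - A n x) < \<epsilon>" if "N \<le> m" "N \<le> n" for m n
  proof -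
    have "A m x - A n x = (A m y - A n y) + (A m (x - y) - A n (x - y))"
      by (simp add: A_diff)
    also have "p \<dots> \<le> p (A m y - A n y) + p (A m (x - y) - A n (x - y))"
      using x y by (intro p_add W_diff A_mem)
    also have "\<dots> \<le> p (A m y - A n y) + (p (A m (x - y)) + p (A n (x - y)))"
      using x y by (intro add_left_mono p_diff W_diff A_mem)
    also have "\<dots> < \<epsilon>"
      using N[OF that] A_le[OF W_diff[OF x y(1)], of m] A_le[OF W_diff[OF x y(1)], of n] y(3) by linarith
    finally show ?thesis .
  qed
  then show "\<exists>N. \<forall>m\<ge>N. \<forall>n\<ge>N. p (A m x - A n x) < \<epsilon>" by blast
qed

lemma averages_Cauchy_zero: "averages_Cauchy 0"
  by (auto simp: averages_Cauchy_def linear_0[OF A_linear] p_zero)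

lemma averages_Cauchy_add:
  assumes "x \<in> W" "y \<in> W" "averages_Cauchy x" "averages_Cauchy y"
  shows "averages_Cauchy (x + y)"
  unfolding averages_Cauchy_def
proof (intro allI impI)
  fix \<epsilon> :: real assume "0 < \<epsilon>"
  then have "0 < \<epsilon>/2" by simp
  then obtain M N where M: "\<And>m n. M \<le> m \<Longrightarrow> M \<le> n \<Longrightarrow> p (A m x - A n x) < \<epsilon> / 2"
    and N: "\<And>m n. N \<le> m \<Longrightarrow> N \<le> n \<Longrightarrow> p (A m y - A n y) < \<epsilon> / 2"
    using assms(3,4) unfolding averages_Cauchy_def by meson
  have "p (A m (x + y) - A n (x + y)) < \<epsilon>" if "max M N \<le> m" "max M N \<le> n" for m n
  proof -
    have "A m (x + y) - A n (x + y) = (A m x - A n x) + (A m y - A n y)"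
      by (simp add: A_add)
    also have "p \<dots> \<le> p (A m x - A n x) + p (A m y - A n y)"
      using assms by (intro p_add W_diff A_mem)
    also have "\<dots> < \<epsilon>"
      using M[of m n] N[of m n] that by simp
    finally show ?thesis .
  qed
  then show "\<exists>N. \<forall>m\<ge>N. \<forall>n\<ge>N. p (A m (x + y) - A n (x + y)) < \<epsilon>" by blast
qed

lemma averages_Cauchy_scale:
  assumes x: "x \<in> W" "averages_Cauchy x"
  shows "averages_Cauchy (r *\<^sub>R x)"
  unfolding averages_Cauchy_def
proof (intro allI impI)
  fix \<epsilon> :: real assume "0 < \<epsilon>"
  define \<delta> where "\<delta> = \<epsilon> / (\<bar>r\<bar> + 1)"
  have "0 < \<delta>" using \<open>0 < \<epsilon>\<close> by (simp add: \<delta>_def add_nonneg_pos)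
  then obtain N where N: "\<And>m n. N \<le> m \<Longrightarrow> N \<le> n \<Longrightarrow> p (A m x - A n x) < \<delta>"
    using x(2) unfolding averages_Cauchy_def by meson
  have "p (A m (r *\<^sub>R x) - A n (r *\<^sub>R x)) < \<epsilon>" if "N \<le> m" "N \<le> n" for m n
  proof -
    have "A m (r *\<^sub>R x) - A n (r *\<^sub>R x) = r *\<^sub>R (A m x - A n x)"
      by (simp add: A_scale scaleR_diff_right)
    also have "p \<dots> \<le> \<bar>r\<bar> * p (A m x - A n x)"
      using x by (intro p_scale W_diff A_mem)
    also have "\<dots> \<le> \<bar>r\<bar> * \<delta>"
      using N[OF that] by (intro mult_left_mono) auto
    also have "\<dots> < (\<bar>r\<bar> + 1) * \<delta>"
      using \<open>0 < \<delta>\<close> by simp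
    also have "\<dots> = \<epsilon>"
      by (simp add: \<delta>_def add_nonneg_eq_0_iff)
    finally show ?thesis .
  qed
  then show "\<exists>N. \<forall>m\<ge>N. \<forall>n\<ge>N. p (A m (r *\<^sub>R x) - A n (r *\<^sub>R x)) < \<epsilon>" by blast
qed

lemma averages_Cauchy_sum:
  "(\<And>i. i \<in> I \<Longrightarrow> f i \<in> W) \<Longrightarrow> (\<And>i. i \<in> I \<Longrightarrow> averages_Cauchy (f i)) \<Longrightarrow> averages_Cauchy (sum f I)"
  by (induction I rule: infinite_finite_induct)
     (auto simp: averages_Cauchy_zero intro!: averages_Cauchy_add W_sum)

text \<open>Let \<open>c = inf\<^sub>n p (A\<^sub>n x)\<close>. Since \<open>A\<^sub>N A\<^sub>n x\<close> and \<open>A\<^sub>N x\<close> are close for large \<open>N\<close>, one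
  has \<open>p (A\<^sub>n x) \<longlonglongrightarrow> c\<close> and \<open>p ((A\<^sub>m x + A\<^sub>n x) / 2) \<ge> c\<close>. The parallelogram law then makes
  \<open>p (A\<^sub>m x - A\<^sub>n x)\<close> small.\<close>

theorem parallelogram_averages_Cauchy:
  assumes par: "\<And>x y. x \<in> W \<Longrightarrow> y \<in> W \<Longrightarrow> (p (x + y))\<^sup>2 + (p (x - y))\<^sup>2 = 2 * (p x)\<^sup>2 + 2 * (p y)\<^sup>2"
    and x: "x \<in> W"
  shows "averages_Cauchy x"
  unfolding averages_Cauchy_def
proof (intro allI impI)
  fix \<epsilon> :: real assume "0 < \<epsilon>"
  define c where "c = (INF n. p (A n x))"
  have bdd: "bdd_below (range (\<lambda>n. p (A n x)))"
    using p_nonneg A_mem[OF x] by (intro bdd_belowI2[where m = 0]) auto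
  have c_le: "c \<le> p (A n x)" for n
    unfolding c_def by (rule cINF_lower[OF bdd]) simp
  have c0: "0 \<le> c"
    unfolding c_def using p_nonneg A_mem[OF x] by (intro cINF_greatest) auto
  define \<delta> where "\<delta> = min 1 (\<epsilon>\<^sup>2 / (8 * c + 5))"
  have \<delta>: "0 < \<delta>" "\<delta> \<le> 1" "\<delta> * (8 * c + 4) < \<epsilon>\<^sup>2"
  proof -
    show "0 < \<delta>" "\<delta> \<le> 1"
      using \<open>0 < \<epsilon>\<close> c0 by (auto simp: \<delta>_def add_nonneg_pos)
    have "\<delta> * (8 * c + 4) < \<delta> * (8 * c + 5)"
      using \<open>0 < \<delta>\<close> by simp
    also have "\<dots> \<le> \<epsilon>\<^sup>2 / (8 * c + 5) * (8 * c + 5)"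
      using c0 by (intro mult_right_mono) (auto simp: \<delta>_def)
    also have "\<dots> = \<epsilon>\<^sup>2"
      using c0 by (simp add: add_nonneg_eq_0_iff)
    finally show "\<delta> * (8 * c + 4) < \<epsilon>\<^sup>2" .
  qed
  obtain m where m: "p (A m x) < c + \<delta>/2"
    using cINF_less_iff[OF UNIV_not_empty bdd, of "c + \<delta>/2"] \<delta>(1) by (auto simp: c_def)
  obtain N where N: "\<And>n. N \<le> n \<Longrightarrow> p (A n (x - A m x)) < \<delta>/2"
    using A_A_diff_small[OF x half_gt_zero[OF \<delta>(1)], of m] by blast
  have upper: "p (A n x) < c + \<delta>" if "N \<le> n" for n
  proof -
    have "A n x = A n (A m x) + A n (x - A m x)"
      by (simp flip: A_add)
    also have "p \<dots> \<le> p (A n (A m x)) + p (A n (x - A m x))"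
      using x by (intro p_add A_mem W_diff)
    also have "\<dots> < c + \<delta>"
      using A_le[OF A_mem[OF x], of n m] m N[OF that] by simp
    finally show ?thesis .
  qed
  have lower: "2 * c \<le> p (A k x + A l x)" for k l
  proof (rule field_le_epsilon)
    fix \<eta> :: real assume "0 < \<eta>"
    then have "0 < \<eta>/2" by simp
    obtain K where K: "\<And>n. K \<le> n \<Longrightarrow> p (A n (x - A k x)) < \<eta>/2"
      using A_A_diff_small[OF x \<open>0 < \<eta>/2\<close>, of k] by blast
    obtain L where L: "\<And>n. L \<le> n \<Longrightarrow> p (A n (x - A l x)) < \<eta>/2"
      using A_A_diff_small[OF x \<open>0 < \<eta>/2\<close>, of l] by blast
    define n where "n = max K L"
    have mem: "A k x + A l x \<in> W" "A n (x - A k x) \<in> W" "A n (x - A l x) \<in> W"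
      using x by (auto intro!: W_add W_diff A_mem)
    have half: "A n x = (1/2) *\<^sub>R (A n (A k x + A l x) + (A n (x - A k x) + A n (x - A l x)))"
      by (simp add: A_diff A_add scaleR_2[symmetric] algebra_simps)
    have "c \<le> p (A n x)" by (rule c_le)
    also have "\<dots> \<le> \<bar>1/2\<bar> * p (A n (A k x + A l x) + (A n (x - A k x) + A n (x - A l x)))"
      by (subst half) (intro p_scale W_add A_mem[OF mem(1)] mem)
    finally have "2 * c \<le> p (A n (A k x + A l x) + (A n (x - A k x) + A n (x - A l x)))"
      by simp
    also have "\<dots> \<le> p (A n (A k x + A l x)) + p (A n (x - A k x) + A n (x - A l x))"
      by (intro p_add W_add A_mem[OF mem(1)] mem)
    also have "\<dots> \<le> p (A k x + A l x) + (p (A n (x - A k x)) + p (A n (x - A l x)))"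
      by (intro add_mono A_le p_add mem)
    also have "\<dots> \<le> p (A k x + A l x) + \<eta>"
      using K[of n] L[of n] by (simp add: n_def)
    finally show "2 * c \<le> p (A k x + A l x) + \<eta>" .
  qed
  have "p (A k x - A l x) < \<epsilon>" if "N \<le> k" "N \<le> l" for k l
  proof -
    have sq: "(p (A i x))\<^sup>2 \<le> (c + \<delta>)\<^sup>2" if "N \<le> i" for i
      using upper[OF that] p_nonneg[OF A_mem[OF x]] by (intro power_mono) auto
    have "(p (A k x - A l x))\<^sup>2 = 2 * (p (A k x))\<^sup>2 + 2 * (p (A l x))\<^sup>2 - (p (A k x + A l x))\<^sup>2"
      using par[OF A_mem[OF x] A_mem[OF x], of k l] by simp
    also have "\<dots> \<le> 4 * (c + \<delta>)\<^sup>2 - (2 * c)\<^sup>2"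
      using sq[OF that(1)] sq[OF that(2)] power_mono[OF lower[of k l], of 2] c0 by simp
    also have "\<dots> = \<delta> * (8 * c + 4 * \<delta>)"
      by (simp add: power2_eq_square algebra_simps)
    also have "\<dots> \<le> \<delta> * (8 * c + 4)"
      using \<delta> by (intro mult_left_mono) auto
    also have "\<dots> < \<epsilon>\<^sup>2" by (rule \<delta>)
    finally show ?thesis
      using \<open>0 < \<epsilon>\<close> by (simp add: power2_less_imp_less)
  qed
  then show "\<exists>N. \<forall>m\<ge>N. \<forall>n\<ge>N. p (A m x - A n x) < \<epsilon>" by blast
qed

end

context fully_symmetric_space
begin

context
  assumes inf: "infinite_dimensional TYPE('a::complex_hilbert)"
begin

subsection \<open>The normed ideal of a sequence space\<close>

abbreviation N\<^sub>E :: "'a bop \<Rightarrow> real"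
  where "N\<^sub>E \<equiv> op_ideal_norm norm_E"

lemma op_ideal_compact: "x \<in> (op_ideal E :: 'a bop set) \<Longrightarrow> compact_bop x"
  by (simp add: op_ideal_def)

text \<open>Membership in the ideal and bounds for its norm are always obtained from Ky Fan bounds by the
  partial sums of a non-increasing element of \<open>E\<close>.\<close>

lemma op_ideal_kyfan:
  fixes x :: "'a bop"
  assumes x: "compact_bop x" and t: "decseq t" "\<And>n. 0 \<le> t n" "embed t \<in> E"
    and le: "\<And>k. kyfan_le k x (\<Sum>n<k. t n)"
  shows "x \<in> op_ideal E" "N\<^sub>E x \<le> norm_E (embed t)"
  using dominated_decreasing[OF singular_values_props(1,2)[OF inf x] t] le x
  by (simp_all add: op_ideal_def op_ideal_norm_def kyfan_le_iff[OF inf x])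

lemma op_ideal_add:
  fixes x :: "'a bop"
  assumes "x \<in> op_ideal E" "y \<in> op_ideal E"
  shows "x + y \<in> op_ideal E" "N\<^sub>E (x + y) \<le> N\<^sub>E x + N\<^sub>E y"
proof -
  note c = op_ideal_compact[OF assms(1)] op_ideal_compact[OF assms(2)]
  note sx = singular_values_props[OF inf c(1)] and sy = singular_values_props[OF inf c(2)]
  define t where "t n = singular_values x n + singular_values y n" for n
  have et: "embed t = (\<lambda>n. embed (singular_values x) n + embed (singular_values y) n)"
    by (simp add: t_def)
  have mem: "embed (singular_values x) \<in> E" "embed (singular_values y) \<in> E"
    using assms by (auto simp: op_ideal_def)
  have "embed t \<in> E"
    unfolding et by (intro add_mem mem)
  moreover have "decseq t" "\<And>n. 0 \<le> t n"
    using sx sy by (auto simp: t_def decseq_def intro!: add_mono)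
  moreover have "kyfan_le k (x + y) (\<Sum>n<k. t n)" for k
    unfolding t_def sum.distrib
    by (intro kyfan_le_add) (simp_all add: kyfan_le_iff[OF inf] c)
  ultimately have "x + y \<in> op_ideal E" "N\<^sub>E (x + y) \<le> norm_E (embed t)"
    using op_ideal_kyfan[OF compact_bop_add[OF c]] by blast+
  moreover have "norm_E (embed t) \<le> N\<^sub>E x + N\<^sub>E y"
    unfolding et op_ideal_norm_def by (intro norm_triangle mem)
  ultimately show "x + y \<in> op_ideal E" "N\<^sub>E (x + y) \<le> N\<^sub>E x + N\<^sub>E y"
    by auto
qed

lemma op_ideal_scaleR:
  fixes x :: "'a bop"
  assumes "x \<in> op_ideal E"
  shows "r *\<^sub>R x \<in> op_ideal E" "N\<^sub>E (r *\<^sub>R x) \<le> \<bar>r\<bar> * N\<^sub>E x"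
proof -
  note c = op_ideal_compact[OF assms]
  note sx = singular_values_props[OF inf c]
  define t where "t n = \<bar>r\<bar> * singular_values x n" for n
  have et: "embed t = (\<lambda>n. complex_of_real \<bar>r\<bar> * embed (singular_values x) n)"
    by (simp add: t_def)
  have mem: "embed (singular_values x) \<in> E"
    using assms by (auto simp: op_ideal_def)
  have "embed t \<in> E"
    unfolding et by (intro scale_mem mem)
  moreover have "decseq t" "\<And>n. 0 \<le> t n"
    using sx by (auto simp: t_def decseq_def intro!: mult_left_mono)
  moreover have "kyfan_le k (r *\<^sub>R x) (\<Sum>n<k. t n)" for k
    unfolding t_def sum_distrib_left[symmetric]
    by (intro kyfan_le_scaleR) (simp add: kyfan_le_iff[OF inf] c)
  ultimately have "r *\<^sub>R x \<in> op_ideal E" "N\<^sub>E (r *\<^sub>R x) \<le> norm_E (embed t)"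
    using op_ideal_kyfan[OF compact_bop_scaleR[OF c]] by blast+
  moreover have "norm_E (embed t) = \<bar>r\<bar> * N\<^sub>E x"
    unfolding et op_ideal_norm_def by (subst norm_scale[OF mem]) simp
  ultimately show "r *\<^sub>R x \<in> op_ideal E" "N\<^sub>E (r *\<^sub>R x) \<le> \<bar>r\<bar> * N\<^sub>E x"
    by auto
qed

lemma op_ideal_zero: "0 \<in> (op_ideal E :: 'a bop set)"
proof -
  have "kyfan_le k (0 :: 'a bop) (\<Sum>n<k. 0)" for k
    using kyfan_le_zero by simp
  then show ?thesis
    using op_ideal_kyfan(1)[OF compact_bop_zero, of "\<lambda>_. 0"] zero_mem by (auto simp: decseq_def)
qed

lemma op_ideal_norm_nonneg: "x \<in> (op_ideal E :: 'a bop set) \<Longrightarrow> 0 \<le> N\<^sub>E x"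
  unfolding op_ideal_def op_ideal_norm_def by (auto intro: norm_nonneg)

lemma norm_le_op_ideal_norm:
  fixes x :: "'a bop"
  assumes "x \<in> op_ideal E"
  shows "norm x \<le> N\<^sub>E x / \<phi> 1"
proof -
  have mem: "embed (singular_values x) \<in> E"
    using assms by (auto simp: op_ideal_def)
  show ?thesis
    using coordinate_le[OF mem, of 0] \<phi>_1_pos singular_values_0[OF inf op_ideal_compact[OF assms]]
    by (simp add: op_ideal_norm_def field_simps)
qed

lemma rank_one_op_ideal:
  fixes e f :: 'a
  assumes "norm e \<le> 1" "norm f \<le> 1"
  shows "rank_one f e \<in> op_ideal E"
proof (rule op_ideal_kyfan(1)[OF compact_rank_one block_facts[of 1] block_mem[of 1]])
  fix k
  show "kyfan_le k (rank_one f e) (\<Sum>n<k. block 1 n)"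
  proof (cases k)
    case 0
    then show ?thesis by (simp add: kyfan_le_def)
  next
    case (Suc j)
    then have "(\<Sum>n<k. block 1 n) = 1"
      unfolding sum_block by simp
    then show ?thesis
      using kyfan_le_rank_one[OF assms] by simp
  qed
qed

lemma dunford_schwartz_op_ideal:
  fixes T :: "'a bop \<Rightarrow> 'a bop"
  assumes T: "dunford_schwartz T" and x: "x \<in> op_ideal E"
  shows "T x \<in> op_ideal E" "N\<^sub>E (T x) \<le> N\<^sub>E x"
proof -
  note c = op_ideal_compact[OF x]
  have "embed (singular_values x) \<in> E"
    using x by (auto simp: op_ideal_def)
  moreover have "kyfan_le k (T x) (\<Sum>n<k. singular_values x n)" for k
    using dunford_schwartz_singular_values[OF inf T c]
    by (simp add: kyfan_le_iff[OF inf dunford_schwartz_compact[OF inf T c]])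
  ultimately show "T x \<in> op_ideal E" "N\<^sub>E (T x) \<le> N\<^sub>E x"
    using op_ideal_kyfan[OF dunford_schwartz_compact[OF inf T c] singular_values_props(1,2)[OF inf c]]
    by (auto simp: op_ideal_norm_def)
qed

lemma dunford_schwartz_contraction_on_ideal:
  fixes T :: "'a bop \<Rightarrow> 'a bop"
  assumes T: "dunford_schwartz T"
  shows "contraction_on (op_ideal E) N\<^sub>E T"
  by (rule contraction_on.intro)
    (auto intro: op_ideal_zero op_ideal_add op_ideal_scaleR op_ideal_norm_nonneg
      dunford_schwartz_linear[OF T] dunford_schwartz_op_ideal[OF T])

lemma dunford_schwartz_contraction_on_hs:
  fixes T :: "'a bop \<Rightarrow> 'a bop"
  assumes T: "dunford_schwartz T"
  shows "contraction_on hilbert_schmidt hs_norm T"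
proof (rule contraction_on.intro)
  show "0 \<in> (hilbert_schmidt :: 'a bop set)"
    by (simp add: hilbert_schmidt_def hs_sq_def bop_ops compact_bop_zero)
qed (auto intro: hilbert_schmidt_add hilbert_schmidt_scaleR hs_norm_nonneg
    hs_norm_add_le eq_refl[OF hs_norm_scaleR] dunford_schwartz_linear[OF T]
    dunford_schwartz_hs[OF inf T])

lemma dunford_schwartz_contraction_on_kyfan:
  fixes T :: "'a bop \<Rightarrow> 'a bop"
  assumes T: "dunford_schwartz T"
  shows "contraction_on {x. compact_bop x} (\<lambda>x. \<Sum>i<k. singular_values x i) T"
  by (rule contraction_on.intro)
    (auto intro: compact_bop_zero compact_bop_add compact_bop_scaleR sum_nonneg
      singular_values_props[OF inf] singular_values_add_sum[OF inf] singular_values_scaleR_sum[OF inf]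
      dunford_schwartz_linear[OF T] dunford_schwartz_compact[OF inf T]
      dunford_schwartz_singular_values[OF inf T])

text \<open>Singular values of a norm convergent series are submajorized by the sum of the singular
  value sequences, which converges in the sequence space when the norms are summable. So
  completeness of the ideal is inherited from the sequence space.\<close>

lemma op_ideal_series:
  fixes d :: "nat \<Rightarrow> 'a bop"
  assumes d: "\<And>j. d j \<in> op_ideal E" and sm: "summable (\<lambda>j. N\<^sub>E (d j))"
    and lim: "(\<lambda>L. \<Sum>j<L. d j) \<longlonglongrightarrow> z"
  shows "z \<in> op_ideal E" "N\<^sub>E z \<le> (\<Sum>j. N\<^sub>E (d j))"
proof -
  define s where "s j = singular_values (d j)" for j
  note c = op_ideal_compact[OF d]
  note sp = singular_values_props[OF inf c, folded s_def]
  have mem: "embed (s j) \<in> E" for j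
    using d[of j] by (simp add: op_ideal_def s_def)
  have Ns: "N\<^sub>E (d j) = norm_E (embed (s j))" for j
    by (simp add: op_ideal_norm_def s_def)
  obtain \<xi> where \<xi>: "\<xi> \<in> E" "\<And>n. (\<lambda>J. \<Sum>j<J. embed (s j) n) \<longlonglongrightarrow> \<xi> n"
      "norm_E \<xi> \<le> (\<Sum>j. norm_E (embed (s j)))"
    by (rule summable_series[OF mem sm[unfolded Ns]], rule that)
  define t where "t n = Re (\<xi> n)" for n
  have lim_t: "(\<lambda>J. \<Sum>j<J. s j n) \<longlonglongrightarrow> t n" for n
    using tendsto_Re[OF \<xi>(2)[of n]] by (simp add: t_def)
  have "(\<lambda>J. \<Sum>j<J. embed (s j) n) \<longlonglongrightarrow> complex_of_real (t n)" for n
    using tendsto_of_real[OF lim_t[of n]] by simp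
  then have \<xi>_eq: "\<xi> = embed t"
    using LIMSEQ_unique[OF \<xi>(2)] by auto
  have t0: "0 \<le> t n" for n
    using lim_t[of n] sp(2) by (intro LIMSEQ_le_const[OF lim_t]) (auto intro: sum_nonneg)
  have tdec: "decseq t"
    unfolding decseq_def
  proof (intro allI impI)
    fix m n :: nat assume "m \<le> n"
    then show "t n \<le> t m"
      using sp(1) by (intro LIMSEQ_le[OF lim_t lim_t]) (auto simp: decseq_def intro!: sum_mono)
  qed
  have "compact_bop z"
    by (rule compact_bop_limit[OF _ lim]) (intro compact_bop_sum c)
  moreover have "kyfan_le k z (\<Sum>n<k. t n)" for k
  proof (rule kyfan_le_limit[OF lim])
    show "(\<lambda>L. \<Sum>n<k. \<Sum>j<L. s j n) \<longlonglongrightarrow> (\<Sum>n<k. t n)"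
      by (intro tendsto_sum lim_t)
    show "kyfan_le k (\<Sum>j<L. d j) (\<Sum>n<k. \<Sum>j<L. s j n)" for L
      unfolding sum.swap[of _ _ "{..<k}"] s_def
      by (intro kyfan_le_sum) (simp add: kyfan_le_iff[OF inf c])
  qed
  ultimately show "z \<in> op_ideal E" "N\<^sub>E z \<le> (\<Sum>j. N\<^sub>E (d j))"
    using op_ideal_kyfan[OF _ tdec t0] \<xi>(1,3) unfolding \<xi>_eq Ns by (auto intro: order_trans)
qed

text \<open>A Cauchy sequence converges in operator norm; a rapidly Cauchy subsequence turns the remainders
  into absolutely convergent series.\<close>

lemma op_ideal_complete:
  fixes X :: "nat \<Rightarrow> 'a bop"
  assumes X: "\<And>n. X n \<in> op_ideal E"
    and cauchy: "\<And>\<epsilon>. 0 < \<epsilon> \<Longrightarrow> \<exists>K. \<forall>m\<ge>K. \<forall>n\<ge>K. N\<^sub>E (X m - X n) < \<epsilon>"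
  shows "\<exists>y\<in>op_ideal E. (\<lambda>n. N\<^sub>E (X n - y)) \<longlonglongrightarrow> 0"
proof -
  have diff: "x - y \<in> op_ideal E" "N\<^sub>E (x - y) = N\<^sub>E (y - x)" if "x \<in> op_ideal E" "y \<in> op_ideal E"
    for x y :: "'a bop"
  proof -
    have *: "x - y \<in> op_ideal E" if "x \<in> op_ideal E" "y \<in> op_ideal E" for x y :: "'a bop"
      using op_ideal_add(1)[OF that(1) op_ideal_scaleR(1)[OF that(2), of "-1"]] by simp
    show "x - y \<in> op_ideal E" using that by (rule *)
    show "N\<^sub>E (x - y) = N\<^sub>E (y - x)"
      using op_ideal_scaleR(2)[OF *[OF that], of "-1"] op_ideal_scaleR(2)[OF *[OF that(2,1)], of "-1"] by simp
  qed
  have "Cauchy X"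
  proof (rule metric_CauchyI)
    fix \<epsilon> :: real assume "0 < \<epsilon>"
    then have "0 < \<epsilon> * \<phi> 1" using \<phi>_1_pos by simp
    then obtain K where K: "\<And>m n. K \<le> m \<Longrightarrow> K \<le> n \<Longrightarrow> N\<^sub>E (X m - X n) < \<epsilon> * \<phi> 1"
      using cauchy by meson
    have "dist (X m) (X n) < \<epsilon>" if "K \<le> m" "K \<le> n" for m n
    proof -
      have "norm (X m - X n) \<le> N\<^sub>E (X m - X n) / \<phi> 1"
        by (intro norm_le_op_ideal_norm diff X)
      also have "\<dots> < \<epsilon>"
        using K[OF that] \<phi>_1_pos by (simp add: field_simps)
      finally show ?thesis by (simp add: dist_norm)
    qed
    then show "\<exists>M. \<forall>m\<ge>M. \<forall>n\<ge>M. dist (X m) (X n) < \<epsilon>" by blast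
  qed
  then obtain y where y: "X \<longlonglongrightarrow> y"
    using convergent_eq_Cauchy by blast
  have "\<exists>K. \<forall>m\<ge>K. \<forall>n\<ge>K. N\<^sub>E (X m - X n) < (1/2)^j" for j :: nat
    by (rule cauchy) simp
  then obtain K where K: "\<And>j m n. K j \<le> m \<Longrightarrow> K j \<le> n \<Longrightarrow> N\<^sub>E (X m - X n) < (1/2)^j"
    by metis
  define r where "r j = (\<Sum>i\<le>j. K i) + j" for j
  have K_le: "K j \<le> r j" for j
    unfolding r_def by (intro trans_le_add1 member_le_sum) auto
  have r_less: "r j < r (Suc j)" for j
    by (simp add: r_def)
  then have r: "strict_mono r"
    by (simp add: strict_mono_Suc_iff)
  have tail: "y - X (r J) \<in> op_ideal E \<and> N\<^sub>E (y - X (r J)) \<le> 2 * (1/2)^J" for J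
  proof -
    define d where "d j = X (r (Suc (J + j))) - X (r (J + j))" for j
    have d: "d j \<in> op_ideal E" for j
      unfolding d_def by (intro diff X)
    have nd: "N\<^sub>E (d j) \<le> (1/2)^J * (1/2)^j" for j
      unfolding d_def power_add[symmetric]
      using K_le[of "J + j"] r_less[of "J + j"] by (intro less_imp_le[OF K]) auto
    have sg: "(\<lambda>j. (1/2)^J * (1/2)^j) sums ((1/2)^J * 2 :: real)"
      using sums_mult[OF geometric_sums[of "1/2::real"], of "(1/2)^J"] by simp
    have sm: "summable (\<lambda>j. N\<^sub>E (d j))"
      by (rule summable_comparison_test'[OF sums_summable[OF sg], of 0])
         (use nd op_ideal_norm_nonneg[OF d] in auto)
    have "(\<Sum>j<L. d j) = X (r (J + L)) - X (r J)" for L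
      unfolding d_def using sum_lessThan_telescope[of "\<lambda>j. X (r (J + j))" L] by simp
    moreover have "(\<lambda>L. X (r (J + L))) \<longlonglongrightarrow> y"
      using LIMSEQ_ignore_initial_segment[OF LIMSEQ_subseq_LIMSEQ[OF y r], of J]
      by (simp add: o_def add.commute)
    ultimately have "(\<lambda>L. \<Sum>j<L. d j) \<longlonglongrightarrow> y - X (r J)"
      by (simp add: tendsto_diff)
    from op_ideal_series[OF d sm this]
    have "y - X (r J) \<in> op_ideal E" "N\<^sub>E (y - X (r J)) \<le> (\<Sum>j. N\<^sub>E (d j))"
      by auto
    moreover have "(\<Sum>j. N\<^sub>E (d j)) \<le> (1/2)^J * 2"
      using suminf_le[OF nd sm sums_summable[OF sg]] sums_unique[OF sg] by simp
    ultimately show ?thesis by simp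
  qed
  have yE: "y \<in> op_ideal E"
    using op_ideal_add(1)[OF conjunct1[OF tail[of 0]] X[of "r 0"]] by simp
  have "(\<lambda>n. N\<^sub>E (X n - y)) \<longlonglongrightarrow> 0"
  proof (rule LIMSEQ_I)
    fix \<epsilon> :: real assume "0 < \<epsilon>"
    then obtain J :: nat where J: "(1/2)^J < \<epsilon> / 3"
      using real_arch_pow_inv[of "\<epsilon>/3" "1/2"] by auto
    have "norm (N\<^sub>E (X n - y) - 0) < \<epsilon>" if n: "r J \<le> n" for n
    proof -
      have "N\<^sub>E ((X n - X (r J)) + (X (r J) - y)) \<le> N\<^sub>E (X n - X (r J)) + N\<^sub>E (X (r J) - y)"
        by (intro op_ideal_add diff X yE)
      moreover have "N\<^sub>E (X n - X (r J)) < (1/2)^J"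
        using n K_le[of J] by (intro K) auto
      moreover have "N\<^sub>E (X (r J) - y) \<le> 2 * (1/2)^J"
        using tail[of J] diff(2)[OF X yE, of "r J"] by simp
      ultimately show ?thesis
        using J op_ideal_norm_nonneg[OF diff(1)[OF X yE], of n] by simp
    qed
    then show "\<exists>no. \<forall>n\<ge>no. norm (N\<^sub>E (X n - y) - 0) < \<epsilon>" by blast
  qed
  then show ?thesis using yE by blast
qed

subsection \<open>Sufficiency: convergence of the averages\<close>

text \<open>On rank one operators the averages are Cauchy for the Hilbert-Schmidt norm, hence for the
  operator norm, and they are bounded in trace norm. When \<open>\<phi> n / n \<longlonglongrightarrow> 0\<close> this makes
  them Cauchy in the ideal.\<close>

lemma rank_one_averages_Cauchy:
  fixes T :: "'a bop \<Rightarrow> 'a bop" and e f :: 'a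
  assumes T: "dunford_schwartz T" and ratio: "(\<lambda>n. \<phi> n / real n) \<longlonglongrightarrow> 0"
    and ef: "norm e \<le> 1" "norm f \<le> 1"
  shows "contraction_on.averages_Cauchy N\<^sub>E T (rank_one f e)"
proof -
  define x where "x = rank_one f e"
  define A where "A = ergodic_average T"
  interpret E: contraction_on "op_ideal E" N\<^sub>E T
    by (rule dunford_schwartz_contraction_on_ideal[OF T])
  interpret H: contraction_on hilbert_schmidt hs_norm T
    by (rule dunford_schwartz_contraction_on_hs[OF T])
  have xE: "x \<in> op_ideal E" and xH: "x \<in> hilbert_schmidt" and xc: "compact_bop x"
    unfolding x_def using ef by (auto intro: rank_one_op_ideal rank_one_hilbert_schmidt[OF inf] compact_rank_one)
  have HC: "H.averages_Cauchy x"
    using hs_norm_parallelogram xH by (rule H.parallelogram_averages_Cauchy)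
  have AE: "A m x - A n x \<in> op_ideal E" for m n
    unfolding A_def by (intro E.W_diff E.A_mem xE)
  have trace: "(\<Sum>i<k. singular_values (A m x - A n x) i) \<le> 2" for m n k
  proof -
    interpret K: contraction_on "{x::'a bop. compact_bop x}" "\<lambda>x. \<Sum>i<k. singular_values x i" T
      by (rule dunford_schwartz_contraction_on_kyfan[OF T])
    have one: "(\<Sum>i<k. singular_values x i) \<le> 1"
      using kyfan_le_rank_one[OF ef, of k] by (simp add: x_def kyfan_le_iff[OF inf compact_rank_one])
    have "(\<Sum>i<k. singular_values (A m x - A n x) i)
        \<le> (\<Sum>i<k. singular_values (A m x) i) + (\<Sum>i<k. singular_values (A n x) i)"
      unfolding A_def using xc K.A_mem by (intro K.p_diff) auto
    also have "\<dots> \<le> (\<Sum>i<k. singular_values x i) + (\<Sum>i<k. singular_values x i)"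
      unfolding A_def using xc by (intro add_mono K.A_le) auto
    finally show ?thesis using one by simp
  qed
  have "E.averages_Cauchy x"
    unfolding E.averages_Cauchy_def
  proof (intro allI impI)
    fix \<eta> :: real assume "0 < \<eta>"
    have "\<exists>\<epsilon>>0. \<forall>s. decseq s \<and> (\<forall>n. 0 \<le> s n) \<and> s 0 \<le> \<epsilon> \<and> (\<forall>m. (\<Sum>n<m. s n) \<le> 2) \<longrightarrow>
        embed s \<in> E \<and> norm_E (embed s) < \<eta>"
      using \<open>0 < \<eta>\<close> by (intro small_trace_norm_bounded ratio) auto
    then obtain \<epsilon> where \<epsilon>: "0 < \<epsilon>" "\<And>s. decseq s \<and> (\<forall>n. 0 \<le> s n) \<and> s 0 \<le> \<epsilon> \<and>
        (\<forall>m. (\<Sum>n<m. s n) \<le> 2) \<Longrightarrow> embed s \<in> E \<and> norm_E (embed s) < \<eta>"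
      by meson
    obtain N where N: "\<And>m n. N \<le> m \<Longrightarrow> N \<le> n \<Longrightarrow> hs_norm (A m x - A n x) < \<epsilon>"
      using HC \<epsilon>(1) unfolding H.averages_Cauchy_def A_def by meson
    have "N\<^sub>E (A m x - A n x) < \<eta>" if "N \<le> m" "N \<le> n" for m n
    proof -
      define z where "z = A m x - A n x"
      have c: "compact_bop z"
        using op_ideal_compact[OF AE] by (simp add: z_def)
      have "z \<in> hilbert_schmidt"
        unfolding z_def A_def by (intro H.W_diff H.A_mem xH)
      then have "norm z \<le> hs_norm z"
        by (rule norm_le_hs_norm[OF inf])
      then have "singular_values z 0 \<le> \<epsilon>"
        unfolding singular_values_0[OF inf c] using N[OF that] by (simp add: z_def)
      then have "norm_E (embed (singular_values z)) < \<eta>"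
        using \<epsilon>(2)[of "singular_values z"] singular_values_props(1,2)[OF inf c] trace by (simp add: z_def)
      then show ?thesis
        by (simp add: op_ideal_norm_def z_def)
    qed
    then show "\<exists>N. \<forall>m\<ge>N. \<forall>n\<ge>N. N\<^sub>E (ergodic_average T m x - ergodic_average T n x) < \<eta>"
      unfolding A_def by blast
  qed
  then show ?thesis by (simp add: x_def)
qed

text \<open>The tails of the singular value decomposition tend to 0 in the ideal because shifts of the
  singular value sequence do, so the rank one case extends to all of the ideal.\<close>

theorem averages_converge:
  fixes T :: "'a bop \<Rightarrow> 'a bop"
  assumes sep: "separable_seq_space E norm_E" and "E \<noteq> l1"
    and T: "dunford_schwartz T" and x: "x \<in> op_ideal E"
  shows "\<exists>y\<in>op_ideal E. (\<lambda>n. N\<^sub>E (ergodic_average T n x - y)) \<longlonglongrightarrow> 0"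
proof -
  interpret E: contraction_on "op_ideal E" N\<^sub>E T
    by (rule dunford_schwartz_contraction_on_ideal[OF T])
  have ratio: "(\<lambda>n. \<phi> n / real n) \<longlonglongrightarrow> 0"
    using \<open>E \<noteq> l1\<close> by (rule \<phi>_ratio_tendsto_0)
  define s where "s = singular_values x"
  note c = op_ideal_compact[OF x]
  note sp = singular_values_props[OF inf c, folded s_def]
  have mem: "embed s \<in> E"
    using x by (simp add: op_ideal_def s_def)
  obtain e f where svd: "svd x s e f"
    using compact_svd[OF inf c] unfolding s_def by blast
  note ef = eq_refl[OF svd_facts(8)[OF svd]] svd_facts(9)[OF svd]
  have head: "svd_head s e f N \<in> op_ideal E" "E.averages_Cauchy (svd_head s e f N)" for N
    unfolding svd_head_def
    by (intro E.W_sum E.W_scale rank_one_op_ideal ef,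
        intro E.averages_Cauchy_sum E.averages_Cauchy_scale rank_one_averages_Cauchy[OF T ratio]
          E.W_scale rank_one_op_ideal ef)
  have tail: "N\<^sub>E (x - svd_head s e f N) \<le> norm_E (embed (\<lambda>k. s (k + N)))" for N
  proof (rule op_ideal_kyfan(2))
    show "compact_bop (x - svd_head s e f N)"
      by (intro compact_bop_diff c compact_svd_head)
    show "decseq (\<lambda>k. s (k + N))"
      using sp(1) by (auto simp: decseq_def)
    show "embed (\<lambda>k. s (k + N)) \<in> E"
      by (rule shift_le_tail(1)[OF sp(1,2) mem])
    show "kyfan_le k (x - svd_head s e f N) (\<Sum>n<k. s (n + N))" for k
      using svd_tail_kyfan[OF svd, of k N] by (simp add: add.commute)
  qed (rule sp(2))
  have "E.averages_Cauchy x"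
  proof (rule E.averages_Cauchy_approx[OF x])
    fix \<epsilon> :: real assume "0 < \<epsilon>"
    have "\<forall>\<^sub>F N in sequentially. norm_E (embed (\<lambda>k. s (k + N))) < \<epsilon>"
      using separable_imp_shift_tendsto_0[OF sep sp(1,2) mem] \<open>0 < \<epsilon>\<close> by (rule order_tendstoD(2))
    then obtain N where "norm_E (embed (\<lambda>k. s (k + N))) < \<epsilon>"
      by (auto simp: eventually_sequentially)
    then show "\<exists>y\<in>op_ideal E. E.averages_Cauchy y \<and> N\<^sub>E (x - y) < \<epsilon>"
      using head tail[of N] by (intro bexI[of _ "svd_head s e f N"]) auto
  qed
  then show ?thesis
    unfolding E.averages_Cauchy_def by (intro op_ideal_complete E.A_mem x) blast
qed

end

end

subsection \<open>Necessity: a shift on an orthonormal sequence\<close>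

text \<open>Operators given by bounded coefficients with respect to two orthonormal sequences. The
  series converges strongly, not in norm.\<close>

lemma orthonormal_series_operator:
  fixes e g :: "nat \<Rightarrow> 'a::complex_hilbert" and c :: "nat \<Rightarrow> complex"
  assumes e: "orthonormal_on UNIV e" and g: "orthonormal_on UNIV g"
    and K: "\<And>n. cmod (c n) \<le> K"
  obtains x where "norm x \<le> K"
    "\<And>v. (\<lambda>N. \<Sum>n<N. (c n * cinner v (e n)) *\<^sub>C g n) \<longlonglongrightarrow> bop_apply x v"
proof -
  have K0: "0 \<le> K"
    using K[of 0] norm_ge_zero order_trans by blast
  note eS = suborthonormal_on_subset[OF orthonormal_imp_suborthonormal[OF e] subset_UNIV]
  note gS = suborthonormal_on_subset[OF orthonormal_imp_suborthonormal[OF g] subset_UNIV]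
  define t where "t v n = (c n * cinner v (e n)) *\<^sub>C g n" for v n
  have block: "(norm (\<Sum>n\<in>I. t v n))\<^sup>2 \<le> K\<^sup>2 * (\<Sum>n\<in>I. (cmod (cinner v (e n)))\<^sup>2)"
    if "finite I" for I v
  proof -
    have "(norm (\<Sum>n\<in>I. t v n))\<^sup>2 \<le> (\<Sum>n\<in>I. (cmod (c n * cinner v (e n)))\<^sup>2)"
      unfolding t_def by (rule norm_sum_suborthonormal_le[OF that gS])
    also have "\<dots> \<le> (\<Sum>n\<in>I. K\<^sup>2 * (cmod (cinner v (e n)))\<^sup>2)"
      unfolding norm_mult power_mult_distrib using K by (intro sum_mono mult_right_mono power_mono) auto
    finally show ?thesis by (simp add: sum_distrib_left)
  qed
  have partial: "norm (\<Sum>n<N. t v n) \<le> K * norm v" for N v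
  proof (rule power2_le_imp_le)
    have "(norm (\<Sum>n<N. t v n))\<^sup>2 \<le> K\<^sup>2 * (\<Sum>n<N. (cmod (cinner v (e n)))\<^sup>2)"
      by (rule block) simp
    also have "\<dots> \<le> K\<^sup>2 * (norm v)\<^sup>2"
      by (intro mult_left_mono Bessel eS) auto
    finally show "(norm (\<Sum>n<N. t v n))\<^sup>2 \<le> (K * norm v)\<^sup>2"
      by (simp add: power_mult_distrib)
  qed (use K0 in simp)
  have "summable (t v)" for v
    unfolding summable_Cauchy
  proof (intro allI impI)
    fix \<epsilon> :: real assume "0 < \<epsilon>"
    have "summable (\<lambda>n. (cmod (cinner v (e n)))\<^sup>2)"
      by (rule summableI_nonneg_bounded[of _ "(norm v)\<^sup>2"]) (auto intro: Bessel eS)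
    moreover have "0 < (\<epsilon> / (K + 1))\<^sup>2"
      using \<open>0 < \<epsilon>\<close> K0 by simp
    ultimately obtain N where N: "\<And>m n. N \<le> m \<Longrightarrow>
        norm (\<Sum>i=m..<n. (cmod (cinner v (e i)))\<^sup>2) < (\<epsilon> / (K + 1))\<^sup>2"
      unfolding summable_Cauchy by meson
    have "norm (\<Sum>i=m..<n. t v i) < \<epsilon>" if "N \<le> m" for m n
    proof -
      have "(norm (\<Sum>i=m..<n. t v i))\<^sup>2 \<le> K\<^sup>2 * (\<Sum>i=m..<n. (cmod (cinner v (e i)))\<^sup>2)"
        by (rule block) simp
      also have "\<dots> \<le> (K + 1)\<^sup>2 * (\<Sum>i=m..<n. (cmod (cinner v (e i)))\<^sup>2)"
        using K0 by (intro mult_right_mono power_mono sum_nonneg) auto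
      also have "\<dots> < (K + 1)\<^sup>2 * (\<epsilon> / (K + 1))\<^sup>2"
        using N[OF that, of n] K0 by (intro mult_strict_left_mono) (auto simp: sum_nonneg)
      also have "\<dots> = \<epsilon>\<^sup>2"
        using K0 by (simp add: power_divide)
      finally show ?thesis
        using \<open>0 < \<epsilon>\<close> by (simp add: power2_less_imp_less)
    qed
    then show "\<exists>N. \<forall>m\<ge>N. \<forall>n. norm (sum (t v) {m..<n}) < \<epsilon>" by blast
  qed
  then have lim: "(\<lambda>N. \<Sum>n<N. t v n) \<longlonglongrightarrow> suminf (t v)" for v
    by (rule summable_LIMSEQ)
  define f where "f v = suminf (t v)" for v
  note lim = lim[folded f_def]
  have "f (u + v) = f u + f v" for u v
  proof (rule LIMSEQ_unique[OF lim])
    have "(\<Sum>n<N. t (u + v) n) = (\<Sum>n<N. t u n) + (\<Sum>n<N. t v n)" for N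
      by (simp add: t_def cinner_linear distrib_left scaleC_add_left sum.distrib)
    then show "(\<lambda>N. \<Sum>n<N. t (u + v) n) \<longlonglongrightarrow> f u + f v"
      using tendsto_add[OF lim lim] by simp
  qed
  moreover have "f (d *\<^sub>C v) = d *\<^sub>C f v" for d v
  proof (rule LIMSEQ_unique[OF lim])
    have "(\<Sum>n<N. t (d *\<^sub>C v) n) = d *\<^sub>C (\<Sum>n<N. t v n)" for N
      by (simp add: t_def cinner_linear complex_vector.scale_sum_right scaleC_scaleC mult_ac)
    then show "(\<lambda>N. \<Sum>n<N. t (d *\<^sub>C v) n) \<longlonglongrightarrow> d *\<^sub>C f v"
      using bounded_linear.tendsto[OF bounded_linear_scaleC lim[of v], of d] by simp
  qed
  ultimately have "clinear f"
    by (simp add: clinear_iff)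
  moreover have fle: "norm (f v) \<le> K * norm v" for v
    using partial by (intro Lim_bounded[OF tendsto_norm[OF lim], of 0]) auto
  ultimately obtain x where x: "bop_apply x = f"
    using ex_bop by blast
  show thesis
  proof (rule that)
    show "norm x \<le> K"
      using K0 fle by (intro norm_bop_le) (auto simp: x)
    show "(\<lambda>N. \<Sum>n<N. (c n * cinner v (e n)) *\<^sub>C g n) \<longlonglongrightarrow> bop_apply x v" for v
      using lim[of v] by (simp add: x t_def)
  qed
qed

text \<open>Only one term of the series is different from 0.\<close>

lemma orthonormal_series_eval:
  fixes e g :: "nat \<Rightarrow> 'a::complex_hilbert"
  assumes lim: "(\<lambda>N. \<Sum>n<N. (c n * cinner v (e n)) *\<^sub>C g n) \<longlonglongrightarrow> w"
    and other: "\<And>n. n \<noteq> m \<Longrightarrow> cinner v (e n) = 0"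
  shows "w = (c m * cinner v (e m)) *\<^sub>C g m"
proof (rule LIMSEQ_unique[OF lim tendsto_eventually])
  show "\<forall>\<^sub>F N in sequentially. (\<Sum>n<N. (c n * cinner v (e n)) *\<^sub>C g n) = (c m * cinner v (e m)) *\<^sub>C g m"
    using eventually_gt_at_top[of m]
  proof eventually_elim
    case (elim N)
    have "(\<Sum>n<N. (c n * cinner v (e n)) *\<^sub>C g n) = (\<Sum>n\<in>{m}. (c n * cinner v (e n)) *\<^sub>C g n)"
      using elim other by (intro sum.mono_neutral_right) auto
    then show ?case by simp
  qed
qed

text \<open>A diagonal operator with non-increasing entries is its own singular value decomposition, which
  also yields its compactness.\<close>

lemma diagonal_svd:
  fixes e :: "nat \<Rightarrow> 'a::complex_hilbert"
  assumes e: "orthonormal_on UNIV e" and s: "decseq s" "\<And>n. 0 \<le> s n" "s \<longlonglongrightarrow> 0"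
  obtains x where "svd x s e e"
proof -
  have s0: "s n \<le> s 0" for n
    using s(1) by (simp add: decseq_def)
  obtain x where x: "\<And>v. (\<lambda>N. \<Sum>n<N. (complex_of_real (s n) * cinner v (e n)) *\<^sub>C e n) \<longlonglongrightarrow> bop_apply x v"
    by (rule orthonormal_series_operator[OF e e, of "\<lambda>n. complex_of_real (s n)" "s 0"])
       (use s s0 in auto)
  note eS = orthonormal_imp_suborthonormal[OF e]
  have "svd x s e e"
    unfolding svd_def
  proof (intro conjI allI impI e eS s)
    show "bop_apply x (e n) = s n *\<^sub>R e n" for n
      using orthonormal_series_eval[OF x[of "e n"], where m = n] e
      by (simp add: orthonormal_on_def scaleR_scaleC)
    show "norm (e n) = 1" for n
      using e by (simp add: orthonormal_on_norm)
  next
    fix n v assume v: "\<forall>i<n. cinner v (e i) = 0"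
    have "norm (\<Sum>m<N. (complex_of_real (s m) * cinner v (e m)) *\<^sub>C e m) \<le> s n * norm v" for N
    proof (rule power2_le_imp_le)
      have "(norm (\<Sum>m<N. (complex_of_real (s m) * cinner v (e m)) *\<^sub>C e m))\<^sup>2
          \<le> (\<Sum>m<N. (cmod (complex_of_real (s m) * cinner v (e m)))\<^sup>2)"
        by (intro norm_sum_suborthonormal_le suborthonormal_on_subset[OF eS]) auto
      also have "\<dots> \<le> (\<Sum>m<N. (s n)\<^sup>2 * (cmod (cinner v (e m)))\<^sup>2)"
      proof (rule sum_mono)
        fix m
        show "(cmod (complex_of_real (s m) * cinner v (e m)))\<^sup>2 \<le> (s n)\<^sup>2 * (cmod (cinner v (e m)))\<^sup>2"
        proof (cases "m < n")
          case False
          then have "s m \<le> s n"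
            using s(1) by (simp add: decseq_def)
          then show ?thesis
            using s(2) by (auto simp: norm_mult power_mult_distrib intro!: mult_right_mono power_mono)
        qed (use v in simp)
      qed
      also have "\<dots> \<le> (s n)\<^sup>2 * (norm v)\<^sup>2"
        unfolding sum_distrib_left[symmetric]
        by (intro mult_left_mono Bessel suborthonormal_on_subset[OF eS]) auto
      finally show "(norm (\<Sum>m<N. (complex_of_real (s m) * cinner v (e m)) *\<^sub>C e m))\<^sup>2 \<le> (s n * norm v)\<^sup>2"
        by (simp add: power_mult_distrib)
    qed (use s in simp)
    then show "norm (bop_apply x v) \<le> s n * norm v"
      by (intro Lim_bounded[OF tendsto_norm[OF x], of 0]) auto
    fix i assume i: "i < n"
    have "cinner (\<Sum>m<N. (complex_of_real (s m) * cinner v (e m)) *\<^sub>C e m) (e i) = 0" for N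
      unfolding cinner_sum_left using v i e
      by (intro sum.neutral) (auto simp: cinner_linear orthonormal_on_def)
    then show "cinner (bop_apply x v) (e i) = 0"
      using LIMSEQ_unique[OF tendsto_cinner_left[OF x]] by simp
  qed
  then show thesis by (rule that)
qed

lemma svd_compact: "svd x s e f \<Longrightarrow> compact_bop x"
  by (rule compact_bop_limit[OF compact_svd_head svd_head_tendsto])

lemma norm_adjoint_apply_le: "norm (bop_apply (adjoint_bop x) u) \<le> norm x * norm u"
proof -
  define w where "w = bop_apply (adjoint_bop x) u"
  have "(norm w)\<^sup>2 = cmod (cinner (bop_apply x w) u)"
    by (simp add: cinner_adjoint w_def cinner_norm norm_power)
  also have "\<dots> \<le> norm (bop_apply x w) * norm u"
    by (rule cmod_cinner_le)
  also have "\<dots> \<le> norm x * norm w * norm u"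
    by (intro mult_right_mono norm_bop_apply) auto
  finally have "norm w * norm w \<le> norm w * (norm x * norm u)"
    by (simp add: power2_eq_square mult_ac)
  then show ?thesis
    unfolding w_def[symmetric] by (cases "norm w = 0") (auto simp: mult_le_cancel_left)
qed

context
  assumes inf: "infinite_dimensional TYPE('a::complex_hilbert)"
begin

text \<open>Two-sided multiplication by contractions maps rank one operators to rank one operators of
  no larger norm, so it does not increase Ky Fan sums and hence not the trace norm.\<close>

lemma dunford_schwartz_multiplication:
  fixes V W :: "'a bop"
  assumes V: "norm V \<le> 1" and W: "norm W \<le> 1"
  shows "dunford_schwartz (\<lambda>x. bop_comp V (bop_comp x W))"
proof -
  define T where "T x = bop_comp V (bop_comp x W)" for x
  have T_clinear: "clinear T"
    by (auto simp: clinear_iff T_def bop_comp_linear bop_ops bop_apply_linear intro!: bop_eqI)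
  then have T_linear: "linear T"
    by (auto simp: clinear_iff linear_iff scaleR_scaleC)
  have T_norm: "norm (T x) \<le> norm x" for x
  proof -
    have "norm (T x) \<le> norm V * (norm x * norm W)"
      unfolding T_def by (rule order_trans[OF norm_bop_comp]) (intro mult_left_mono norm_bop_comp norm_ge_zero)
    also have "\<dots> \<le> 1 * (norm x * 1)"
      using V W by (intro mult_mono) auto
    finally show ?thesis by simp
  qed
  have T_rank: "T (rank_one f e) = rank_one (bop_apply V f) (bop_apply (adjoint_bop W) e)" for e f
    by (rule bop_eqI) (simp add: T_def bop_ops rank_one.rep_eq bop_apply_linear cinner_adjoint)
  have "trace_norm (T x) \<le> trace_norm x" if x: "x \<in> trace_class" for x
  proof -
    define C where "C = enn2real (trace_norm x)"
    have C: "trace_norm x = ennreal C" "0 \<le> C"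
      using x by (auto simp: C_def trace_class_def)
    have c: "compact_bop x"
      using C by (intro trace_class_compact[of x C]) auto
    define s where "s = singular_values x"
    obtain e f where svd: "svd x s e f"
      using compact_svd[OF inf c] unfolding s_def by blast
    have "bounded_linear T"
      using T_norm T_linear by (intro bounded_linear_intro[of T 1]) (auto simp: linear_add linear_scale)
    then have "(\<lambda>N. T (svd_head s e f N)) \<longlonglongrightarrow> T x"
      using svd_head_tendsto[OF svd] by (rule bounded_linear.tendsto)
    moreover have "compact_bop (T (svd_head s e f N))" for N
      unfolding svd_head_def linear_sum[OF T_linear] linear_scale[OF T_linear] T_rank
      by (intro compact_bop_sum compact_bop_scaleR compact_rank_one)
    ultimately have cT: "compact_bop (T x)"
      by (rule compact_bop_limit[rotated])
    have "kyfan_le k (T (rank_one (f n) (e n))) 1" for k n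
      unfolding T_rank
    proof (rule kyfan_le_rank_one)
      have "norm W * norm (e n) \<le> 1 * 1"
        using W svd_facts(8)[OF svd] by (intro mult_mono) auto
      then show "norm (bop_apply (adjoint_bop W) (e n)) \<le> 1"
        using norm_adjoint_apply_le[of W "e n"] by simp
      have "norm V * norm (f n) \<le> 1 * 1"
        using V svd_facts(9)[OF svd] by (intro mult_mono) auto
      then show "norm (bop_apply V (f n)) \<le> 1"
        using norm_bop_apply[of V "f n"] by simp
    qed
    then have "kyfan_le k (T (x - svd_head s e f 0)) (\<Sum>i<k. s (0 + i))" for k
      by (rule kyfan_le_transfer[OF svd T_linear T_norm])
    then have kf: "kyfan_le k (T x) (\<Sum>i<k. s i)" for k
      by (simp add: svd_head_def)
    have "(\<Sum>i<k. s i) \<le> C" for k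
      using trace_norm_le_imp_kyfan[OF inf eq_refl[OF C(1)] C(2), of k] by (simp add: kyfan_le_iff[OF inf c] s_def)
    then have "kyfan_le k (T x) C" for k
      by (rule kyfan_le_mono[OF kf])
    then show ?thesis
      unfolding C(1) by (intro trace_norm_leI[OF inf cT] C(2))
  qed
  then show ?thesis
    using T_clinear T_norm by (simp add: dunford_schwartz_def T_def[abs_def])
qed

end

context fully_symmetric_space
begin

context
  assumes inf: "infinite_dimensional TYPE('a::complex_hilbert)" and c0: "E \<subseteq> c0"
    and conv: "\<And>(T :: 'a bop \<Rightarrow> 'a bop) x. dunford_schwartz T \<Longrightarrow> x \<in> op_ideal E \<Longrightarrow>
      \<exists>y\<in>op_ideal E. (\<lambda>n. op_ideal_norm norm_E (ergodic_average T n x - y)) \<longlonglongrightarrow> 0"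
begin

text \<open>The Cesaro means of the right shifts of \<open>s\<close>, in the coordinate \<open>m\<close>.\<close>

definition shift_average :: "(nat \<Rightarrow> real) \<Rightarrow> nat \<Rightarrow> nat \<Rightarrow> real"
  where "shift_average s n m = (\<Sum>k=0..n. if k \<le> m then s (m - k) else 0) / real (n + 1)"

text \<open>Let \<open>T x = V x V*\<close> with \<open>V e\<^sub>n = e\<^bsub>n+1\<^esub>\<close>, and apply the hypothesis to \<open>T\<close> and the
  diagonal operator with entries \<open>s\<^sub>n\<close>. The averages are diagonal on the \<open>e\<^sub>m\<close> with entries
  \<open>shift_average s n m\<close>, which tend to 0 for fixed \<open>m\<close>; so the limit operator vanishes on the
  \<open>e\<^sub>m\<close>, and sums of entries bound the Ky Fan sums of the differences from below.\<close>

lemma shift_average_small: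
  assumes s: "decseq s" "\<And>n. 0 \<le> s n" "embed s \<in> E"
  obtains \<zeta> :: "nat \<Rightarrow> nat \<Rightarrow> real" where "\<And>n. decseq (\<zeta> n)" "\<And>n i. 0 \<le> \<zeta> n i" "\<And>n. embed (\<zeta> n) \<in> E"
    "(\<lambda>n. norm_E (embed (\<zeta> n))) \<longlonglongrightarrow> 0"
    "\<And>n j k. (\<Sum>i<k. shift_average s n (j + i)) \<le> (\<Sum>i<k. \<zeta> n i)"
proof -
  have "positive_bop (0 :: 'a bop)"
    by (simp add: positive_bop_def bop_ops)
  then obtain e :: "nat \<Rightarrow> 'a" where e: "orthonormal_on UNIV e"
    by (rule positive_compact_spectral[OF inf _ compact_bop_zero])
  then have e': "orthonormal_on UNIV (\<lambda>n. e (Suc n))"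
    by (simp add: orthonormal_on_def)
  have s_lim: "s \<longlonglongrightarrow> 0"
    using s(3) c0 tendsto_of_real_iff[of s 0, where 'a = complex] by (auto simp: c0_def)
  obtain x where svd: "svd x s e e"
    by (rule diagonal_svd[OF e s(1,2) s_lim])
  have xE: "x \<in> op_ideal E"
    by (rule op_ideal_kyfan(1)[OF inf svd_compact[OF svd] s svd_kyfan[OF svd]])
  obtain V where V: "norm V \<le> 1" "\<And>v. (\<lambda>N. \<Sum>n<N. (1 * cinner v (e n)) *\<^sub>C e (Suc n)) \<longlonglongrightarrow> bop_apply V v"
    by (rule orthonormal_series_operator[OF e e', of "\<lambda>_. 1" 1]) auto
  obtain W where W: "norm W \<le> 1" "\<And>v. (\<lambda>N. \<Sum>n<N. (1 * cinner v (e (Suc n))) *\<^sub>C e n) \<longlonglongrightarrow> bop_apply W v"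
    by (rule orthonormal_series_operator[OF e' e, of "\<lambda>_. 1" 1]) auto
  have Ve: "bop_apply V (e n) = e (Suc n)" for n
    using orthonormal_series_eval[OF V(2)[of "e n"], where m = n] e
    by (simp add: orthonormal_on_def complex_vector.scale_one)
  have We: "bop_apply W (e (Suc n)) = e n" for n
    using orthonormal_series_eval[OF W(2)[of "e (Suc n)"], where m = n] e
    by (simp add: orthonormal_on_def complex_vector.scale_one)
  have W0: "bop_apply W (e 0) = 0"
    using orthonormal_series_eval[OF W(2)[of "e 0"], where m = 0] e
    by (simp add: orthonormal_on_def complex_vector.scale_zero_left)
  define T where "T z = bop_comp V (bop_comp z W)" for z
  have T: "dunford_schwartz T"
    unfolding T_def[abs_def] using V(1) W(1) by (rule dunford_schwartz_multiplication[OF inf])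
  obtain y where y: "y \<in> op_ideal E" "(\<lambda>n. op_ideal_norm norm_E (ergodic_average T n x - y)) \<longlonglongrightarrow> 0"
    using conv[OF T xE] by blast
  interpret E: contraction_on "op_ideal E" "op_ideal_norm norm_E" T
    by (rule dunford_schwartz_contraction_on_ideal[OF inf T])
  have pow: "bop_apply ((T ^^ k) x) (e m) = (if k \<le> m then s (m - k) else 0) *\<^sub>R e m" for k m
  proof (induction k arbitrary: m)
    case 0
    then show ?case by (simp add: svd_facts(6)[OF svd])
  next
    case (Suc k)
    then show ?case
      by (cases m) (simp_all add: T_def[of "(T ^^ k) x"] bop_ops W0 We Ve bop_apply_linear)
  qed
  define a where "a = shift_average s"
  have avg: "bop_apply (E.A n x) (e m) = a n m *\<^sub>R e m" for n m
    by (simp add: ergodic_average_def bop_ops bop_sum pow a_def shift_average_def flip: scaleR_sum_left)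
  define z where "z n = E.A n x - y" for n
  have z: "z n \<in> op_ideal E" for n
    unfolding z_def by (intro E.W_diff E.A_mem xE y)
  have "(\<lambda>n. norm (z n)) \<longlonglongrightarrow> 0"
  proof (rule tendsto_sandwich[where f = "\<lambda>_. 0", OF _ _ tendsto_const])
    show "(\<lambda>n. op_ideal_norm norm_E (z n) / \<phi> 1) \<longlonglongrightarrow> 0"
      using tendsto_divide[OF y(2) tendsto_const[of "\<phi> 1"]] \<phi>_1_pos by (simp add: z_def)
  qed (use norm_le_op_ideal_norm[OF inf z] in auto)
  then have z_lim: "z \<longlonglongrightarrow> 0"
    by (simp add: tendsto_norm_zero_iff)
  have ye: "bop_apply y (e m) = 0" for m
  proof (rule LIMSEQ_unique)
    define C where "C = (\<Sum>k=0..m. s (m - k))"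
    have a_le: "\<bar>a n m\<bar> \<le> C / real (n + 1)" for n
    proof -
      have "(\<Sum>k=0..n. if k \<le> m then s (m - k) else 0) = (\<Sum>k\<in>{0..n} \<inter> {0..m}. s (m - k))"
        by (subst sum.inter_restrict) (auto intro!: sum.cong)
      also have "\<dots> \<le> C"
        unfolding C_def using s(2) by (intro sum_mono2) auto
      finally show ?thesis
        using s(2) by (auto simp: a_def shift_average_def abs_of_nonneg sum_nonneg intro!: divide_right_mono)
    qed
    have lim0: "(\<lambda>n. C / real (n + 1)) \<longlonglongrightarrow> 0"
      using tendsto_mult[OF tendsto_const[of C] LIMSEQ_inverse_real_of_nat] by (simp add: divide_inverse)
    have "(\<lambda>n. \<bar>a n m\<bar>) \<longlonglongrightarrow> 0"
      by (rule tendsto_sandwich[where f = "\<lambda>_. 0", OF _ _ tendsto_const lim0])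
         (intro always_eventually allI abs_ge_zero a_le)+
    then have "(\<lambda>n. a n m) \<longlonglongrightarrow> 0"
      by (simp add: tendsto_rabs_zero_iff)
    then have "(\<lambda>n. a n m *\<^sub>R e m - bop_apply (z n) (e m)) \<longlonglongrightarrow> 0 *\<^sub>R e m - bop_apply 0 (e m)"
      by (intro tendsto_intros tendsto_bop_apply z_lim)
    then show "(\<lambda>n. a n m *\<^sub>R e m - bop_apply (z n) (e m)) \<longlonglongrightarrow> 0"
      by (simp add: bop_ops)
    have "a n m *\<^sub>R e m - bop_apply (z n) (e m) = bop_apply y (e m)" for n
      by (simp add: z_def bop_ops avg)
    then show "(\<lambda>n. a n m *\<^sub>R e m - bop_apply (z n) (e m)) \<longlonglongrightarrow> bop_apply y (e m)"
      by simp
  qed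
  have ze: "bop_apply (z n) (e m) = a n m *\<^sub>R e m" for n m
    by (simp add: z_def bop_ops avg ye)
  note zc = op_ideal_compact[OF inf z]
  show thesis
  proof (rule that[of "\<lambda>n. singular_values (z n)"])
    fix n j k
    have sub: "suborthonormal_on {..<k} (\<lambda>i. e (j + i))"
      by (rule orthonormal_imp_suborthonormal) (use e in \<open>simp add: orthonormal_on_def\<close>)
    have "(\<Sum>i<k. shift_average s n (j + i)) \<le> (\<Sum>i<k. cmod (cinner (bop_apply (z n) (e (j + i))) (e (j + i))))"
      using e by (intro sum_mono) (simp add: ze a_def cinner_linear orthonormal_on_def)
    also have "\<dots> \<le> (\<Sum>i<k. singular_values (z n) i)"
      by (rule kyfan_leD[OF _ sub sub]) (simp add: kyfan_le_iff[OF inf zc])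
    finally show "(\<Sum>i<k. shift_average s n (j + i)) \<le> (\<Sum>i<k. singular_values (z n) i)" .
  next
    show "(\<lambda>n. norm_E (embed (singular_values (z n)))) \<longlonglongrightarrow> 0"
      using y(2) by (simp add: op_ideal_norm_def z_def)
    show "embed (singular_values (z n)) \<in> E" for n
      using z[of n] by (simp add: op_ideal_def)
  qed (use singular_values_props[OF inf zc] in auto)
qed

text \<open>For \<open>m \<ge> n\<close> the mean \<open>shift_average s n m\<close> is taken over \<open>s (m - n), ..., s m\<close>, all of them
  at least \<open>s m\<close>.\<close>

lemma convergence_imp_shift_tendsto_0:
  assumes s: "decseq s" "\<And>n. 0 \<le> s n" "embed s \<in> E"
  shows "(\<lambda>n. norm_E (embed (\<lambda>k. s (k + n)))) \<longlonglongrightarrow> 0"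
proof -
  obtain \<zeta> where \<zeta>: "\<And>n. decseq (\<zeta> n)" "\<And>n i. 0 \<le> \<zeta> n i" "\<And>n. embed (\<zeta> n) \<in> E"
    "(\<lambda>n. norm_E (embed (\<zeta> n))) \<longlonglongrightarrow> 0"
    "\<And>n j k. (\<Sum>i<k. shift_average s n (j + i)) \<le> (\<Sum>i<k. \<zeta> n i)"
    by (rule shift_average_small[OF s], rule that)
  have ge: "s (i + n) \<le> shift_average s n (n + i)" for i n
  proof -
    have "(\<Sum>k=0..n. s (i + n)) \<le> (\<Sum>k=0..n. if k \<le> n + i then s (n + i - k) else 0)"
      using s(1) by (intro sum_mono) (auto simp: decseq_def)
    then show ?thesis
      by (simp add: shift_average_def field_simps)
  qed
  have "norm_E (embed (\<lambda>k. s (k + n))) \<le> norm_E (embed (\<zeta> n))" for n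
  proof (rule dominated_decreasing(2)[OF _ _ \<zeta>(1,2,3)])
    show "(\<Sum>i<m. s (i + n)) \<le> (\<Sum>i<m. \<zeta> n i)" for m
      by (rule order_trans[OF sum_mono \<zeta>(5)]) (rule ge)
  qed (use s in \<open>auto simp: decseq_def\<close>)
  then show ?thesis
    by (intro tendsto_sandwich[where f = "\<lambda>_. 0", OF _ _ tendsto_const \<zeta>(4)] always_eventually allI
        norm_nonneg shift_le_tail(1)[OF s])
qed

text \<open>Starting from \<open>(1, 0, 0, ...)\<close>, the means are blocks of length \<open>n + 1\<close> and height \<open>1 / (n + 1)\<close>.\<close>

lemma convergence_imp_\<phi>_ratio_tendsto_0: "(\<lambda>n. \<phi> n / real n) \<longlonglongrightarrow> 0"
proof -
  obtain \<zeta> where \<zeta>: "\<And>n. decseq (\<zeta> n)" "\<And>n i. 0 \<le> \<zeta> n i" "\<And>n. embed (\<zeta> n) \<in> E"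
    "(\<lambda>n. norm_E (embed (\<zeta> n))) \<longlonglongrightarrow> 0"
    "\<And>n j k. (\<Sum>i<k. shift_average (block 1) n (j + i)) \<le> (\<Sum>i<k. \<zeta> n i)"
    by (rule shift_average_small[OF block_facts block_mem, of 1], rule that)
  have avg: "shift_average (block 1) n i = block (n + 1) i / real (n + 1)" for n i
  proof -
    have "(\<Sum>k=0..n. if k \<le> i then block 1 (i - k) else 0) = (\<Sum>k=0..n. if k = i then 1 else 0)"
      by (intro sum.cong refl) (auto simp: block_def)
    also have "\<dots> = block (n + 1) i"
      by (simp add: block_def)
    finally show ?thesis
      unfolding shift_average_def by (rule arg_cong)
  qed
  have le: "\<phi> (Suc n) / real (Suc n) \<le> norm_E (embed (\<zeta> n))" for n
  proof -
    have "norm_E (embed (\<lambda>i. block (n + 1) i / real (n + 1))) \<le> norm_E (embed (\<zeta> n))"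
    proof (rule dominated_decreasing(2)[OF _ _ \<zeta>(1,2,3)])
      show "(\<Sum>i<m. block (n + 1) i / real (n + 1)) \<le> (\<Sum>i<m. \<zeta> n i)" for m
        using \<zeta>(5)[of n 0 m] unfolding avg by simp
    qed (auto simp: block_def decseq_def)
    moreover have "norm_E (embed (\<lambda>i. block (n + 1) i / real (n + 1))) = \<phi> (n + 1) / real (n + 1)"
      using norm_scale[OF block_mem, of "complex_of_real (1 / real (n + 1))" "n + 1"]
      by (simp add: \<phi>_def norm_divide del: of_nat_Suc)
    ultimately show ?thesis by simp
  qed
  have "(\<lambda>n. \<phi> (Suc n) / real (Suc n)) \<longlonglongrightarrow> 0"
    by (intro tendsto_sandwich[where f = "\<lambda>_. 0", OF _ _ tendsto_const \<zeta>(4)] always_eventually allI le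
        divide_nonneg_nonneg \<phi>_nonneg of_nat_0_le_iff)
  then show ?thesis
    by (rule LIMSEQ_imp_Suc)
qed

theorem convergence_imp_separable: "separable_seq_space E norm_E"
  using c0 convergence_imp_shift_tendsto_0 by (rule separableI)

theorem convergence_imp_not_l1: "E \<noteq> l1"
  using convergence_imp_\<phi>_ratio_tendsto_0 by (rule \<phi>_ratio_imp_not_l1)

end

end

theorem theorem1p4:
  fixes E :: "(nat \<Rightarrow> complex) set" and norm_E :: "(nat \<Rightarrow> complex) \<Rightarrow> real"
  assumes "infinite_dimensional TYPE('a::complex_hilbert)"
    and "fully_symmetric_space E norm_E"
    and "E \<subseteq> c0"
  shows "(\<forall>T :: 'a bop \<Rightarrow> 'a bop. dunford_schwartz T \<longrightarrow>
            (\<forall>x\<in>op_ideal E. \<exists>y\<in>op_ideal E.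
              (\<lambda>n. op_ideal_norm norm_E (ergodic_average T n x - y)) \<longlonglongrightarrow> 0))
         \<longleftrightarrow> separable_seq_space E norm_E \<and> E \<noteq> l1"
proof -
  interpret fully_symmetric_space E norm_E by (rule assms)
  show ?thesis
  proof
    assume conv: "\<forall>T :: 'a bop \<Rightarrow> 'a bop. dunford_schwartz T \<longrightarrow>
      (\<forall>x\<in>op_ideal E. \<exists>y\<in>op_ideal E. (\<lambda>n. op_ideal_norm norm_E (ergodic_average T n x - y)) \<longlonglongrightarrow> 0)"
    show "separable_seq_space E norm_E \<and> E \<noteq> l1"
      using convergence_imp_separable[OF assms(1,3)] convergence_imp_not_l1[OF assms(1,3)] conv by blast
  next
    assume "separable_seq_space E norm_E \<and> E \<noteq> l1"
    then show "\<forall>T :: 'a bop \<Rightarrow> 'a bop. dunford_schwartz T \<longrightarrow>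
      (\<forall>x\<in>op_ideal E. \<exists>y\<in>op_ideal E. (\<lambda>n. op_ideal_norm norm_E (ergodic_average T n x - y)) \<longlonglongrightarrow> 0)"
      using averages_converge[OF assms(1)] by blast
  qed
qed

end
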